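(* Let $T>0$, $p\in(1,\infty]$, let $q$ be the conjugate exponent of $p$ (i.e. $\frac1p+\frac1q=1$), and let $\rho_0\in L^p(\Omega)$. Suppose that $u\in L^1(0,T;W_0^{1,q}(\Omega))$ with $\nabla\cdot u=0$. Then there exists a weak solution $\rho\in L^\infty(0,T;L^p(\Omega))$ of the transport equation $\rho_t-u\cdot\nabla\rho=0$ in $(0,T)\times\Omega$ with velocity field $u$ and initial density $\rho_0$.
   Context: $\Omega\subseteq\mathbb{R}^N$ is an open, bounded, connected and simply connected set with smooth boundary. The velocity field $u=u(x,t)$ is $\mathbb{R}^N$-valued, and $W_0^{1,q}(\Omega)$ is the closure of $C_c^\infty(\Omega)$ in the Sobolev space $W^{1,q}(\Omega)$ (here for $\mathbb{R}^N$-valued functions). $\nabla\cdot u=0$ is meant in the weak sense: for almost every $t$, $\int_\Omega u(x,t)\cdot\nabla\varphi(x)\,dx=0$ for every $\varphi\in C_c^\infty(\Omega)$. A function $\rho\in L^\infty(0,T;L^p(\Omega))$ (real-valued) is a weak solution of $\rho_t-u\cdot\nabla\rho=0$ with velocity field $u$ and initial density $\rho_0\in L^p(\Omega)$ if $$-\int_0^T\int_\Omega \rho\,\phi_t\,dx\,dt-\int_\Omega\rho_0(x)\phi(x,0)\,dx+\int_0^T\int_\Omega\rho\,(u\cdot\nabla\phi)\,dx\,dt=0$$ for every smooth real-valued $\phi$ with compact support in $[0,T)\times\Omega$. *)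

theory Defs
  imports "HOL-Analysis.Analysis" "HOL-Probability.Essential_Supremum"
begin

text \<open>Functions on an open set \<open>\<Omega>\<close> are total functions on the ambient space; their values outside
  \<open>\<Omega>\<close> play no role, and functions that agree almost everywhere in \<open>\<Omega>\<close> are not identified.\<close>

subsection \<open>Smooth functions and smooth boundaries\<close>

text \<open>Meant for open \<open>S\<close> only. As the domain is finite-dimensional, continuity of all
  directional derivatives of order at most \<open>k\<close> is the usual \<open>C\<^sup>k\<close> property.\<close>

primrec Ck_on :: "nat \<Rightarrow> 'a::euclidean_space set \<Rightarrow> ('a \<Rightarrow> 'b::real_normed_vector) \<Rightarrow> bool" where
  "Ck_on 0 S f \<longleftrightarrow> continuous_on S f"
| "Ck_on (Suc k) S f \<longleftrightarrow>
     (\<forall>x\<in>S. f differentiable (at x)) \<and> (\<forall>v. Ck_on k S (\<lambda>x. frechet_derivative f (at x) v))"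

definition smooth_on :: "'a::euclidean_space set \<Rightarrow> ('a \<Rightarrow> 'b::real_normed_vector) \<Rightarrow> bool" where
  "smooth_on S f \<longleftrightarrow> (\<forall>k. Ck_on k S f)"

definition test_functions :: "'a::euclidean_space set \<Rightarrow> ('a \<Rightarrow> 'b::real_normed_vector) set" where
  "test_functions \<Omega> =
     {\<phi>. smooth_on UNIV \<phi> \<and> compact (closure {x. \<phi> x \<noteq> 0}) \<and> closure {x. \<phi> x \<noteq> 0} \<subseteq> \<Omega>}"

definition grad :: "('a::euclidean_space \<Rightarrow> real) \<Rightarrow> 'a \<Rightarrow> 'a" where
  "grad \<phi> x = (\<Sum>b\<in>Basis. frechet_derivative \<phi> (at x) b *\<^sub>R b)"

text \<open>Near each boundary point \<open>\<Omega>\<close> is, up to relabelling and reflecting the coordinate axes, the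
  region strictly above the graph of a smooth function \<open>\<gamma>\<close> of the remaining coordinates;
  \<open>\<gamma>\<close> is encoded as a function on the whole space that does not depend on the coordinate along
  \<open>e\<close>.\<close>

definition smooth_boundary :: "'a::euclidean_space set \<Rightarrow> bool" where
  "smooth_boundary \<Omega> \<longleftrightarrow>
     (\<forall>z\<in>frontier \<Omega>. \<exists>r>0. \<exists>e\<in>Basis \<union> uminus ` Basis. \<exists>\<gamma> :: 'a \<Rightarrow> real.
        smooth_on UNIV \<gamma> \<and> (\<forall>x c. \<gamma> (x + c *\<^sub>R e) = \<gamma> x) \<and>
        \<Omega> \<inter> ball z r = {x \<in> ball z r. \<gamma> x < x \<bullet> e})"

subsection \<open>Lebesgue and Sobolev spaces\<close>

definition Lp_norm :: "ennreal \<Rightarrow> 'a::euclidean_space set \<Rightarrow> ('a \<Rightarrow> 'b::euclidean_space) \<Rightarrow> ennreal" where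
  "Lp_norm p \<Omega> f =
     (if p = \<infinity> then esssup (lebesgue_on \<Omega>) (\<lambda>x. ennreal (norm (f x)))
      else let I = (\<integral>\<^sup>+ x. ennreal (norm (f x) powr enn2real p) \<partial>lebesgue_on \<Omega>)
           in if I = \<infinity> then \<infinity> else ennreal (enn2real I powr (1 / enn2real p)))"

definition Lp_space :: "ennreal \<Rightarrow> 'a::euclidean_space set \<Rightarrow> ('a \<Rightarrow> 'b::euclidean_space) set" where
  "Lp_space p \<Omega> = {f. f \<in> borel_measurable (lebesgue_on \<Omega>) \<and> Lp_norm p \<Omega> f < \<infinity>}"

definition locally_integrable_on :: "'a::euclidean_space set \<Rightarrow> ('a \<Rightarrow> 'b::euclidean_space) \<Rightarrow> bool" where
  "locally_integrable_on \<Omega> f \<longleftrightarrow> (\<forall>K. compact K \<and> K \<subseteq> \<Omega> \<longrightarrow> integrable (lebesgue_on K) f)"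

definition has_weak_partial ::
  "'a::euclidean_space set \<Rightarrow> 'a \<Rightarrow> ('a \<Rightarrow> 'b::euclidean_space) \<Rightarrow> ('a \<Rightarrow> 'b) \<Rightarrow> bool" where
  "has_weak_partial \<Omega> b f g \<longleftrightarrow>
     locally_integrable_on \<Omega> f \<and> locally_integrable_on \<Omega> g \<and>
     (\<forall>\<phi> :: 'a \<Rightarrow> real. \<phi> \<in> test_functions \<Omega> \<longrightarrow>
        (LINT x|lebesgue_on \<Omega>. frechet_derivative \<phi> (at x) b *\<^sub>R f x) =
        - (LINT x|lebesgue_on \<Omega>. \<phi> x *\<^sub>R g x))"

text \<open>Unique up to null sets, where it exists.\<close>

definition weak_partial ::
  "'a::euclidean_space set \<Rightarrow> 'a \<Rightarrow> ('a \<Rightarrow> 'b::euclidean_space) \<Rightarrow> 'a \<Rightarrow> 'b" where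
  "weak_partial \<Omega> b f = (SOME g. has_weak_partial \<Omega> b f g)"

definition W1_space :: "ennreal \<Rightarrow> 'a::euclidean_space set \<Rightarrow> ('a \<Rightarrow> 'b::euclidean_space) set" where
  "W1_space q \<Omega> =
     {f \<in> Lp_space q \<Omega>. \<forall>b\<in>Basis. \<exists>g\<in>Lp_space q \<Omega>. has_weak_partial \<Omega> b f g}"

text \<open>The norm of \<open>W\<^sup>1\<^sup>,\<^sup>q\<close>; meaningful only for functions that have weak partial derivatives.\<close>

definition W1_norm :: "ennreal \<Rightarrow> 'a::euclidean_space set \<Rightarrow> ('a \<Rightarrow> 'b::euclidean_space) \<Rightarrow> ennreal" where
  "W1_norm q \<Omega> f = Lp_norm q \<Omega> f + (\<Sum>b\<in>Basis. Lp_norm q \<Omega> (weak_partial \<Omega> b f))"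

definition W10_space :: "ennreal \<Rightarrow> 'a::euclidean_space set \<Rightarrow> ('a \<Rightarrow> 'b::euclidean_space) set" where
  "W10_space q \<Omega> =
     {f \<in> W1_space q \<Omega>. \<forall>\<epsilon>>0. \<exists>\<phi>\<in>test_functions \<Omega>. W1_norm q \<Omega> (f - \<phi>) < \<epsilon>}"

subsection \<open>Functions of time with values in a function space\<close>

text \<open>Strong (Bochner) measurability on \<open>(0,T)\<close> with respect to a space \<open>X\<close> normed by \<open>nrm\<close>.
  The spaces above are sets of functions, not Banach space types, so the library's Bochner
  integral does not apply to them.\<close>

definition bochner_measurable ::
  "real \<Rightarrow> 'b::minus set \<Rightarrow> ('b \<Rightarrow> ennreal) \<Rightarrow> (real \<Rightarrow> 'b) \<Rightarrow> bool" where
  "bochner_measurable T X nrm f \<longleftrightarrow>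
     (AE t in lebesgue_on {0<..<T}. f t \<in> X) \<and>
     (\<exists>s. (\<forall>n. simple_function (lebesgue_on {0<..<T}) (s n) \<and> (\<forall>t\<in>{0<..<T}. s n t \<in> X)) \<and>
          (AE t in lebesgue_on {0<..<T}. (\<lambda>n::nat. nrm (f t - s n t)) \<longlonglongrightarrow> 0))"

definition L1_time :: "real \<Rightarrow> 'b::minus set \<Rightarrow> ('b \<Rightarrow> ennreal) \<Rightarrow> (real \<Rightarrow> 'b) set" where
  "L1_time T X nrm =
     {f. bochner_measurable T X nrm f \<and> (\<integral>\<^sup>+ t. nrm (f t) \<partial>lebesgue_on {0<..<T}) < \<infinity>}"

text \<open>\<open>L\<^sup>\<infinity>(0,T;L\<^sup>p(\<Omega>))\<close>. For \<open>p = \<infinity>\<close> strong measurability is not required: the space is then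
  understood, as usual, as \<open>L\<^sup>\<infinity>((0,T) \<times> \<Omega>)\<close>, since the non-separability of \<open>L\<^sup>\<infinity>(\<Omega>)\<close> means that
  already the transport of an indicator function by a smooth flow fails to be strongly measurable.\<close>

definition Linf_time_Lp ::
  "real \<Rightarrow> ennreal \<Rightarrow> 'a::euclidean_space set \<Rightarrow> (real \<Rightarrow> 'a \<Rightarrow> real) set" where
  "Linf_time_Lp T p \<Omega> =
     {\<rho>. (\<lambda>(t, x). \<rho> t x) \<in> borel_measurable (lebesgue_on ({0<..<T} \<times> \<Omega>)) \<and>
         (p < \<infinity> \<longrightarrow> bochner_measurable T (Lp_space p \<Omega>) (Lp_norm p \<Omega>) \<rho>) \<and>
         (\<exists>C::real. AE t in lebesgue_on {0<..<T}.
            \<rho> t \<in> Lp_space p \<Omega> \<and> Lp_norm p \<Omega> (\<rho> t) \<le> ennreal C)}"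

subsection \<open>The transport equation\<close>

definition weakly_divergence_free ::
  "real \<Rightarrow> 'a::euclidean_space set \<Rightarrow> (real \<Rightarrow> 'a \<Rightarrow> 'a) \<Rightarrow> bool" where
  "weakly_divergence_free T \<Omega> u \<longleftrightarrow>
     (AE t in lebesgue_on {0<..<T}. \<forall>\<phi>\<in>test_functions \<Omega>.
        (LINT x|lebesgue_on \<Omega>. u t x \<bullet> grad \<phi> x) = 0)"

text \<open>Smooth functions with compact support in \<open>[0,T) \<times> \<Omega>\<close>; they need not vanish at time \<open>0\<close>, and
  smoothness up to time \<open>0\<close> is expressed by a smooth extension to negative times.\<close>

definition spacetime_test_functions ::
  "real \<Rightarrow> 'a::euclidean_space set \<Rightarrow> (real \<times> 'a \<Rightarrow> real) set" where
  "spacetime_test_functions T \<Omega> =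
     {\<phi>. smooth_on ({..<T} \<times> \<Omega>) \<phi> \<and>
         compact (closure {z \<in> {0..<T} \<times> \<Omega>. \<phi> z \<noteq> 0}) \<and>
         closure {z \<in> {0..<T} \<times> \<Omega>. \<phi> z \<noteq> 0} \<subseteq> {0..<T} \<times> \<Omega>}"

definition transport_weak_solution ::
  "real \<Rightarrow> ennreal \<Rightarrow> 'a::euclidean_space set \<Rightarrow> (real \<Rightarrow> 'a \<Rightarrow> 'a) \<Rightarrow> ('a \<Rightarrow> real) \<Rightarrow>
    (real \<Rightarrow> 'a \<Rightarrow> real) \<Rightarrow> bool" where
  "transport_weak_solution T p \<Omega> u \<rho>0 \<rho> \<longleftrightarrow>
     \<rho> \<in> Linf_time_Lp T p \<Omega> \<and>
     (\<forall>\<phi>\<in>spacetime_test_functions T \<Omega>.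
        - (LINT t|lebesgue_on {0<..<T}. LINT x|lebesgue_on \<Omega>.
             \<rho> t x * deriv (\<lambda>s. \<phi> (s, x)) t)
        - (LINT x|lebesgue_on \<Omega>. \<rho>0 x * \<phi> (0, x))
        + (LINT t|lebesgue_on {0<..<T}. LINT x|lebesgue_on \<Omega>.
             \<rho> t x * (u t x \<bullet> grad (\<lambda>y. \<phi> (t, y)) x)) = 0)"

end

theory Submission
  imports Defs "HOL-Library.Function_Algebras"
begin

text \<open>The solution is obtained by duality, without regularising \<open>u\<close>.  Write
  \<open>L \<phi> = - \<phi>\<^sub>t + u \<bullet> \<nabla>\<phi>\<close>.  A density \<open>\<rho>\<close> is a weak solution iff \<open>\<integral>\<integral> \<rho> L \<phi> = \<integral> \<rho>\<^sub>0 \<phi>(0)\<close> for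
  all test functions \<open>\<phi>\<close>.  For smooth convex increasing \<open>\<beta>\<close> with \<open>\<beta>(0) = 0\<close> the function \<open>\<beta>(\<phi>(t))\<close>
  is itself a test function on \<open>\<Omega>\<close>, so \<open>\<integral> u \<bullet> \<nabla>\<beta>(\<phi>(t)) = 0\<close>; letting \<open>\<beta>(s)\<close> approach
  \<open>(s\<^sup>+)\<^sup>q\<close> yields the a priori estimate
  \<open>\<parallel>\<phi>(0)\<^sup>+\<parallel>\<^sub>q \<le> q \<integral>\<^sub>0\<^sup>T \<parallel>(L \<phi>)\<^sup>+(t)\<parallel>\<^sub>q dt\<close>.  Hence for \<open>\<rho>\<^sub>0 \<ge> 0\<close> the functional
  \<open>L \<phi> \<mapsto> \<integral> \<rho>\<^sub>0 \<phi>(0)\<close> extends, by Hahn--Banach, to a functional that is bounded by a multiple of the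
  one-sided \<open>L\<^sup>1(0,T;L\<^sup>q)\<close> norm.  The one-sided bound makes it positive, so Radon--Nikodym represents
  it by a density \<open>\<rho> \<ge> 0\<close>, and testing with powers of truncations of \<open>\<rho>\<close> bounds \<open>\<rho>\<close> in
  \<open>L\<^sup>\<infinity>(0,T;L\<^sup>p)\<close>.  General data are split into positive and negative parts.\<close>

subsection \<open>Functions as a real vector space\<close>

text \<open>Only existence is claimed, so the arbitrary choice made by an extension theorem does no
  harm. The chain rule is applied to smooth \<phi> alone, never to \<rho>, and the estimate runs
  backward in time: \<phi> vanishes near T, so \<phi>(t) is controlled by the values of
  \<open>L \<phi>\<close> after t, the flux term having integral zero.

  Two obstacles shape the rest. First, \<open>L \<phi>\<close> contains the velocity and is
  unbounded in general, so the functional has to live on a space of functions dominated by multiples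
  of \<open>1 + |u|\<close>, not on bounded functions. Secondly, u is given time by time, as a map
  into a function space, whereas Fubini needs a jointly measurable function. So u is replaced by a
  representative w that agrees with it for almost every t, almost everywhere in x. At the other end
  the density comes out jointly measurable, and for finite p its strong measurability in time has to
  be recovered.\<close>

instantiation "fun" :: (type, real_vector) real_vector
begin

definition "scaleR c f = (\<lambda>x. c *\<^sub>R f x)"

instance
  by standard (simp_all add: scaleR_fun_def fun_eq_iff scaleR_add_right scaleR_add_left)

end

lemma scaleR_fun_apply [simp]: "(c *\<^sub>R f) x = c *\<^sub>R f x"
  by (simp add: scaleR_fun_def)

subsection \<open>The Hahn--Banach theorem\<close>

text \<open>Linear functionals on subspaces are represented by their graphs, so that the chains in Zorn's
  lemma are ordered by inclusion.  A linear graph below a sublinear functional is automatically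
  single-valued.\<close>

definition graph_below :: "'v::real_vector set \<Rightarrow> ('v \<Rightarrow> real) \<Rightarrow> ('v \<times> real) set \<Rightarrow> bool" where
  "graph_below V P G \<longleftrightarrow> subspace G \<and> fst ` G \<subseteq> V \<and> (\<forall>(x, a)\<in>G. a \<le> P x)"

text \<open>The value at \<open>z\<close> must lie above every \<open>a - P (x - z)\<close> and
  below every \<open>P (y + z) - b\<close>. Subadditivity makes these demands compatible, and the
  supremum \<open>c\<close> of the lower ones meets both. Only the directions \<open>z\<close> and
  \<open>- z\<close> matter, since positive homogeneity rescales every other multiple to one of
  them.\<close>

lemma graph_below_extend:
  fixes P :: "'v::real_vector \<Rightarrow> real"
  assumes V: "subspace V"
    and add: "\<And>x y. x \<in> V \<Longrightarrow> y \<in> V \<Longrightarrow> P (x + y) \<le> P x + P y"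
    and scale: "\<And>c x. c > 0 \<Longrightarrow> x \<in> V \<Longrightarrow> P (c *\<^sub>R x) = c * P x"
    and G: "graph_below V P G" and z: "z \<in> V"
  shows "\<exists>H. graph_below V P H \<and> G \<subseteq> H \<and> z \<in> fst ` H"
proof -
  have sub: "subspace G" and dom: "\<And>x a. (x, a) \<in> G \<Longrightarrow> x \<in> V"
    and le: "\<And>x a. (x, a) \<in> G \<Longrightarrow> a \<le> P x"
    using G by (auto simp: graph_below_def)
  have zero: "(0, 0) \<in> G"
    using subspace_0[OF sub] by (simp add: zero_prod_def)
  define lower where "lower = {a - P (x - z) | x a. (x, a) \<in> G}"
  define c where "c = Sup lower"
  have cross: "a - P (x - z) \<le> P (y + z) - b" if "(x, a) \<in> G" "(y, b) \<in> G" for x a y b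
  proof -
    have "(x, a) + (y, b) \<in> G"
      using subspace_add[OF sub that] .
    then have "a + b \<le> P (x + y)"
      using le by simp
    also have "\<dots> = P ((x - z) + (y + z))"
      by simp
    also have "\<dots> \<le> P (x - z) + P (y + z)"
      using that z V dom by (intro add) (auto intro: subspace_diff subspace_add)
    finally show ?thesis
      by simp
  qed
  have ne: "lower \<noteq> {}"
    using zero by (auto simp: lower_def)
  have bdd: "bdd_above lower"
    using cross[OF _ zero] by (auto simp: lower_def intro!: bdd_aboveI)
  have c_ge: "a - P (x - z) \<le> c" if "(x, a) \<in> G" for x a
    unfolding c_def by (rule cSup_upper[OF _ bdd]) (use that in \<open>auto simp: lower_def\<close>)
  have c_le: "c \<le> P (y + z) - b" if "(y, b) \<in> G" for y b
    unfolding c_def by (rule cSup_least[OF ne]) (use that cross in \<open>auto simp: lower_def\<close>)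
  define H where "H = (\<Union>g\<in>G. range (\<lambda>s. g + s *\<^sub>R (z, c)))"
  have Hmem: "h \<in> H \<longleftrightarrow> (\<exists>g\<in>G. \<exists>s. h = g + s *\<^sub>R (z, c))" for h
    unfolding H_def by blast
  have "subspace H"
  proof (rule subspaceI)
    show "0 \<in> H"
      unfolding Hmem using subspace_0[OF sub] by (intro bexI[of _ 0] exI[of _ 0]) (simp_all add: zero_prod_def)
  next
    fix h k assume "h \<in> H" "k \<in> H"
    then obtain g s g' s' where "g \<in> G" "g' \<in> G" "h = g + s *\<^sub>R (z, c)" "k = g' + s' *\<^sub>R (z, c)"
      unfolding Hmem by blast
    moreover have "g + s *\<^sub>R (z, c) + (g' + s' *\<^sub>R (z, c)) = (g + g') + (s + s') *\<^sub>R (z, c)"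
      by (simp add: algebra_simps scaleR_add_left)
    ultimately show "h + k \<in> H"
      unfolding Hmem using subspace_add[OF sub] by blast
  next
    fix h and r :: real assume "h \<in> H"
    then obtain g s where "g \<in> G" "h = g + s *\<^sub>R (z, c)"
      unfolding Hmem by blast
    moreover have "r *\<^sub>R (g + s *\<^sub>R (z, c)) = r *\<^sub>R g + (r * s) *\<^sub>R (z, c)"
      by (simp add: scaleR_add_right)
    ultimately show "r *\<^sub>R h \<in> H"
      unfolding Hmem using subspace_scale[OF sub] by blast
  qed
  moreover have "a + s * c \<le> P (x + s *\<^sub>R z)" if g: "(x, a) \<in> G" for x a s
  proof -
    consider "s = 0" | "s > 0" | "s < 0"
      by linarith
    then show ?thesis
    proof cases
      case 1
      then show ?thesis using le[OF g] by simp
    next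
      case 2
      have "(1 / s) *\<^sub>R (x, a) \<in> G"
        using subspace_scale[OF sub g] .
      then have "c \<le> P ((1 / s) *\<^sub>R x + z) - a / s"
        using c_le by simp
      then have "a + s * c \<le> s * P ((1 / s) *\<^sub>R x + z)"
        using 2 by (simp add: field_simps)
      also have "\<dots> = P (s *\<^sub>R ((1 / s) *\<^sub>R x + z))"
        using 2 dom[OF g] z V by (intro scale[symmetric]) (auto intro: subspace_add subspace_scale)
      finally show ?thesis
        using 2 by (simp add: scaleR_add_right)
    next
      case 3
      have "(1 / - s) *\<^sub>R (x, a) \<in> G"
        using subspace_scale[OF sub g] .
      then have "a / - s - P ((1 / - s) *\<^sub>R x - z) \<le> c"
        using c_ge[of "(1 / - s) *\<^sub>R x" "a / - s"] by simp
      then have "a + s * c \<le> (- s) * P ((1 / - s) *\<^sub>R x - z)"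
        using 3 by (simp add: field_simps)
      also have "\<dots> = P ((- s) *\<^sub>R ((1 / - s) *\<^sub>R x - z))"
        using 3 dom[OF g] z V by (intro scale[symmetric]) (auto intro: subspace_diff subspace_scale simp del: divide_minus_right)
      finally show ?thesis
        using 3 by (simp add: scaleR_diff_right)
    qed
  qed
  moreover have "fst ` H \<subseteq> V"
  proof
    fix x assume "x \<in> fst ` H"
    then obtain g s where "g \<in> G" "x = fst g + s *\<^sub>R z"
      using Hmem by fastforce
    moreover from this have "fst g \<in> V"
      using dom[of "fst g" "snd g"] by simp
    ultimately show "x \<in> V"
      using z V by (auto intro: subspace_add subspace_scale)
  qed
  ultimately have "graph_below V P H"
    by (auto simp: graph_below_def H_def)
  moreover have "G \<subseteq> H"
    unfolding Hmem subset_iff by (metis add.right_neutral scaleR_zero_left)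
  moreover have "(z, c) \<in> H"
    unfolding Hmem using zero by (intro bexI[of _ "(0, 0)"] exI[of _ 1]) simp_all
  ultimately show ?thesis
    by (metis fst_conv image_eqI)
qed

text \<open>A maximal graph has all of \<open>V\<close> as its domain, since
  \<open>graph_below_extend\<close> would enlarge it otherwise. Linearity of \<open>f\<close> is
  then closure of this graph under sums and multiples.\<close>

theorem Hahn_Banach_graph:
  fixes P :: "'v::real_vector \<Rightarrow> real"
  assumes V: "subspace V"
    and add: "\<And>x y. x \<in> V \<Longrightarrow> y \<in> V \<Longrightarrow> P (x + y) \<le> P x + P y"
    and scale: "\<And>c x. c > 0 \<Longrightarrow> x \<in> V \<Longrightarrow> P (c *\<^sub>R x) = c * P x"
    and G: "graph_below V P G"
  shows "\<exists>f. (\<forall>x\<in>V. \<forall>y\<in>V. f (x + y) = f x + f y) \<and> (\<forall>c. \<forall>x\<in>V. f (c *\<^sub>R x) = c * f x)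
    \<and> (\<forall>x\<in>V. f x \<le> P x) \<and> (\<forall>(x, a)\<in>G. f x = a)"
proof -
  let ?A = "{H. graph_below V P H \<and> G \<subseteq> H}"
  have "\<exists>M\<in>?A. \<forall>X\<in>?A. M \<subseteq> X \<longrightarrow> X = M"
  proof (rule subset_Zorn_nonempty)
    show "?A \<noteq> {}"
      using G by blast
    fix C assume ne: "C \<noteq> {}" and "subset.chain ?A C"
    then have C: "\<And>X. X \<in> C \<Longrightarrow> graph_below V P X \<and> G \<subseteq> X"
      and ch: "\<And>X Y. X \<in> C \<Longrightarrow> Y \<in> C \<Longrightarrow> X \<subseteq> Y \<or> Y \<subseteq> X"
      by (auto simp: subset_chain_def)
    have "subspace (\<Union>C)"
    proof (rule subspaceI)
      show "0 \<in> \<Union>C"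
        using ne C by (metis UnionI all_not_in_conv graph_below_def subspace_0)
    next
      fix x y assume "x \<in> \<Union>C" "y \<in> \<Union>C"
      then obtain X where "X \<in> C" "x \<in> X" "y \<in> X"
        using ch by blast
      then show "x + y \<in> \<Union>C"
        using C subspace_add unfolding graph_below_def by blast
    next
      fix x and c :: real assume "x \<in> \<Union>C"
      then show "c *\<^sub>R x \<in> \<Union>C"
        using C subspace_scale unfolding graph_below_def by blast
    qed
    then show "\<Union>C \<in> ?A"
      using ne C unfolding graph_below_def by blast
  qed
  then obtain M where "M \<in> ?A" and maxA: "\<forall>X\<in>?A. M \<subseteq> X \<longrightarrow> X = M"
    by (rule bexE)
  then have M: "graph_below V P M" "G \<subseteq> M"
    by simp_all
  have max: "X = M" if "graph_below V P X" "M \<subseteq> X" for X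
    using maxA that M(2) by (metis (mono_tags, lifting) mem_Collect_eq order_trans)
  have sub: "subspace M" and dom: "\<And>x a. (x, a) \<in> M \<Longrightarrow> x \<in> V"
    and le: "\<And>x a. (x, a) \<in> M \<Longrightarrow> a \<le> P x"
    using M by (auto simp: graph_below_def)
  have total: "\<exists>a. (x, a) \<in> M" if x: "x \<in> V" for x
  proof -
    obtain H where "graph_below V P H" "M \<subseteq> H" "x \<in> fst ` H"
      using graph_below_extend[OF V add scale M(1) x] by blast
    then show ?thesis
      using max by (metis fst_conv imageE prod.collapse)
  qed
  \<comment> \<open>\<open>scale\<close> covers positive factors only, so the value at 0 is forced
    by \<open>P 0 = 2 * P 0\<close>.\<close>
  have P0: "P 0 = 0"
    using scale[of 2 0] subspace_0[OF V] by simp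
  \<comment> \<open>Two values over one point put \<open>(0, a - b)\<close> and
    \<open>(0, b - a)\<close> into the graph, and both lie below \<open>P 0\<close>.\<close>
  have single: "a = b" if "(x, a) \<in> M" "(x, b) \<in> M" for x a b
  proof -
    have "(x, a) - (x, b) \<in> M" "(x, b) - (x, a) \<in> M"
      using that sub by (blast intro: subspace_diff)+
    then show ?thesis
      using le[of 0 "a - b"] le[of 0 "b - a"] P0 by simp
  qed
  define f where "f x = (THE a. (x, a) \<in> M)" for x
  have f_eq: "f x = a" if "(x, a) \<in> M" for x a
    unfolding f_def using that single by blast
  have f: "(x, f x) \<in> M" if "x \<in> V" for x
    using total[OF that] f_eq by auto
  show ?thesis
  proof (intro exI[of _ f] conjI ballI allI)
    fix x y assume "x \<in> V" "y \<in> V"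
    then have "(x, f x) + (y, f y) \<in> M"
      using f subspace_add[OF sub] by blast
    then show "f (x + y) = f x + f y"
      using f_eq by simp
  next
    fix c :: real and x assume "x \<in> V"
    then have "c *\<^sub>R (x, f x) \<in> M"
      using f subspace_scale[OF sub] by blast
    then show "f (c *\<^sub>R x) = c * f x"
      using f_eq by simp
  next
    fix x assume "x \<in> V"
    then show "f x \<le> P x"
      using f le by blast
  next
    fix g assume "g \<in> G"
    then show "case g of (x, a) \<Rightarrow> f x = a"
      using M(2) f_eq by auto
  qed
qed

subsection \<open>Powers and the inequalities of Hoelder and Minkowski\<close>

text \<open>Being built on the Bochner integral, this is a real number throughout, but it is 0 when
  \<open>\<bar>f x\<bar> powr q\<close> is not integrable. Integrability is therefore carried along
  in the lemmas that compare norms.\<close>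

definition lnorm :: "real \<Rightarrow> 'a measure \<Rightarrow> ('a \<Rightarrow> real) \<Rightarrow> real" where
  "lnorm q N f = (LINT x|N. \<bar>f x\<bar> powr q) powr (1 / q)"

lemma lnorm_nonneg [simp]: "0 \<le> lnorm q N f"
  by (simp add: lnorm_def)

lemma lnorm_cong: "(\<And>x. x \<in> space N \<Longrightarrow> f x = g x) \<Longrightarrow> lnorm q N f = lnorm q N g"
  unfolding lnorm_def by (simp cong: Bochner_Integration.integral_cong)

lemma lnorm_0 [simp]: "lnorm q N (\<lambda>x. 0) = 0"
  by (simp add: lnorm_def)

lemma powr_diff_one_mult:
  fixes a q :: real
  assumes "0 \<le> a"
  shows "a powr (q - 1) * a = a powr q"
  using assms powr_mult_base[of a "q - 1"] by (cases "a = 0") (simp_all add: mult.commute)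

lemma powr_add_le:
  fixes a b q :: real
  assumes "0 \<le> a" "0 \<le> b" "0 \<le> q"
  shows "(a + b) powr q \<le> 2 powr q * (a powr q + b powr q)"
proof -
  have "(a + b) powr q \<le> (2 * max a b) powr q"
    using assms by (intro powr_mono2) auto
  also have "\<dots> = 2 powr q * max a b powr q"
    using assms by (simp add: powr_mult)
  also have "\<dots> \<le> 2 powr q * (a powr q + b powr q)"
    by (intro mult_left_mono) (auto simp: max_def)
  finally show ?thesis .
qed

lemma integrable_powr_add:
  fixes f h :: "'a \<Rightarrow> real"
  assumes q: "0 \<le> q" and [measurable]: "f \<in> borel_measurable N" "h \<in> borel_measurable N"
    and "integrable N (\<lambda>x. \<bar>f x\<bar> powr q)" "integrable N (\<lambda>x. \<bar>h x\<bar> powr q)"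
  shows "integrable N (\<lambda>x. \<bar>f x + h x\<bar> powr q)"
proof (rule Bochner_Integration.integrable_bound)
  show "integrable N (\<lambda>x. 2 powr q * (\<bar>f x\<bar> powr q + \<bar>h x\<bar> powr q))"
    using assms by auto
  show "AE x in N. norm (\<bar>f x + h x\<bar> powr q) \<le> norm (2 powr q * (\<bar>f x\<bar> powr q + \<bar>h x\<bar> powr q))"
  proof (rule AE_I2)
    fix x
    have "\<bar>f x + h x\<bar> powr q \<le> (\<bar>f x\<bar> + \<bar>h x\<bar>) powr q"
      using q by (intro powr_mono2) auto
    also have "\<dots> \<le> 2 powr q * (\<bar>f x\<bar> powr q + \<bar>h x\<bar> powr q)"
      using q by (intro powr_add_le) auto
    finally show "norm (\<bar>f x + h x\<bar> powr q) \<le> norm (2 powr q * (\<bar>f x\<bar> powr q + \<bar>h x\<bar> powr q))"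
      by simp
  qed
qed simp

lemma lnorm_mono:
  assumes q: "0 < q" and [measurable]: "f \<in> borel_measurable N"
    and h: "integrable N (\<lambda>x. \<bar>h x\<bar> powr q)"
    and le: "\<And>x. x \<in> space N \<Longrightarrow> \<bar>f x\<bar> \<le> \<bar>h x\<bar>"
  shows "integrable N (\<lambda>x. \<bar>f x\<bar> powr q)" and "lnorm q N f \<le> lnorm q N h"
proof -
  have *: "\<bar>f x\<bar> powr q \<le> \<bar>h x\<bar> powr q" if "x \<in> space N" for x
    using q le[OF that] by (intro powr_mono2) auto
  show int: "integrable N (\<lambda>x. \<bar>f x\<bar> powr q)"
    by (rule Bochner_Integration.integrable_bound[OF h]) (use * in auto)
  show "lnorm q N f \<le> lnorm q N h"
    unfolding lnorm_def using q * by (intro powr_mono2 integral_mono[OF int h *]) auto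
qed

lemma lnorm_cmult:
  assumes "0 < q"
  shows "lnorm q N (\<lambda>x. c * f x) = \<bar>c\<bar> * lnorm q N f"
  using assms by (simp add: lnorm_def abs_mult powr_mult powr_powr)

text \<open>Writing one factor as a power with exponent \<open>q - 1\<close> avoids the conjugate
  exponent and treats \<open>q = 1\<close> together with the rest. The inequality is Young's,
  applied pointwise to \<open>f x powr q\<close> and \<open>h x powr q\<close> after dividing each
  by its total mass, and then integrated.\<close>

lemma Holder:
  fixes f h :: "'a \<Rightarrow> real"
  assumes q: "1 \<le> q" and [measurable]: "f \<in> borel_measurable N" "h \<in> borel_measurable N"
    and nn: "\<And>x. 0 \<le> f x" "\<And>x. 0 \<le> h x"
    and int: "integrable N (\<lambda>x. f x powr q)" "integrable N (\<lambda>x. h x powr q)"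
  shows "integrable N (\<lambda>x. f x powr (q - 1) * h x)"
    and "(LINT x|N. f x powr (q - 1) * h x) \<le> (LINT x|N. f x powr q) powr (1 - 1 / q) * lnorm q N h"
proof -
  show int2: "integrable N (\<lambda>x. f x powr (q - 1) * h x)"
  proof (rule Bochner_Integration.integrable_bound)
    show "integrable N (\<lambda>x. f x powr q + h x powr q)"
      using int by auto
    show "AE x in N. norm (f x powr (q - 1) * h x) \<le> norm (f x powr q + h x powr q)"
    proof (rule AE_I2)
      fix x
      have "f x powr (q - 1) * h x \<le> max (f x) (h x) powr (q - 1) * max (f x) (h x)"
        using q nn by (intro mult_mono powr_mono2) auto
      also have "\<dots> = max (f x) (h x) powr q"
        using nn by (intro powr_diff_one_mult) (simp add: le_max_iff_disj)
      also have "\<dots> \<le> f x powr q + h x powr q"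
        by (auto simp: max_def)
      finally show "norm (f x powr (q - 1) * h x) \<le> norm (f x powr q + h x powr q)"
        using nn by simp
    qed
  qed simp
  define A where "A = (LINT x|N. f x powr q)"
  define B where "B = (LINT x|N. h x powr q)"
  have lnorm_h: "lnorm q N h = B powr (1 / q)"
    using nn by (simp add: lnorm_def B_def)
  have "0 \<le> A" "0 \<le> B"
    by (auto simp: A_def B_def)
  \<comment> \<open>The normalisation divides by \<open>A\<close> and \<open>B\<close>. If one of
    them is 0, the product vanishes almost everywhere.\<close>
  then consider "A = 0" | "B = 0" | "A > 0" "B > 0"
    by linarith
  then show "(LINT x|N. f x powr (q - 1) * h x) \<le> (LINT x|N. f x powr q) powr (1 - 1 / q) * lnorm q N h"
  proof cases
    case 1
    then have "AE x in N. f x powr q = 0"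
      using int by (simp add: A_def integral_nonneg_eq_0_iff_AE)
    then have "AE x in N. f x powr (q - 1) * h x = 0"
      by eventually_elim simp
    then have "(LINT x|N. f x powr (q - 1) * h x) = 0"
      by (simp add: integral_eq_zero_AE)
    then show ?thesis by simp
  next
    case 2
    then have "AE x in N. h x powr q = 0"
      using int by (simp add: B_def integral_nonneg_eq_0_iff_AE)
    then have "AE x in N. f x powr (q - 1) * h x = 0"
      by eventually_elim simp
    then have "(LINT x|N. f x powr (q - 1) * h x) = 0"
      by (simp add: integral_eq_zero_AE)
    then show ?thesis by simp
  next
    case 3
    have young: "f x powr (q - 1) * h x
        \<le> A powr (1 - 1 / q) * B powr (1 / q) * ((1 - 1 / q) * (f x powr q / A) + 1 / q * (h x powr q / B))" for x
    proof (cases "f x = 0 \<or> h x = 0")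
      case True
      then have "f x powr (q - 1) * h x = 0"
        by auto
      also have "\<dots> \<le> A powr (1 - 1 / q) * B powr (1 / q) * ((1 - 1 / q) * (f x powr q / A) + 1 / q * (h x powr q / B))"
        using 3 q by (intro mult_nonneg_nonneg add_nonneg_nonneg) auto
      finally show ?thesis .
    next
      case False
      then have pos: "f x > 0" "h x > 0"
        using nn[of x] by linarith+
      have "(f x powr q / A) powr (1 - 1 / q) * (h x powr q / B) powr (1 / q)
        \<le> (1 - 1 / q) * (f x powr q / A) + 1 / q * (h x powr q / B)"
        using 3 pos q by (intro Youngs_inequality_0) auto
      moreover have "(f x powr q / A) powr (1 - 1 / q) = f x powr (q - 1) / A powr (1 - 1 / q)"
        using 3 pos q by (simp add: powr_divide powr_powr right_diff_distrib)
      moreover have "(h x powr q / B) powr (1 / q) = h x / B powr (1 / q)"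
        using 3 pos q by (simp add: powr_divide powr_powr)
      ultimately show ?thesis
        using 3 by (simp add: field_simps)
    qed
    have "(LINT x|N. f x powr (q - 1) * h x)
        \<le> (LINT x|N. A powr (1 - 1 / q) * B powr (1 / q) * ((1 - 1 / q) * (f x powr q / A) + 1 / q * (h x powr q / B)))"
      using int int2 young by (intro integral_mono) auto
    also have "\<dots> = A powr (1 - 1 / q) * B powr (1 / q) * ((1 - 1 / q) * (A / A) + 1 / q * (B / B))"
      unfolding A_def B_def using int by simp
    also have "\<dots> = A powr (1 - 1 / q) * B powr (1 / q)"
      using 3 by simp
    finally show ?thesis
      by (simp add: A_def lnorm_h)
  qed
qed

text \<open>One factor is split off \<open>(f + h) powr q\<close>, \<open>Holder\<close> is applied
  to \<open>f + h\<close> against each summand, and the common factor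
  \<open>S powr (1 - 1 / q)\<close> is divided out.\<close>

lemma lnorm_triangle:
  fixes f h :: "'a \<Rightarrow> real"
  assumes q: "1 \<le> q" and [measurable]: "f \<in> borel_measurable N" "h \<in> borel_measurable N"
    and nn: "\<And>x. 0 \<le> f x" "\<And>x. 0 \<le> h x"
    and int: "integrable N (\<lambda>x. f x powr q)" "integrable N (\<lambda>x. h x powr q)"
  shows "lnorm q N (\<lambda>x. f x + h x) \<le> lnorm q N f + lnorm q N h"
proof -
  define S where "S = (LINT x|N. (f x + h x) powr q)"
  have S: "lnorm q N (\<lambda>x. f x + h x) = S powr (1 / q)"
    using nn by (simp add: lnorm_def S_def)
  have intS: "integrable N (\<lambda>x. (f x + h x) powr q)"
    using integrable_powr_add[of q f N h] int nn q by simp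
  show ?thesis
  proof (cases "S = 0")
    case False
    then have pos: "S > 0"
      by (simp add: S_def less_le)
    have "S = (LINT x|N. (f x + h x) powr (q - 1) * f x + (f x + h x) powr (q - 1) * h x)"
      unfolding S_def using nn
      by (intro Bochner_Integration.integral_cong) (simp_all flip: distrib_left add: powr_diff_one_mult)
    also have "\<dots> = (LINT x|N. (f x + h x) powr (q - 1) * f x) + (LINT x|N. (f x + h x) powr (q - 1) * h x)"
      using nn q int intS by (intro Bochner_Integration.integral_add Holder(1)) auto
    also have "\<dots> \<le> S powr (1 - 1 / q) * lnorm q N f + S powr (1 - 1 / q) * lnorm q N h"
      unfolding S_def using nn q int intS by (intro add_mono Holder(2)) auto
    finally have "S / S powr (1 - 1 / q) \<le> lnorm q N f + lnorm q N h"
      using pos by (simp add: field_simps)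
    then show ?thesis
      unfolding S using pos by (simp add: powr_diff)
  qed (simp add: S)
qed

subsection \<open>Representation of positive functionals by densities\<close>

text \<open>The measure is \<open>A \<mapsto> l (W \<sqdot> 1\<^sub>A)\<close>, so that the functions bounded by multiples of \<open>W\<close> become
  bounded integrands.\<close>

lemma positive_functional_representation:
  fixes M :: "'z measure" and W :: "'z \<Rightarrow> real" and l :: "('z \<Rightarrow> real) \<Rightarrow> real"
  defines "V \<equiv> {g \<in> borel_measurable M. \<exists>\<kappa>. \<forall>z\<in>space M. \<bar>g z\<bar> \<le> \<kappa> * W z}"
  assumes sf: "sigma_finite_measure M"
    and W[measurable]: "W \<in> borel_measurable M" and Wpos: "\<And>z. z \<in> space M \<Longrightarrow> 0 < W z"
    and add: "\<And>g h. g \<in> V \<Longrightarrow> h \<in> V \<Longrightarrow> l (\<lambda>z. g z + h z) = l g + l h"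
    and scale: "\<And>c g. g \<in> V \<Longrightarrow> l (\<lambda>z. c * g z) = c * l g"
    and pos: "\<And>g. g \<in> V \<Longrightarrow> (\<And>z. z \<in> space M \<Longrightarrow> 0 \<le> g z) \<Longrightarrow> 0 \<le> l g"
    and null: "\<And>A. A \<in> null_sets M \<Longrightarrow> l (\<lambda>z. W z * indicator A z) = 0"
    and cont: "\<And>A :: nat \<Rightarrow> 'z set. range A \<subseteq> sets M \<Longrightarrow> decseq A \<Longrightarrow> (\<Inter>i. A i) = {} \<Longrightarrow>
       (\<lambda>i. l (\<lambda>z. W z * indicator (A i) z)) \<longlonglongrightarrow> 0"
  shows "\<exists>\<rho>\<in>borel_measurable M. (\<forall>z. 0 \<le> \<rho> z) \<and>
    (\<forall>g\<in>V. integrable M (\<lambda>z. \<rho> z * g z) \<and> l g = (LINT z|M. \<rho> z * g z))"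
proof -
  interpret sigma_finite_measure M by fact
  have inV: "(\<lambda>z. W z * h z) \<in> V" if [measurable]: "h \<in> borel_measurable M"
    and B: "\<And>z. z \<in> space M \<Longrightarrow> \<bar>h z\<bar> \<le> B" for h B
  proof -
    have "\<bar>W z * h z\<bar> \<le> B * W z" if "z \<in> space M" for z
      using mult_left_mono[OF B[OF that], of "W z"] Wpos[OF that] by (simp add: abs_mult mult.commute)
    then show ?thesis
      by (auto simp: V_def)
  qed
  have Vadd: "(\<lambda>z. g z + h z) \<in> V" if gh: "g \<in> V" "h \<in> V" for g h
  proof -
    obtain a b where *: "\<And>z. z \<in> space M \<Longrightarrow> \<bar>g z\<bar> \<le> a * W z" "\<And>z. z \<in> space M \<Longrightarrow> \<bar>h z\<bar> \<le> b * W z"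
      and [measurable]: "g \<in> borel_measurable M" "h \<in> borel_measurable M"
      using gh unfolding V_def mem_Collect_eq by blast
    have "\<bar>g z + h z\<bar> \<le> (a + b) * W z" if "z \<in> space M" for z
      using *[OF that] by (simp add: distrib_right)
    then show ?thesis
      by (auto simp: V_def)
  qed
  have Vscale: "(\<lambda>z. c * g z) \<in> V" if gh: "g \<in> V" for c g
  proof -
    obtain a where *: "\<And>z. z \<in> space M \<Longrightarrow> \<bar>g z\<bar> \<le> a * W z"
      and [measurable]: "g \<in> borel_measurable M"
      using gh unfolding V_def mem_Collect_eq by blast
    have "\<bar>c * g z\<bar> \<le> (\<bar>c\<bar> * a) * W z" if "z \<in> space M" for z
      using mult_left_mono[OF *[OF that], of "\<bar>c\<bar>"] by (simp add: abs_mult mult.assoc)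
    then show ?thesis
      by (auto simp: V_def)
  qed
  have mono: "l g \<le> l h" if "g \<in> V" "h \<in> V" "\<And>z. z \<in> space M \<Longrightarrow> g z \<le> h z" for g h
  proof -
    have "0 \<le> l (\<lambda>z. h z + (- 1) * g z)"
      using that by (intro pos Vadd Vscale) auto
    also have "\<dots> = l h - l g"
      using add[OF that(2) Vscale[OF that(1), of "- 1"]] scale[OF that(1), of "- 1"] by simp
    finally show ?thesis by simp
  qed
  have cong: "l g = l h" if "g \<in> V" "h \<in> V" "\<And>z. z \<in> space M \<Longrightarrow> g z = h z" for g h
    using mono[of g h] mono[of h g] that by auto
  define J where "J h = l (\<lambda>z. W z * h z)" for h
  have J_add: "J (\<lambda>z. f z + h z) = J f + J h"
    if "f \<in> borel_measurable M" "h \<in> borel_measurable M"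
      "\<And>z. z \<in> space M \<Longrightarrow> \<bar>f z\<bar> \<le> a" "\<And>z. z \<in> space M \<Longrightarrow> \<bar>h z\<bar> \<le> b" for f h a b
    using add[OF inV inV, of f a h b] that by (simp add: J_def distrib_left)
  have J_scale: "J (\<lambda>z. c * f z) = c * J f"
    if "f \<in> borel_measurable M" "\<And>z. z \<in> space M \<Longrightarrow> \<bar>f z\<bar> \<le> a" for f a c
    using scale[OF inV, of f a c] that by (simp add: J_def mult.left_commute)
  have J_ind: "(\<lambda>z. W z * indicator A z) \<in> V" if "A \<in> sets M" for A
    using that by (intro inV[of _ 1]) (auto simp: indicator_def)
  have J_ind_nonneg: "0 \<le> J (indicator A)" if "A \<in> sets M" for A
    unfolding J_def using J_ind[OF that] Wpos by (intro pos) (auto simp: less_imp_le)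
  define m where "m A = ennreal (J (indicator A))" for A
  have J0: "J (indicator {}) = 0"
    using null[of "{}"] by (simp add: J_def)
  have m_pos: "positive (sets M) m"
    using J0 by (simp add: positive_def m_def)
  have m_add: "additive (sets M) m"
  unfolding additive_def
  proof (intro ballI impI)
    fix A B assume "A \<in> sets M" "B \<in> sets M" "A \<inter> B = {}"
    note AB = this
    have "(indicator (A \<union> B) :: 'z \<Rightarrow> real) = (\<lambda>z. indicator A z + indicator B z)"
      using AB by (auto simp: indicator_def fun_eq_iff)
    then have "J (indicator (A \<union> B)) = J (indicator A) + J (indicator B)"
      using AB J_add[of "indicator A" "indicator B" 1 1] by (simp add: indicator_def)
    then show "m (A \<union> B) = m A + m B"
      using AB J_ind_nonneg by (simp add: m_def ennreal_plus)
  qed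
  \<comment> \<open>For a finite additive set function, continuity along sequences decreasing to the
    empty set is equivalent to countable additivity. This is the purpose of the assumption
    \<open>cont\<close>.\<close>
  have m_ca: "countably_additive (sets M) m"
  proof (rule sets.empty_continuous_imp_countably_additive[OF m_pos m_add])
    show "\<forall>A\<in>sets M. m A \<noteq> \<infinity>"
      by (simp add: m_def)
    fix A :: "nat \<Rightarrow> 'z set"
    assume A: "range A \<subseteq> sets M" "decseq A" "(\<Inter>i. A i) = {}"
    show "(\<lambda>i. m (A i)) \<longlonglongrightarrow> 0"
      using cont[OF A] by (simp add: m_def J_def tendsto_ennrealI flip: ennreal_0)
  qed
  define \<nu> where "\<nu> = measure_of (space M) (sets M) m"
  have sets_\<nu>[measurable_cong]: "sets \<nu> = sets M"
    by (simp add: \<nu>_def sets.sigma_sets_eq sets.space_closed)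
  have space_\<nu>: "space \<nu> = space M"
    by (rule sets_eq_imp_space_eq[OF sets_\<nu>])
  have em: "emeasure \<nu> A = m A" if "A \<in> sets M" for A
    unfolding \<nu>_def by (rule emeasure_measure_of_sigma[OF sets.sigma_algebra_axioms m_pos m_ca that])
  have meas: "measure \<nu> A = J (indicator A)" if "A \<in> sets M" for A
    using J_ind_nonneg[OF that] by (simp add: measure_def em[OF that] m_def)
  interpret \<nu>: finite_measure \<nu>
    by (rule finite_measureI) (simp add: space_\<nu> em m_def)
  have ac: "absolutely_continuous M \<nu>"
    unfolding absolutely_continuous_def
  proof
    fix A assume A: "A \<in> null_sets M"
    then have "A \<in> sets M"
      by auto
    with null[OF A] show "A \<in> null_sets \<nu>"
      by (simp add: null_sets_def sets_\<nu> em m_def J_def)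
  qed
  obtain D where D[measurable]: "D \<in> borel_measurable M" and AE_D: "AE x in M. RN_deriv M \<nu> x = ennreal (D x)"
    and D_nn: "\<And>x. 0 \<le> D x"
    using real_RN_deriv[OF \<nu>.finite_measure_axioms ac sets_\<nu>] by metis
  have dens: "\<nu> = density M (\<lambda>x. ennreal (D x))"
  proof -
    have "density M (RN_deriv M \<nu>) = density M (\<lambda>x. ennreal (D x))"
      by (rule density_cong) (use AE_D in auto)
    then show ?thesis
      using density_RN_deriv[OF ac sets_\<nu>] by simp
  qed
  have int_J: "J h = (LINT z|\<nu>. h z)" if [measurable]: "h \<in> borel_measurable M"
    and B: "\<And>z. z \<in> space M \<Longrightarrow> \<bar>h z\<bar> \<le> B" for h and B :: real
  proof -
    have intg: "integrable \<nu> f" if [measurable]: "f \<in> borel_measurable M" and "\<And>z. z \<in> space M \<Longrightarrow> \<bar>f z\<bar> \<le> b" for f :: "'z \<Rightarrow> real" and b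
      by (rule \<nu>.integrable_const_bound[where B=b]) (use that space_\<nu> in auto)
    \<comment> \<open>So far \<open>J\<close> agrees with the integral on indicators only. Rounding
      \<open>h\<close> down to multiples of \<open>1 / N\<close> gives a step function, with
      finitely many levels as \<open>h\<close> is bounded. The remainder lies between 0 and
      \<open>1 / N\<close>, and by positivity this controls its image under \<open>J\<close> as well
      as its integral.\<close>
    have close: "\<bar>J h - (LINT z|\<nu>. h z)\<bar> \<le> J (\<lambda>z. 1) / Suc n" for n
    proof -
      define N where "N = real (Suc n)"
      have N: "N > 0" by (simp add: N_def)
      define k where "k = \<lceil>N * \<bar>B\<bar>\<rceil> + 1"
      define C where "C j = {z \<in> space M. \<lfloor>N * h z\<rfloor> = j}" for j
      have [measurable]: "C j \<in> sets M" for j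
        unfolding C_def by measurable
      define s where "s F = (\<lambda>z. \<Sum>j\<in>F. (real_of_int j / N) * indicator (C j) z)" for F :: "int set"
      have s_meas[measurable]: "s F \<in> borel_measurable M" for F
        unfolding s_def by measurable
      have s_bd: "\<bar>s F z\<bar> \<le> (\<Sum>j\<in>F. \<bar>real_of_int j / N\<bar>)" for F z
        unfolding s_def by (rule order_trans[OF sum_abs sum_mono]) (auto simp: indicator_def)
      have J_s: "J (s F) = (LINT z|\<nu>. s F z)" if "finite F" for F
        using that
      proof (induction F)
        case empty
        have "(indicator {} :: 'z \<Rightarrow> real) = (\<lambda>z. 0)"
          by (simp add: fun_eq_iff)
        then have "J (\<lambda>z. 0) = 0"
          using J0 by simp
        then show ?case by (simp add: s_def)
      next
        case (insert j F)
        have s_ins: "s (insert j F) = (\<lambda>z. (real_of_int j / N) * indicator (C j) z + s F z)"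
          using insert by (simp add: s_def)
        have "J (s (insert j F)) = J (\<lambda>z. (real_of_int j / N) * indicator (C j) z) + J (s F)"
          unfolding s_ins by (rule J_add[OF _ _ _ s_bd, where a="\<bar>real_of_int j / N\<bar>"]) (auto simp: indicator_def)
        also have "J (\<lambda>z. (real_of_int j / N) * indicator (C j) z) = (real_of_int j / N) * measure \<nu> (C j)"
          using J_scale[of "indicator (C j)" 1 "real_of_int j / N"] by (simp add: meas)
        also have "\<dots> = (LINT z|\<nu>. (real_of_int j / N) * indicator (C j) z)"
          by simp
        also have "\<dots> + J (s F) = (LINT z|\<nu>. s (insert j F) z)"
          unfolding s_ins insert.IH
          by (intro Bochner_Integration.integral_add[symmetric] intg[OF _ s_bd]
              intg[where b="\<bar>real_of_int j / N\<bar>"]) (auto simp: indicator_def)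
        finally show ?case .
      qed
      define S where "S = s {-k..k}"
      have S_eq: "S z = real_of_int \<lfloor>N * h z\<rfloor> / N" if z: "z \<in> space M" for z
      proof -
        have "\<bar>N * h z\<bar> \<le> N * \<bar>B\<bar>"
          using B[OF z] N by (simp add: abs_mult)
        then have "\<lfloor>N * h z\<rfloor> \<in> {-k..k}"
          unfolding k_def by (simp add: abs_le_iff) linarith
        moreover have "S z = (\<Sum>j\<in>{-k..k}. if \<lfloor>N * h z\<rfloor> = j then real_of_int j / N else 0)"
          unfolding S_def s_def C_def using z by (intro sum.cong) (auto simp: indicator_def)
        ultimately show ?thesis
          by (simp add: sum.delta')
      qed
      have diff: "0 \<le> h z - S z" "h z - S z \<le> 1 / N" if z: "z \<in> space M" for z
      proof -
        have "h z - S z = (N * h z - real_of_int \<lfloor>N * h z\<rfloor>) / N"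
          using N by (simp add: S_eq[OF z] diff_divide_distrib)
        moreover have "0 \<le> N * h z - real_of_int \<lfloor>N * h z\<rfloor>" "N * h z - real_of_int \<lfloor>N * h z\<rfloor> \<le> 1"
          by linarith+
        ultimately show "0 \<le> h z - S z" "h z - S z \<le> 1 / N"
          using N by (simp_all add: divide_right_mono)
      qed
      have [measurable]: "S \<in> borel_measurable M"
        by (simp add: S_def)
      define d where "d = (\<lambda>z. h z - S z)"
      have [measurable]: "d \<in> borel_measurable M"
        by (simp add: d_def)
      have d_bd: "\<bar>d z\<bar> \<le> 1 / N" if "z \<in> space M" for z
        using diff[OF that] by (simp add: d_def)
      have J_h: "J h = J S + J d"
        using J_add[of S d "\<Sum>j\<in>{-k..k}. \<bar>real_of_int j / N\<bar>" "1 / N"] s_bd[of "{-k..k}"] d_bd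
        by (simp add: S_def d_def)
      have I_h: "(LINT z|\<nu>. h z) = (LINT z|\<nu>. S z) + (LINT z|\<nu>. d z)"
        using Bochner_Integration.integral_add[OF intg[of S "\<Sum>j\<in>{-k..k}. \<bar>real_of_int j / N\<bar>"] intg[of d "1 / N"]] s_bd[of "{-k..k}"] d_bd
        by (simp add: S_def d_def)
      have one: "J (\<lambda>z. 1) = measure \<nu> (space \<nu>)"
      proof -
        have "J (\<lambda>z. 1) = J (indicator (space M))"
          unfolding J_def by (rule cong[OF inV[of _ 1] J_ind]) auto
        then show ?thesis
          by (simp add: meas space_\<nu>)
      qed
      have "0 \<le> J d"
        unfolding J_def by (rule pos[OF inV[OF _ d_bd]]) (use diff Wpos in \<open>auto simp: d_def less_imp_le\<close>)
      moreover have "J d \<le> J (\<lambda>z. 1 / N * 1)"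
        unfolding J_def by (rule mono[OF inV[OF _ d_bd] inV[of _ "1 / N"]]) (use diff Wpos N in \<open>auto simp: d_def less_imp_le simp del: times_divide_eq_right intro!: mult_left_mono\<close>)
      moreover have "J (\<lambda>z. 1 / N * 1) = 1 / N * J (\<lambda>z. 1)"
        by (rule J_scale[of _ 1]) auto
      moreover have "0 \<le> (LINT z|\<nu>. d z)"
        using diff by (intro Bochner_Integration.integral_nonneg_AE AE_I2) (simp add: d_def space_\<nu>)
      moreover have "(LINT z|\<nu>. d z) \<le> (LINT z|\<nu>. 1 / N)"
        using diff by (intro integral_mono intg[OF _ d_bd]) (auto simp: d_def space_\<nu>)
      ultimately show ?thesis
        unfolding J_h I_h using J_s[of "{-k..k}"] one by (simp add: S_def N_def abs_le_iff)
    qed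
    have "(\<lambda>n. J (\<lambda>z. 1) / real (Suc n)) \<longlonglongrightarrow> 0"
      by (rule LIMSEQ_Suc[OF lim_const_over_n])
    then have "\<bar>J h - (LINT z|\<nu>. h z)\<bar> \<le> 0"
      by (rule LIMSEQ_le_const) (use close in auto)
    then show ?thesis by simp
  qed
  \<comment> \<open>Dividing by the weight undoes its absorption into the measure. The absolute
    value keeps \<rho> nonnegative also outside \<open>space M\<close>, where the sign of
    \<open>W\<close> is unknown.\<close>
  define \<rho> where "\<rho> z = D z / \<bar>W z\<bar>" for z
  show ?thesis
  proof (intro bexI[of _ \<rho>] conjI ballI allI)
    show [measurable]: "\<rho> \<in> borel_measurable M"
      unfolding \<rho>_def by measurable
    show "0 \<le> \<rho> z" for z
      using D_nn by (simp add: \<rho>_def)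
    fix g assume g: "g \<in> V"
    then obtain \<kappa> where [measurable]: "g \<in> borel_measurable M" and \<kappa>: "\<And>z. z \<in> space M \<Longrightarrow> \<bar>g z\<bar> \<le> \<kappa> * W z"
      by (auto simp: V_def)
    define h where "h z = g z / W z" for z
    have [measurable]: "h \<in> borel_measurable M"
      unfolding h_def by measurable
    have h_bd: "\<bar>h z\<bar> \<le> \<kappa>" if "z \<in> space M" for z
      using \<kappa>[OF that] Wpos[OF that] by (simp add: h_def field_simps)
    have "integrable \<nu> h"
      by (rule \<nu>.integrable_const_bound[where B=\<kappa>]) (use h_bd space_\<nu> in auto)
    then have "integrable M (\<lambda>z. D z * h z)"
      unfolding dens using D_nn by (subst (asm) integrable_density) auto
    moreover have eq: "D z * h z = \<rho> z * g z" if "z \<in> space M" for z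
      using Wpos[OF that] by (simp add: h_def \<rho>_def)
    ultimately show "integrable M (\<lambda>z. \<rho> z * g z)"
      by (simp cong: Bochner_Integration.integrable_cong)
    have "g z = W z * h z" if "z \<in> space M" for z
      using Wpos[OF that] by (simp add: h_def)
    then have "l g = J h"
      unfolding J_def by (intro cong[OF g inV[OF _ h_bd]]) auto
    also have "\<dots> = (LINT z|\<nu>. h z)"
      by (rule int_J[OF _ h_bd]) auto
    also have "\<dots> = (LINT z|M. D z * h z)"
      unfolding dens using D_nn by (subst integral_density) auto
    also have "\<dots> = (LINT z|M. \<rho> z * g z)"
      by (rule Bochner_Integration.integral_cong[OF refl eq])
    finally show "l g = (LINT z|M. \<rho> z * g z)" .
  qed
qed

subsection \<open>Calculus of functions with continuous iterated derivatives\<close>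

lemma frechet_derivative_cong_open:
  assumes "open S" "x \<in> S" "\<And>y. y \<in> S \<Longrightarrow> f y = g y"
  shows "f differentiable (at x) \<longleftrightarrow> g differentiable (at x)"
    and "frechet_derivative f (at x) = frechet_derivative g (at x)"
proof -
  have *: "(f has_derivative D) (at x) \<longleftrightarrow> (g has_derivative D) (at x)" for D
    using has_derivative_transform_within_open[of f D x UNIV S g]
      has_derivative_transform_within_open[of g D x UNIV S f] assms by auto
  show "f differentiable (at x) \<longleftrightarrow> g differentiable (at x)"
    by (simp add: differentiable_def *)
  show "frechet_derivative f (at x) = frechet_derivative g (at x)"
    by (simp add: frechet_derivative_def *)
qed

lemma Ck_on_cong:
  assumes "open S" "\<And>x. x \<in> S \<Longrightarrow> f x = g x"
  shows "Ck_on k S f \<longleftrightarrow> Ck_on k S g"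
  using assms(2)
proof (induction k arbitrary: f g)
  case 0
  then show ?case by (simp cong: continuous_on_cong)
next
  case (Suc k)
  have "Ck_on k S (\<lambda>x. frechet_derivative f (at x) v) \<longleftrightarrow> Ck_on k S (\<lambda>x. frechet_derivative g (at x) v)" for v
    by (rule Suc.IH) (simp add: frechet_derivative_cong_open(2)[OF assms(1) _ Suc.prems])
  then show ?case
    using frechet_derivative_cong_open(1)[OF assms(1) _ Suc.prems] by auto
qed

lemma Ck_on_SucD:
  assumes "Ck_on (Suc k) S f" "x \<in> S"
  shows "(f has_derivative frechet_derivative f (at x)) (at x)"
  using assms by (simp add: frechet_derivative_works)

text \<open>Reduces smoothness proofs to computations with an explicit derivative: on an open set,
  agreement with \<open>frechet_derivative\<close> at the points of \<open>S\<close> is inherited by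
  all further derivatives.\<close>

lemma Ck_on_SucI:
  assumes S: "open S" and D: "\<And>x. x \<in> S \<Longrightarrow> (g has_derivative g' x) (at x)"
    and Ck: "\<And>v. Ck_on k S (\<lambda>x. g' x v)"
  shows "Ck_on (Suc k) S g"
proof -
  have "frechet_derivative g (at x) = g' x" if "x \<in> S" for x
    using frechet_derivative_at[OF D[OF that]] by simp
  then have "Ck_on k S (\<lambda>x. frechet_derivative g (at x) v) \<longleftrightarrow> Ck_on k S (\<lambda>x. g' x v)" for v
    by (intro Ck_on_cong[OF S]) simp
  then show ?thesis
    using D Ck by (auto simp: differentiable_def)
qed

lemma Ck_on_Suc_imp: "Ck_on (Suc k) S f \<Longrightarrow> Ck_on k S f"
proof (induction k arbitrary: f)
  case 0
  then show ?case
    by (auto intro!: continuous_at_imp_continuous_on differentiable_imp_continuous_within)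
next
  case (Suc k)
  then show ?case by auto
qed

text \<open>Smoothness is local. This glues a function that is smooth inside \<Omega> to its
  extension by zero.\<close>

lemma Ck_on_Un:
  assumes "open S" "open T"
  shows "Ck_on k S f \<Longrightarrow> Ck_on k T f \<Longrightarrow> Ck_on k (S \<union> T) f"
  by (induction k arbitrary: f) (use assms in \<open>auto intro: continuous_on_open_Un\<close>)

lemma Ck_on_const: "open S \<Longrightarrow> Ck_on k S (\<lambda>x. c)"
proof (induction k arbitrary: c)
  case (Suc k)
  then show ?case
    by (intro Ck_on_SucI[where g'="\<lambda>x v. 0"]) auto
qed simp

lemma Ck_on_add:
  assumes S: "open S"
  shows "Ck_on k S f \<Longrightarrow> Ck_on k S g \<Longrightarrow> Ck_on k S (\<lambda>x. f x + g x)"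
proof (induction k arbitrary: f g)
  case 0
  then show ?case by (auto intro: continuous_intros)
next
  case (Suc k)
  show ?case
    by (rule Ck_on_SucI[OF S has_derivative_add[OF Ck_on_SucD[OF Suc.prems(1)] Ck_on_SucD[OF Suc.prems(2)]]])
      (use Suc in auto)
qed

lemma Ck_on_mult:
  fixes f g :: "'a::euclidean_space \<Rightarrow> real"
  assumes S: "open S"
  shows "Ck_on k S f \<Longrightarrow> Ck_on k S g \<Longrightarrow> Ck_on k S (\<lambda>x. f x * g x)"
proof (induction k arbitrary: f g)
  case 0
  then show ?case by (auto intro: continuous_intros)
next
  case (Suc k)
  show ?case
    by (rule Ck_on_SucI[OF S has_derivative_mult[OF Ck_on_SucD[OF Suc.prems(1)] Ck_on_SucD[OF Suc.prems(2)]]])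
      (use Suc Ck_on_Suc_imp[OF Suc.prems(1)] Ck_on_Suc_imp[OF Suc.prems(2)] in
        \<open>auto intro!: Ck_on_add[OF S]\<close>)
qed

text \<open>The induction has to vary the exponent, since each differentiation lowers it by one.
  Positivity of \<open>f\<close> keeps all these real powers differentiable.\<close>

lemma Ck_on_powr:
  fixes f :: "'a::euclidean_space \<Rightarrow> real"
  assumes S: "open S" and pos: "\<And>x. x \<in> S \<Longrightarrow> 0 < f x"
  shows "Ck_on k S f \<Longrightarrow> Ck_on k S (\<lambda>x. f x powr a)"
proof (induction k arbitrary: a)
  case 0
  then show ?case
    using pos by (force intro!: continuous_intros)
next
  case (Suc k)
  show ?case
  proof (rule Ck_on_SucI[OF S DERIV_compose_FDERIV[OF has_real_derivative_powr[OF pos] Ck_on_SucD[OF Suc.prems]]])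
    fix v
    show "Ck_on k S (\<lambda>x. frechet_derivative f (at x) v * (a * f x powr (a - 1)))"
      using Suc.prems Suc.IH[OF Ck_on_Suc_imp[OF Suc.prems]]
      by (intro Ck_on_mult[OF S] Ck_on_const S) auto
  qed auto
qed

lemma Ck_on_compose_affine:
  assumes L: "bounded_linear L" and S': "open S'" and sub: "\<And>x. x \<in> S' \<Longrightarrow> c + L x \<in> S"
  shows "Ck_on k S f \<Longrightarrow> Ck_on k S' (\<lambda>x. f (c + L x))"
proof (induction k arbitrary: f)
  case 0
  have "continuous_on S' (\<lambda>x. c + L x)"
    using L by (intro continuous_intros bounded_linear.continuous_on[OF L])
  with 0 show ?case
    using sub by (auto intro: continuous_on_compose2)
next
  case (Suc k)
  have aff: "((\<lambda>x. c + L x) has_derivative L) (at x)" for x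
    using bounded_linear_imp_has_derivative[OF L] by (auto intro!: derivative_eq_intros)
  show ?case
    by (rule Ck_on_SucI[OF S' has_derivative_compose[OF aff Ck_on_SucD[OF Suc.prems sub]]])
      (use Suc in auto)
qed

lemma inner_grad:
  assumes "(f has_derivative f') (at x)"
  shows "w \<bullet> grad f x = f' w"
proof -
  interpret bounded_linear f'
    using assms by (rule has_derivative_bounded_linear)
  have "f' w = f' (\<Sum>b\<in>Basis. (w \<bullet> b) *\<^sub>R b)"
    by (simp add: euclidean_representation)
  also have "\<dots> = (\<Sum>b\<in>Basis. (w \<bullet> b) * f' b)"
    by (simp add: sum scaleR)
  also have "\<dots> = w \<bullet> grad f x"
    using frechet_derivative_at[OF assms] by (simp add: grad_def inner_sum_right mult.commute)
  finally show ?thesis by simp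
qed

subsection \<open>A smooth approximation of the positive part\<close>

text \<open>The positive root y of \<open>y * (y - s) = \<epsilon>\<^sup>2 / 4\<close>. It is
  strictly positive, so that real powers of it are smooth even for fractional q, and it tends to the
  positive part of s as \<epsilon> tends to 0.\<close>

definition smooth_pos :: "real \<Rightarrow> real \<Rightarrow> real" where
  "smooth_pos \<epsilon> s = (s + sqrt (s\<^sup>2 + \<epsilon>\<^sup>2)) / 2"

context
  fixes \<epsilon> :: real
  assumes \<epsilon>: "\<epsilon> > 0"
begin

lemma smooth_pos_aux: "0 < s\<^sup>2 + \<epsilon>\<^sup>2" "\<bar>s\<bar> < sqrt (s\<^sup>2 + \<epsilon>\<^sup>2)"
proof -
  show "0 < s\<^sup>2 + \<epsilon>\<^sup>2"
    using \<epsilon> by (simp add: add_nonneg_pos)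
  have "sqrt (s\<^sup>2) < sqrt (s\<^sup>2 + \<epsilon>\<^sup>2)"
    using \<epsilon> by (intro real_sqrt_less_mono) simp
  then show "\<bar>s\<bar> < sqrt (s\<^sup>2 + \<epsilon>\<^sup>2)"
    by simp
qed

lemma smooth_pos_pos: "0 < smooth_pos \<epsilon> s"
  using smooth_pos_aux(2)[of s] by (simp add: smooth_pos_def)

lemma smooth_pos_ge: "max 0 s \<le> smooth_pos \<epsilon> s"
  using smooth_pos_aux(2)[of s] by (simp add: smooth_pos_def)

lemma smooth_pos_0: "smooth_pos \<epsilon> 0 = \<epsilon> / 2"
  using \<epsilon> by (simp add: smooth_pos_def)

text \<open>The quotient form of the derivative shows at once that it lies between 0 and 1, because
  \<open>smooth_pos\<close> is half of a number that is at most twice the root in the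
  denominator.\<close>

lemma smooth_pos_deriv:
  "(smooth_pos \<epsilon> has_real_derivative smooth_pos \<epsilon> s / sqrt (s\<^sup>2 + \<epsilon>\<^sup>2)) (at s)"
proof -
  have deriv: "(smooth_pos \<epsilon> has_real_derivative
      (1 + (2 * s) * (inverse (sqrt (s\<^sup>2 + \<epsilon>\<^sup>2)) / 2)) / 2) (at s)"
    unfolding smooth_pos_def[abs_def]
    using smooth_pos_aux(1)[of s] by (auto intro!: derivative_eq_intros simp: field_simps)
  have key: "(1 + (2 * s) * (inverse r / 2)) / 2 = ((s + r) / 2) / r" if "r > 0" for r :: real
    using that by (simp add: field_simps)
  have "(1 + (2 * s) * (inverse (sqrt (s\<^sup>2 + \<epsilon>\<^sup>2)) / 2)) / 2 = smooth_pos \<epsilon> s / sqrt (s\<^sup>2 + \<epsilon>\<^sup>2)"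
    unfolding smooth_pos_def using smooth_pos_aux(1)[of s] by (intro key) simp
  then show ?thesis
    by (rule DERIV_cong[OF deriv])
qed

lemma smooth_pos_deriv_le: "0 \<le> smooth_pos \<epsilon> s / sqrt (s\<^sup>2 + \<epsilon>\<^sup>2)" "smooth_pos \<epsilon> s / sqrt (s\<^sup>2 + \<epsilon>\<^sup>2) \<le> 1"
  using smooth_pos_pos[of s] smooth_pos_aux[of s] by (simp_all add: smooth_pos_def field_simps)

lemma smooth_pos_powr_deriv:
  "((\<lambda>s. smooth_pos \<epsilon> s powr q) has_real_derivative
    q * smooth_pos \<epsilon> s powr (q - 1) * (smooth_pos \<epsilon> s / sqrt (s\<^sup>2 + \<epsilon>\<^sup>2))) (at s)"
  using DERIV_chain2[OF has_real_derivative_powr[OF smooth_pos_pos, of q] smooth_pos_deriv, of s] by simp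

text \<open>The square root is a power with exponent \<open>1 / 2\<close>. Its argument and
  \<open>smooth_pos\<close> itself are both strictly positive, so \<open>Ck_on_powr\<close> can be
  used twice.\<close>

lemma Ck_on_smooth_pos_powr:
  fixes f :: "'a::euclidean_space \<Rightarrow> real"
  assumes S: "open S" and f: "Ck_on k S f"
  shows "Ck_on k S (\<lambda>x. smooth_pos \<epsilon> (f x) powr q)"
proof (rule Ck_on_powr[OF S smooth_pos_pos])
  have "Ck_on k S (\<lambda>x. (f x + (f x * f x + \<epsilon>\<^sup>2) powr (1 / 2)) * (1 / 2))"
    using smooth_pos_aux(1) by (intro Ck_on_mult Ck_on_add Ck_on_powr Ck_on_const S f) (simp_all add: power2_eq_square)
  moreover have "(f x + (f x * f x + \<epsilon>\<^sup>2) powr (1 / 2)) * (1 / 2) = smooth_pos \<epsilon> (f x)" for x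
    using smooth_pos_aux(1)[of "f x"] by (simp add: smooth_pos_def powr_half_sqrt power2_eq_square)
  ultimately show "Ck_on k S (\<lambda>x. smooth_pos \<epsilon> (f x))"
    by simp
qed

end

subsection \<open>The duality argument\<close>

lemma (in pair_sigma_finite) measurable_slice:
  assumes "g \<in> borel_measurable (M1 \<Otimes>\<^sub>M M2)" "t \<in> space M1"
  shows "(\<lambda>x. g (t, x)) \<in> borel_measurable M2"
  using measurable_compose[OF measurable_Pair1'[OF assms(2)] assms(1)] by simp

lemma measurable_slice_lnorm:
  assumes "sigma_finite_measure N" and [measurable]: "case_prod g \<in> borel_measurable (A \<Otimes>\<^sub>M N)"
  shows "(\<lambda>t. lnorm q N (g t)) \<in> borel_measurable A"
proof -
  interpret sigma_finite_measure N by fact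
  show ?thesis
    unfolding lnorm_def by measurable
qed

text \<open>\<open>w\<close> is a jointly measurable representative of the velocity. Integrability
  of its slices is demanded at every time and not just at almost every time, which can be arranged
  by setting \<open>w\<close> to 0 on a null set of times; it makes the slices of functions in
  \<open>V\<close> usable without exceptional sets.\<close>

locale velocity =
  fixes T :: real and \<Omega> :: "'a::euclidean_space set" and q :: real and w :: "real \<Rightarrow> 'a \<Rightarrow> 'a"
  assumes T: "0 < T" and open_\<Omega>: "open \<Omega>" and bounded_\<Omega>: "bounded \<Omega>" and q: "1 \<le> q"
    and w_measurable: "case_prod w \<in> borel_measurable (lebesgue_on {0<..<T} \<Otimes>\<^sub>M lebesgue_on \<Omega>)"
    and w_slice: "\<And>t. t \<in> {0<..<T} \<Longrightarrow> integrable (lebesgue_on \<Omega>) (\<lambda>x. norm (w t x) powr q)"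
    and w_lnorm: "integrable (lebesgue_on {0<..<T}) (\<lambda>t. lnorm q (lebesgue_on \<Omega>) (\<lambda>x. norm (w t x)))"
    and w_div: "AE t in lebesgue_on {0<..<T}. \<forall>\<phi>\<in>test_functions \<Omega>.
        (LINT x|lebesgue_on \<Omega>. w t x \<bullet> grad \<phi> x) = 0"
begin

abbreviation "A \<equiv> lebesgue_on {0<..<T}"
abbreviation "X \<equiv> lebesgue_on \<Omega>"
abbreviation "M \<equiv> A \<Otimes>\<^sub>M X"

text \<open>The weight \<open>W\<close> dominates \<open>L \<phi>\<close> for every test function \<open>\<phi>\<close>, up to a constant depending on
  \<open>\<phi>\<close>; \<open>N\<close> is the one-sided \<open>L\<^sup>1(0,T;L\<^sup>q)\<close> norm.\<close>

definition W :: "real \<times> 'a \<Rightarrow> real" where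
  "W z = 1 + norm (w (fst z) (snd z))"

definition V :: "(real \<times> 'a \<Rightarrow> real) set" where
  "V = {g \<in> borel_measurable M. \<exists>\<kappa>. \<forall>z\<in>space M. \<bar>g z\<bar> \<le> \<kappa> * W z}"

definition N :: "(real \<times> 'a \<Rightarrow> real) \<Rightarrow> real" where
  "N g = (LINT t|A. lnorm q X (\<lambda>x. max 0 (g (t, x))))"

section \<open>The weighted function space and the one-sided norm\<close>

lemma \<Omega>_lmeasurable: "\<Omega> \<in> lmeasurable"
  using bounded_\<Omega> open_\<Omega> by (simp add: lmeasurable_open)

sublocale X: finite_measure X
  using \<Omega>_lmeasurable by (rule finite_measure_lebesgue_on)

sublocale A: finite_measure A
  by (rule finite_measure_lebesgue_on) (simp add: lmeasurable_open)

sublocale P: pair_sigma_finite A X ..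

sublocale M: finite_measure M
  by (rule finite_measure_pair_measure) unfold_locales

lemma space_M: "space M = {0<..<T} \<times> \<Omega>"
  by (simp add: space_pair_measure)

lemma w_pair_measurable[measurable]: "(\<lambda>z. w (fst z) (snd z)) \<in> borel_measurable M"
  using w_measurable by (simp add: case_prod_beta)

lemma W_measurable[measurable]: "W \<in> borel_measurable M"
  unfolding W_def[abs_def] by measurable

lemma W_ge_1: "1 \<le> W z" and W_pos: "0 < W z"
  by (simp_all add: W_def add_pos_nonneg)

lemma q_pos: "0 < q"
  using q by simp

lemma W_slice:
  assumes t: "t \<in> {0<..<T}"
  shows "integrable X (\<lambda>x. \<bar>W (t, x)\<bar> powr q)"
    and "lnorm q X (\<lambda>x. W (t, x)) \<le> lnorm q X (\<lambda>x. 1) + lnorm q X (\<lambda>x. norm (w t x))"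
proof -
  have [measurable]: "(\<lambda>x. norm (w t x)) \<in> borel_measurable X"
    using P.measurable_slice[of "\<lambda>z. norm (w (fst z) (snd z))" t] t by simp
  show "integrable X (\<lambda>x. \<bar>W (t, x)\<bar> powr q)"
    using integrable_powr_add[of q "\<lambda>x. 1" X "\<lambda>x. norm (w t x)"] w_slice[OF t] q by (simp add: W_def)
  show "lnorm q X (\<lambda>x. W (t, x)) \<le> lnorm q X (\<lambda>x. 1) + lnorm q X (\<lambda>x. norm (w t x))"
    using lnorm_triangle[of q "\<lambda>x. 1" X "\<lambda>x. norm (w t x)"] w_slice[OF t] q by (simp add: W_def)
qed

lemma W_lnorm: "integrable A (\<lambda>t. lnorm q X (\<lambda>x. W (t, x)))"
proof (rule Bochner_Integration.integrable_bound)
  show "integrable A (\<lambda>t. lnorm q X (\<lambda>x. 1) + lnorm q X (\<lambda>x. norm (w t x)))"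
    using w_lnorm by (intro Bochner_Integration.integrable_add) auto
  show "(\<lambda>t. lnorm q X (\<lambda>x. W (t, x))) \<in> borel_measurable A"
    by (rule measurable_slice_lnorm) (auto intro: X.sigma_finite_measure_axioms)
  show "AE t in A. norm (lnorm q X (\<lambda>x. W (t, x))) \<le> norm (lnorm q X (\<lambda>x. 1) + lnorm q X (\<lambda>x. norm (w t x)))"
    using W_slice(2) by (intro AE_I2) simp
qed

text \<open>Hoelder's inequality against the constant 1 bounds the integral of each slice by its
  norm in \<open>L\<^sup>q\<close>, which is integrable in time.\<close>

lemma W_integrable: "integrable M W"
proof (rule P.Fubini_integrable)
  have slice: "integrable X (\<lambda>x. W (t, x))"
    and le: "(LINT x|X. W (t, x)) \<le> (LINT x|X. 1) powr (1 - 1 / q) * lnorm q X (\<lambda>x. W (t, x))" if t: "t \<in> {0<..<T}" for t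
  proof -
    have [measurable]: "(\<lambda>x. W (t, x)) \<in> borel_measurable X"
      using P.measurable_slice[of W t] t by simp
    show "integrable X (\<lambda>x. W (t, x))"
      "(LINT x|X. W (t, x)) \<le> (LINT x|X. 1) powr (1 - 1 / q) * lnorm q X (\<lambda>x. W (t, x))"
      using Holder[of q "\<lambda>x. 1" X "\<lambda>x. W (t, x)"] W_slice(1)[OF t] q W_pos by (simp_all add: less_imp_le)
  qed
  show "AE t in A. integrable X (\<lambda>x. W (t, x))"
    using slice by (intro AE_I2) simp
  show "integrable A (\<lambda>t. LINT x|X. norm (W (t, x)))"
  proof (rule Bochner_Integration.integrable_bound)
    show "integrable A (\<lambda>t. (LINT x|X. 1) powr (1 - 1 / q) * lnorm q X (\<lambda>x. W (t, x)))"
      using W_lnorm by (rule integrable_mult_right)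
    show "AE t in A. norm (LINT x|X. norm (W (t, x))) \<le> norm ((LINT x|X. 1) powr (1 - 1 / q) * lnorm q X (\<lambda>x. W (t, x)))"
      using le W_pos by (intro AE_I2) (simp add: less_imp_le)
  qed measurable
qed simp

lemma V_D:
  assumes "g \<in> V"
  shows "g \<in> borel_measurable M" and "\<exists>\<kappa>\<ge>0. \<forall>z\<in>space M. \<bar>g z\<bar> \<le> \<kappa> * W z"
proof -
  show "g \<in> borel_measurable M"
    using assms by (simp add: V_def)
  obtain \<kappa> where \<kappa>: "\<forall>z\<in>space M. \<bar>g z\<bar> \<le> \<kappa> * W z"
    using assms by (auto simp: V_def)
  have "\<kappa> * W z \<le> max 0 \<kappa> * W z" for z
    using W_pos[of z] by (intro mult_right_mono) auto
  then show "\<exists>\<kappa>\<ge>0. \<forall>z\<in>space M. \<bar>g z\<bar> \<le> \<kappa> * W z"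
    using \<kappa> by (intro exI[of _ "max 0 \<kappa>"]) (auto intro: order_trans)
qed

lemma V_bound:
  assumes h: "h \<in> V" and [measurable]: "g \<in> borel_measurable M"
    and le: "\<And>z. z \<in> space M \<Longrightarrow> \<bar>g z\<bar> \<le> c * \<bar>h z\<bar>" and c: "0 \<le> c"
  shows "g \<in> V"
proof -
  obtain \<kappa> where \<kappa>: "\<forall>z\<in>space M. \<bar>h z\<bar> \<le> \<kappa> * W z"
    using h by (auto simp: V_def)
  have "\<bar>g z\<bar> \<le> (c * \<kappa>) * W z" if z: "z \<in> space M" for z
    using le[OF z] mult_left_mono[OF bspec[OF \<kappa> z] c] by (simp add: mult.assoc)
  then show ?thesis
    by (auto simp: V_def intro!: exI[of _ "c * \<kappa>"])
qed

lemma W_in_V: "W \<in> V"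
  using W_pos by (auto simp: V_def less_imp_le intro!: exI[of _ 1])

lemma bounded_in_V:
  assumes "g \<in> borel_measurable M" "\<And>z. z \<in> space M \<Longrightarrow> \<bar>g z\<bar> \<le> c" "0 \<le> c"
  shows "g \<in> V"
proof (rule V_bound[OF W_in_V assms(1) _ assms(3)])
  fix z assume "z \<in> space M"
  then have "\<bar>g z\<bar> \<le> c * 1"
    using assms(2) by simp
  also have "c * 1 \<le> c * \<bar>W z\<bar>"
    using W_ge_1[of z] assms(3) by (intro mult_left_mono) auto
  finally show "\<bar>g z\<bar> \<le> c * \<bar>W z\<bar>" .
qed

lemma subspace_V: "subspace V"
proof (rule subspaceI)
  show "0 \<in> V"
    by (rule bounded_in_V[of _ 0]) (auto simp: zero_fun_def)
next
  fix g h assume gh: "g \<in> V" "h \<in> V"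
  then obtain a b where *: "\<forall>z\<in>space M. \<bar>g z\<bar> \<le> a * W z" "\<forall>z\<in>space M. \<bar>h z\<bar> \<le> b * W z"
    by (auto simp: V_def)
  have [measurable]: "g \<in> borel_measurable M" "h \<in> borel_measurable M"
    using gh by (auto simp: V_def)
  have "\<bar>g z + h z\<bar> \<le> (a + b) * W z" if "z \<in> space M" for z
    using bspec[OF *(1) that] bspec[OF *(2) that] by (simp add: distrib_right)
  then show "g + h \<in> V"
    by (auto simp: V_def plus_fun_def intro!: exI[of _ "a + b"])
next
  fix c :: real and g assume g: "g \<in> V"
  have [measurable]: "g \<in> borel_measurable M"
    using V_D(1)[OF g] .
  show "c *\<^sub>R g \<in> V"
    by (rule V_bound[OF g, where c="\<bar>c\<bar>"]) (auto simp: abs_mult scaleR_fun_def)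
qed

lemma V_slice:
  assumes g: "g \<in> V" and t: "t \<in> {0<..<T}"
  shows "(\<lambda>x. g (t, x)) \<in> borel_measurable X" and "integrable X (\<lambda>x. \<bar>g (t, x)\<bar> powr q)"
proof -
  show *: "(\<lambda>x. g (t, x)) \<in> borel_measurable X"
    using P.measurable_slice[OF V_D(1)[OF g]] t by simp
  have [measurable]: "(\<lambda>x. W (t, x)) \<in> borel_measurable X"
    using P.measurable_slice[of W t] t by simp
  obtain \<kappa> where \<kappa>: "0 \<le> \<kappa>" "\<forall>z\<in>space M. \<bar>g z\<bar> \<le> \<kappa> * W z"
    using V_D(2)[OF g] by blast
  show "integrable X (\<lambda>x. \<bar>g (t, x)\<bar> powr q)"
  proof (rule lnorm_mono(1)[OF q_pos *, where h="\<lambda>x. \<kappa> * W (t, x)"])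
    show "integrable X (\<lambda>x. \<bar>\<kappa> * W (t, x)\<bar> powr q)"
      using W_slice(1)[OF t] by (simp add: abs_mult powr_mult)
    show "\<bar>g (t, x)\<bar> \<le> \<bar>\<kappa> * W (t, x)\<bar>" if "x \<in> space X" for x
      using \<kappa>(2) that t space_M by (auto intro: order_trans[OF _ abs_ge_self])
  qed
qed

lemma V_lnorm: 
  assumes g: "g \<in> V"
  shows "integrable A (\<lambda>t. lnorm q X (\<lambda>x. g (t, x)))"
proof -
  obtain \<kappa> where \<kappa>: "0 \<le> \<kappa>" "\<forall>z\<in>space M. \<bar>g z\<bar> \<le> \<kappa> * W z"
    using V_D(2)[OF g] by blast
  have [measurable]: "g \<in> borel_measurable M"
    using V_D(1)[OF g] .
  show ?thesis
  proof (rule Bochner_Integration.integrable_bound)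
    show "integrable A (\<lambda>t. \<kappa> * lnorm q X (\<lambda>x. W (t, x)))"
      using W_lnorm by (rule integrable_mult_right)
    show "(\<lambda>t. lnorm q X (\<lambda>x. g (t, x))) \<in> borel_measurable A"
      by (rule measurable_slice_lnorm) (auto intro: X.sigma_finite_measure_axioms)
    show "AE t in A. norm (lnorm q X (\<lambda>x. g (t, x))) \<le> norm (\<kappa> * lnorm q X (\<lambda>x. W (t, x)))"
    proof (rule AE_I2)
      fix t assume "t \<in> space A"
      then have t: "t \<in> {0<..<T}" by simp
      have "lnorm q X (\<lambda>x. g (t, x)) \<le> lnorm q X (\<lambda>x. \<kappa> * W (t, x))"
        using V_slice(1)[OF g t] \<kappa> W_slice(1)[OF t] t space_M
        by (intro lnorm_mono(2)[OF q_pos]) (auto simp: abs_mult powr_mult abs_of_pos[OF W_pos])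
      then show "norm (lnorm q X (\<lambda>x. g (t, x))) \<le> norm (\<kappa> * lnorm q X (\<lambda>x. W (t, x)))"
        using \<kappa>(1) by (simp add: lnorm_cmult[OF q_pos])
    qed
  qed
qed

lemma V_max_0:
  assumes g: "g \<in> V"
  shows "(\<lambda>z. max 0 (g z)) \<in> V"
  using V_D(1)[OF g] by (intro V_bound[OF g, of _ 1]) auto

lemma N_nonneg: "0 \<le> N g"
  by (simp add: N_def)

lemma N_add:
  assumes g: "g \<in> V" and h: "h \<in> V"
  shows "N (g + h) \<le> N g + N h"
proof -
  have gh: "g + h \<in> V"
    using g h subspace_V by (rule subspace_add[rotated])
  have "N (g + h) \<le> (LINT t|A. lnorm q X (\<lambda>x. max 0 (g (t, x))) + lnorm q X (\<lambda>x. max 0 (h (t, x))))"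
    unfolding N_def
  proof (rule integral_mono)
    fix t assume "t \<in> space A"
    then have t: "t \<in> {0<..<T}" by simp
    note * = V_slice[OF V_max_0[OF g] t] V_slice[OF V_max_0[OF h] t]
    have "lnorm q X (\<lambda>x. max 0 ((g + h) (t, x))) \<le> lnorm q X (\<lambda>x. max 0 (g (t, x)) + max 0 (h (t, x)))"
      using * q_pos V_slice(1)[OF V_max_0[OF gh] t]
      by (intro lnorm_mono(2) integrable_powr_add) auto
    also have "\<dots> \<le> lnorm q X (\<lambda>x. max 0 (g (t, x))) + lnorm q X (\<lambda>x. max 0 (h (t, x)))"
      using * q by (intro lnorm_triangle) auto
    finally show "lnorm q X (\<lambda>x. max 0 ((g + h) (t, x)))
      \<le> lnorm q X (\<lambda>x. max 0 (g (t, x))) + lnorm q X (\<lambda>x. max 0 (h (t, x)))" .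
  qed (use V_lnorm[OF V_max_0[OF g]] V_lnorm[OF V_max_0[OF h]] V_lnorm[OF V_max_0[OF gh]] in auto)
  also have "\<dots> = N g + N h"
    unfolding N_def using V_lnorm[OF V_max_0[OF g]] V_lnorm[OF V_max_0[OF h]]
    by (rule Bochner_Integration.integral_add)
  finally show ?thesis .
qed

lemma N_scale: "c > 0 \<Longrightarrow> N (c *\<^sub>R g) = c * N g"
proof -
  assume c: "c > 0"
  have "max 0 (c * y) = c * max 0 y" for y :: real
    using c by (simp add: max_def zero_le_mult_iff)
  then show ?thesis
    using c by (simp add: N_def lnorm_cmult[OF q_pos])
qed

text \<open>This is where one-sidedness pays off: a linear functional \<open>l\<close> below a
  multiple of \<open>N\<close> satisfies \<open>l (- g) \<le> 0\<close> for nonnegative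
  \<open>g\<close>, and so it is positive.\<close>

lemma N_nonpos:
  assumes "\<And>z. z \<in> space M \<Longrightarrow> g z \<le> 0"
  shows "N g = 0"
proof -
  have "lnorm q X (\<lambda>x. max 0 (g (t, x))) = lnorm q X (\<lambda>x. 0)" if "t \<in> space A" for t
    using that assms[of "(t, _)"] space_M by (intro lnorm_cong) (simp add: max_absorb1)
  then have "N g = (LINT t|A. 0)"
    unfolding N_def by (intro Bochner_Integration.integral_cong) simp_all
  then show ?thesis by simp
qed

text \<open>Almost every time slice of a null set is a null set. In the representation by a density
  this becomes absolute continuity.\<close>

lemma N_null:
  assumes S: "S \<in> null_sets M"
  shows "N (\<lambda>z. W z * indicator S z) = 0"
proof -
  have "AE z in M. z \<notin> S"
    using S by (rule AE_not_in)
  then have "AE t in A. AE x in X. (t, x) \<notin> S"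
    by (rule P.AE_pair)
  then have "AE t in A. lnorm q X (\<lambda>x. max 0 (W (t, x) * indicator S (t, x))) = 0"
  proof eventually_elim
    case (elim t)
    then have "AE x in X. \<bar>max 0 (W (t, x) * indicator S (t, x))\<bar> powr q = 0"
      by eventually_elim simp
    then show ?case
      by (simp add: lnorm_def integral_eq_zero_AE)
  qed
  then show ?thesis
    unfolding N_def by (rule integral_eq_zero_AE)
qed

text \<open>Dominated convergence is used twice, in space with the \<open>q\<close>-th power of a
  slice of \<open>W\<close> as majorant, and in time with the slice norms of \<open>W\<close>. This
  supplies countable additivity of the representing measure.\<close>

lemma N_continuous:
  fixes S :: "nat \<Rightarrow> (real \<times> 'a) set"
  assumes S: "range S \<subseteq> sets M" "decseq S" "(\<Inter>i. S i) = {}"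
  shows "(\<lambda>i. N (\<lambda>z. W z * indicator (S i) z)) \<longlonglongrightarrow> 0"
proof -
  have [measurable]: "S i \<in> sets M" for i
    using S by auto
  define g where "g i z = max 0 (W z * indicator (S i) z)" for i z
  have g_V: "g i \<in> V" for i
    unfolding g_def by (rule V_bound[OF W_in_V, of _ 1]) (auto simp: indicator_def)
  have g_le: "\<bar>g i z\<bar> \<le> \<bar>W z\<bar>" for i z
    by (auto simp: g_def indicator_def)
  have g_lim: "(\<lambda>i. g i z) \<longlonglongrightarrow> 0" for z
  proof -
    obtain j where "z \<notin> S j"
      using S(3) by blast
    then have "z \<notin> S i" if "i \<ge> j" for i
      using S(2) that by (auto simp: decseq_def)
    then have "\<forall>\<^sub>F i in sequentially. g i z = 0"
      by (auto simp: g_def eventually_sequentially intro!: exI[of _ j])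
    then show ?thesis
      by (rule tendsto_eventually)
  qed
  have inner: "(\<lambda>i. lnorm q X (\<lambda>x. g i (t, x))) \<longlonglongrightarrow> 0" if t: "t \<in> {0<..<T}" for t
  proof -
    have "(\<lambda>i. LINT x|X. \<bar>g i (t, x)\<bar> powr q) \<longlonglongrightarrow> (LINT x|X. 0)"
    proof (rule integral_dominated_convergence[where w="\<lambda>x. \<bar>W (t, x)\<bar> powr q"])
      show "integrable X (\<lambda>x. \<bar>W (t, x)\<bar> powr q)"
        by (rule W_slice(1)[OF t])
      show "AE x in X. (\<lambda>i. \<bar>g i (t, x)\<bar> powr q) \<longlonglongrightarrow> 0"
        using g_lim q_pos by (intro AE_I2 tendsto_zero_powrI[OF _ tendsto_const] tendsto_rabs_zero) auto
      show "(\<lambda>x. \<bar>g i (t, x)\<bar> powr q) \<in> borel_measurable X" for i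
        using V_slice(2)[OF g_V t] by auto
      show "AE x in X. norm (\<bar>g i (t, x)\<bar> powr q) \<le> \<bar>W (t, x)\<bar> powr q" for i
        using g_le q_pos by (intro AE_I2) (auto intro!: powr_mono2)
    qed simp
    then show ?thesis
      unfolding lnorm_def using q_pos by (intro tendsto_zero_powrI[OF _ tendsto_const]) auto
  qed
  have "(\<lambda>i. LINT t|A. lnorm q X (\<lambda>x. g i (t, x))) \<longlonglongrightarrow> (LINT t|A. 0)"
  proof (rule integral_dominated_convergence[OF _ _ W_lnorm])
    show "AE t in A. (\<lambda>i. lnorm q X (\<lambda>x. g i (t, x))) \<longlonglongrightarrow> 0"
      using inner by (intro AE_I2) simp
    show "AE t in A. norm (lnorm q X (\<lambda>x. g i (t, x))) \<le> lnorm q X (\<lambda>x. W (t, x))" for i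
    proof (rule AE_I2)
      fix t assume "t \<in> space A"
      then have "t \<in> {0<..<T}" by simp
      then show "norm (lnorm q X (\<lambda>x. g i (t, x))) \<le> lnorm q X (\<lambda>x. W (t, x))"
        using lnorm_mono(2)[OF q_pos V_slice(1)[OF g_V] W_slice(1) g_le] by simp
    qed
    show "(\<lambda>t. lnorm q X (\<lambda>x. g i (t, x))) \<in> borel_measurable A" for i
      using V_lnorm[OF g_V] by auto
  qed simp
  then show ?thesis
    by (simp add: N_def g_def)
qed

text \<open>Sublinearity of \<open>N\<close> allows the extension, and the three properties of
  \<open>N\<close> above make the extended functional a measure with a density. The bound by
  \<open>C * N g\<close> holds on all of \<open>V\<close>, beyond the domain of \<open>G\<close>;
  this is what later permits testing with powers of the density itself.\<close>

theorem ex_density: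
  assumes C: "0 \<le> C" and G: "graph_below V (\<lambda>g. C * N g) G"
  shows "\<exists>\<rho>\<in>borel_measurable M. (\<forall>z. 0 \<le> \<rho> z) \<and>
    (\<forall>g\<in>V. integrable M (\<lambda>z. \<rho> z * g z) \<and> (LINT z|M. \<rho> z * g z) \<le> C * N g) \<and>
    (\<forall>(g, a)\<in>G. (LINT z|M. \<rho> z * g z) = a)"
proof -
  have "C * N (g + h) \<le> C * N g + C * N h" if "g \<in> V" "h \<in> V" for g h
    using mult_left_mono[OF N_add[OF that] C] by (simp add: distrib_left)
  moreover have "C * N (c *\<^sub>R g) = c * (C * N g)" if "c > 0" "g \<in> V" for c g
    using N_scale[OF that(1)] by simp
  ultimately obtain l where add: "\<forall>g\<in>V. \<forall>h\<in>V. l (g + h) = l g + l h"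
    and scale: "\<forall>c. \<forall>g\<in>V. l (c *\<^sub>R g) = c * l g"
    and le: "\<forall>g\<in>V. l g \<le> C * N g" and G_l: "\<forall>(g, a)\<in>G. l g = a"
    using Hahn_Banach_graph[OF subspace_V _ _ G] by blast
  have neg: "l (\<lambda>z. - g z) = - l g" if "g \<in> V" for g
  proof -
    have "(\<lambda>z. - g z) = (- 1) *\<^sub>R g"
      by (simp add: fun_eq_iff)
    then show ?thesis
      using scale that by (metis mult_minus1)
  qed
  have V_neg: "(\<lambda>z. - g z) \<in> V" if "g \<in> V" for g
    using V_D(1)[OF that] by (intro V_bound[OF that, of _ 1]) auto
  have pos_l: "0 \<le> l g" if "g \<in> V" "\<And>z. z \<in> space M \<Longrightarrow> 0 \<le> g z" for g
    using le V_neg[OF that(1)] neg[OF that(1)] N_nonpos[of "\<lambda>z. - g z"] that(2) by force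
  have ind_V: "(\<lambda>z. W z * indicator S z) \<in> V" if [measurable]: "S \<in> sets M" for S
    by (rule V_bound[OF W_in_V, of _ 1]) (auto simp: indicator_def)
  have ind_le: "\<bar>l (\<lambda>z. W z * indicator S z)\<bar> \<le> C * N (\<lambda>z. W z * indicator S z)" if "S \<in> sets M" for S
    using le pos_l[OF ind_V[OF that]] ind_V[OF that] W_pos by (simp add: less_imp_le)
  have "\<exists>\<rho>\<in>borel_measurable M. (\<forall>z. 0 \<le> \<rho> z) \<and>
    (\<forall>g\<in>V. integrable M (\<lambda>z. \<rho> z * g z) \<and> l g = (LINT z|M. \<rho> z * g z))"
    unfolding V_def
  proof (rule positive_functional_representation[OF _ W_measurable W_pos],
      unfold V_def[symmetric])
    show "sigma_finite_measure M"
      by unfold_locales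
    show "l (\<lambda>z. g z + h z) = l g + l h" if "g \<in> V" "h \<in> V" for g h
      using add that by (simp add: plus_fun_def)
    show "l (\<lambda>z. c * g z) = c * l g" if "g \<in> V" for c g
      using scale that by (simp add: scaleR_fun_def)
    show "0 \<le> l g" if "g \<in> V" "\<And>z. z \<in> space M \<Longrightarrow> 0 \<le> g z" for g
      using that by (rule pos_l)
    show "l (\<lambda>z. W z * indicator S z) = 0" if "S \<in> null_sets M" for S
      using ind_le[of S] N_null[OF that] that by auto
    show "(\<lambda>i. l (\<lambda>z. W z * indicator (S i) z)) \<longlonglongrightarrow> 0"
      if S: "range S \<subseteq> sets M" "decseq S" "(\<Inter>i. S i) = {}" for S :: "nat \<Rightarrow> (real \<times> 'a) set"
    proof (rule tendsto_rabs_zero_cancel, rule tendsto_sandwich[OF _ _ tendsto_const])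
      show "(\<lambda>i. C * N (\<lambda>z. W z * indicator (S i) z)) \<longlonglongrightarrow> 0"
        using tendsto_mult_right_zero[OF N_continuous[OF S]] .
      show "\<forall>\<^sub>F i in sequentially. \<bar>l (\<lambda>z. W z * indicator (S i) z)\<bar> \<le> C * N (\<lambda>z. W z * indicator (S i) z)"
        using S(1) ind_le by (intro always_eventually) auto
    qed simp
  qed
  then obtain \<rho> where \<rho>: "\<rho> \<in> borel_measurable M" "\<forall>z. 0 \<le> \<rho> z"
    and repr: "\<forall>g\<in>V. integrable M (\<lambda>z. \<rho> z * g z) \<and> l g = (LINT z|M. \<rho> z * g z)"
    by (elim bexE conjE)
  have l_eq: "l g = (LINT z|M. \<rho> z * g z)" if "g \<in> V" for g
    using repr that by blast
  have bound: "\<forall>g\<in>V. integrable M (\<lambda>z. \<rho> z * g z) \<and> (LINT z|M. \<rho> z * g z) \<le> C * N g"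
  proof
    fix g assume g: "g \<in> V"
    show "integrable M (\<lambda>z. \<rho> z * g z) \<and> (LINT z|M. \<rho> z * g z) \<le> C * N g"
      using bspec[OF repr g] bspec[OF le g] by simp
  qed
  have graph: "\<forall>(g, a)\<in>G. (LINT z|M. \<rho> z * g z) = a"
  proof
    fix x assume x: "x \<in> G"
    have "fst x \<in> V"
      using G x unfolding graph_below_def by blast
    then have "(LINT z|M. \<rho> z * fst x z) = l (fst x)"
      using l_eq by simp
    also have "\<dots> = snd x"
      using bspec[OF G_l x] by (simp add: case_prod_beta)
    finally show "case x of (g, a) \<Rightarrow> (LINT z|M. \<rho> z * g z) = a"
      by (simp add: case_prod_beta)
  qed
  show ?thesis
    by (rule bexI[OF _ \<rho>(1)]) (rule conjI[OF \<rho>(2) conjI[OF bound graph]])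
qed

end

lemma AE_eq_0_if_integral_nonpos:
  fixes f :: "'a \<Rightarrow> real"
  assumes "integrable N f" "\<And>x. 0 \<le> f x" "(LINT x|N. f x) \<le> 0"
  shows "AE x in N. f x = 0"
proof -
  have "(LINT x|N. f x) = 0"
    using assms by (intro antisym Bochner_Integration.integral_nonneg) auto
  then show ?thesis
    using assms by (subst (asm) integral_nonneg_eq_0_iff_AE) auto
qed

section \<open>Bounds on the density, uniform in time\<close>

context velocity
begin

text \<open>The test function is the indicator of the set where \<rho> exceeds \<open>C\<close>. For
  \<open>q = 1\<close> its norm \<open>N\<close> is the measure of that set, so the integral of
  \<open>\<rho> - C\<close> over the set cannot be positive.\<close>

lemma density_bound_infinity:
  assumes q1: "q = 1" and [measurable]: "\<rho> \<in> borel_measurable M"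
    and \<rho>: "\<And>g. g \<in> V \<Longrightarrow> integrable M (\<lambda>z. \<rho> z * g z)"
      "\<And>g. g \<in> V \<Longrightarrow> (LINT z|M. \<rho> z * g z) \<le> C * N g"
  shows "AE z in M. \<rho> z \<le> C"
proof -
  define S where "S = {z \<in> space M. C < \<rho> z}"
  have [measurable]: "S \<in> sets M"
    unfolding S_def by measurable
  have ind: "indicator S \<in> V"
    by (rule bounded_in_V[of _ 1]) (auto simp: indicator_def)
  have int: "integrable M (indicator S :: _ \<Rightarrow> real)"
    by (rule M.integrable_const_bound[where B=1]) (auto simp: indicator_def)
  have "\<bar>max 0 (indicat_real S z)\<bar> powr q = indicator S z" for z
    by (simp add: indicator_def q1)
  then have "lnorm q X (\<lambda>x. max 0 (indicat_real S (t, x))) = (LINT x|X. indicator S (t, x))" for t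
    using q1 by (simp add: lnorm_def)
  then have "N (indicator S) = (LINT t|A. LINT x|X. indicator S (t, x))"
    by (simp add: N_def)
  also have "\<dots> = (LINT z|M. indicator S z)"
    using P.integral_fst'[OF int] by simp
  finally have "(LINT z|M. \<rho> z * indicator S z) \<le> C * (LINT z|M. indicator S z)"
    using \<rho>(2)[OF ind] by simp
  then have "(LINT z|M. \<rho> z * indicator S z - C * indicator S z) \<le> 0"
    using \<rho>(1)[OF ind] int by simp
  moreover have nn: "0 \<le> \<rho> z * indicator S z - C * indicator S z" for z
    by (auto simp: S_def indicator_def)
  moreover have "integrable M (\<lambda>z. \<rho> z * indicator S z - C * indicator S z)"
    using \<rho>(1)[OF ind] int by simp
  ultimately have "AE z in M. \<rho> z * indicator S z - C * indicator S z = 0"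
    by (intro AE_eq_0_if_integral_nonpos)
  with AE_space show ?thesis
    by eventually_elim (auto simp: S_def indicator_def split: if_splits)
qed

text \<open>\<open>N\<close> only integrates over time, so a test function may be confined to an
  arbitrary measurable set of times. Confining it to the times at which the bound fails yields a
  bound at almost every single time. Truncation of \<rho> keeps the test function bounded, hence in
  \<open>V\<close>, and is removed by monotone convergence.\<close>

lemma density_bound:
  assumes q1: "1 < q" and [measurable]: "\<rho> \<in> borel_measurable M" and nn: "\<And>z. 0 \<le> \<rho> z" and C: "0 \<le> C"
    and \<rho>: "\<And>g. g \<in> V \<Longrightarrow> integrable M (\<lambda>z. \<rho> z * g z)"
      "\<And>g. g \<in> V \<Longrightarrow> (LINT z|M. \<rho> z * g z) \<le> C * N g"
    and p: "p = q / (q - 1)"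
  shows "AE t in A. (\<integral>\<^sup>+x. ennreal (\<rho> (t, x) powr p) \<partial>X) \<le> ennreal (C powr p)"
proof -
  have p1: "1 < p" and pq: "(p - 1) * q = p" and pq': "1 / p + 1 / q = 1"
    using q1 by (auto simp: p field_simps)
  have trunc: "AE t in A. (LINT x|X. min (\<rho> (t, x)) (real k) powr p) \<le> C powr p" for k :: nat
  proof -
    define r where "r z = min (\<rho> z) (real k)" for z
    have [measurable]: "r \<in> borel_measurable M"
      unfolding r_def by measurable
    have r: "0 \<le> r z" "r z \<le> k" "r z \<le> \<rho> z" for z
      using nn by (auto simp: r_def)
    define y where "y t = (LINT x|X. r (t, x) powr p)" for t
    have y_nn: "0 \<le> y t" for t
      by (simp add: y_def)
    have [measurable]: "y \<in> borel_measurable A"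
      unfolding y_def by measurable
    define E where "E = {t \<in> space A. C powr p < y t}"
    have [measurable]: "E \<in> sets A"
      unfolding E_def by measurable
    \<comment> \<open>Since \<open>(p - 1) q = p\<close>, both sides of the bound for this \<open>g\<close> are integrals of powers of \<open>y\<close>
      over \<open>E\<close>, and they contradict each other unless \<open>E\<close> is a null set.\<close>
    define g where "g z = indicator E (fst z) * r z powr (p - 1)" for z
    have [measurable]: "g \<in> borel_measurable M"
      unfolding g_def by measurable
    have g_bd: "0 \<le> g z" "g z \<le> real k powr (p - 1)" for z
      using r[of z] p1 by (auto simp: g_def indicator_def intro!: powr_mono2)
    have g_V: "g \<in> V"
      by (rule bounded_in_V[of _ "real k powr (p - 1)"]) (use g_bd in \<open>auto simp: abs_of_nonneg\<close>)
    have int_r: "integrable M (\<lambda>z. indicator E (fst z) * r z powr p)"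
      using r p1 by (intro M.integrable_const_bound[where B="real k powr p"])
        (auto simp: indicator_def intro!: powr_mono2)
    have lnorm_g: "lnorm q X (\<lambda>x. max 0 (g (t, x))) = indicator E t * y t powr (1 / q)" for t
    proof -
      have "\<bar>max 0 (g (t, x))\<bar> powr q = indicator E t * r (t, x) powr p" for x
        using g_bd[of "(t, x)"] q_pos by (simp add: g_def powr_mult powr_powr pq indicator_def)
      then show ?thesis
        by (simp add: lnorm_def y_def indicator_def)
    qed
    have "(LINT t|A. indicator E t * y t) = (LINT z|M. indicator E (fst z) * r z powr p)"
      using P.integral_fst'[OF int_r] by (simp add: y_def)
    also have "\<dots> \<le> (LINT z|M. \<rho> z * g z)"
    proof (rule integral_mono[OF int_r \<rho>(1)[OF g_V]])
      fix z
      have "r z powr p = r z powr (p - 1) * r z"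
        using r by (simp add: powr_diff_one_mult)
      also have "\<dots> \<le> r z powr (p - 1) * \<rho> z"
        using r by (intro mult_left_mono) auto
      finally show "indicator E (fst z) * r z powr p \<le> \<rho> z * g z"
        by (auto simp: g_def indicator_def mult.commute)
    qed
    also have "\<dots> \<le> C * (LINT t|A. indicator E t * y t powr (1 / q))"
      using \<rho>(2)[OF g_V] by (simp add: N_def lnorm_g)
    finally have le: "(LINT t|A. indicator E t * y t) \<le> C * (LINT t|A. indicator E t * y t powr (1 / q))" .
    have int_y: "integrable A (\<lambda>t. indicator E t * y t)"
      using P.integrable_fst'[OF int_r] by (simp add: y_def)
    have int_N: "integrable A (\<lambda>t. indicator E t * y t powr (1 / q))"
      using V_lnorm[OF V_max_0[OF g_V]] by (simp add: lnorm_g)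
    \<comment> \<open>On \<open>E\<close> the constant \<open>C\<close> is smaller than
      \<open>y t powr (1 / p)\<close>, and the exponents \<open>1 / p\<close> and
      \<open>1 / q\<close> add up to 1.\<close>
    have gap: "0 < y t - C * y t powr (1 / q)" if "t \<in> E" for t
    proof -
      have yC: "C powr p < y t"
        using that by (simp add: E_def)
      then have y: "0 < y t"
        using powr_ge_zero[of C p] by linarith
      have "C = (C powr p) powr (1 / p)"
        using C p1 by (simp add: powr_powr)
      also have "\<dots> < y t powr (1 / p)"
        using yC p1 by (intro powr_less_mono2) auto
      finally have "C * y t powr (1 / q) < y t powr (1 / p) * y t powr (1 / q)"
        using y by (intro mult_strict_right_mono) auto
      also have "\<dots> = y t"
        using y pq' by (simp flip: powr_add)
      finally show ?thesis by simp
    qed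
    define d where "d t = indicator E t * y t - C * (indicator E t * y t powr (1 / q))" for t
    have "integrable A d"
      unfolding d_def using int_y int_N by auto
    moreover have "0 \<le> d t" for t
      using gap by (auto simp: d_def indicator_def less_imp_le)
    moreover have "(LINT t|A. d t) \<le> 0"
      unfolding d_def using le int_y int_N by simp
    ultimately have "AE t in A. d t = 0"
      by (intro AE_eq_0_if_integral_nonpos)
    with AE_space show ?thesis
    proof eventually_elim
      case (elim t)
      then have "t \<notin> E"
        using gap[of t] by (auto simp: d_def)
      then show ?case
        using elim by (simp add: E_def y_def r_def)
    qed
  qed
  \<comment> \<open>The exceptional times depend on the truncation level. There are countably many
    levels, so one null set serves them all.\<close>
  have "AE t in A. \<forall>k. (LINT x|X. min (\<rho> (t, x)) (real k) powr p) \<le> C powr p"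
    using trunc by (simp add: AE_all_countable)
  with AE_space show ?thesis
  proof eventually_elim
    case (elim t)
    have [measurable]: "(\<lambda>x. \<rho> (t, x)) \<in> borel_measurable X"
      using elim by (intro P.measurable_slice) auto
    define f where "f k x = ennreal (min (\<rho> (t, x)) (real k) powr p)" for k x
    have f_le: "f k x \<le> ennreal (\<rho> (t, x) powr p)" for k x
      unfolding f_def using nn p1 by (intro ennreal_leI powr_mono2) auto
    have "(SUP k. f k x) = ennreal (\<rho> (t, x) powr p)" for x
    proof (rule antisym)
      obtain k :: nat where "\<rho> (t, x) \<le> real k"
        using real_arch_simple by blast
      then have "ennreal (\<rho> (t, x) powr p) \<le> f k x"
        by (simp add: f_def min_absorb1)
      also have "f k x \<le> (SUP k. f k x)"
        by (rule SUP_upper) simp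
      finally show "ennreal (\<rho> (t, x) powr p) \<le> (SUP k. f k x)" .
    qed (use f_le in \<open>auto intro: SUP_least\<close>)
    then have "(\<integral>\<^sup>+x. ennreal (\<rho> (t, x) powr p) \<partial>X) = (\<integral>\<^sup>+x. (SUP k. f k x) \<partial>X)"
      by simp
    also have "\<dots> = (SUP k. \<integral>\<^sup>+x. f k x \<partial>X)"
    proof (rule nn_integral_monotone_convergence_SUP)
      show "incseq f"
        unfolding f_def incseq_def le_fun_def using nn p1
        by (intro allI impI ennreal_leI powr_mono2) auto
      show "f k \<in> borel_measurable X" for k
        unfolding f_def by measurable
    qed
    also have "\<dots> \<le> ennreal (C powr p)"
    proof (rule SUP_least)
      fix k :: nat
      have "integrable X (\<lambda>x. min (\<rho> (t, x)) (real k) powr p)"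
        using nn p1 by (intro X.integrable_const_bound[where B="real k powr p"]) (auto intro!: powr_mono2)
      then have "(\<integral>\<^sup>+x. f k x \<partial>X) = ennreal (LINT x|X. min (\<rho> (t, x)) (real k) powr p)"
        unfolding f_def by (intro nn_integral_eq_integral) auto
      then show "(\<integral>\<^sup>+x. f k x \<partial>X) \<le> ennreal (C powr p)"
        using elim by (simp add: ennreal_leI)
    qed
    finally show ?case .
  qed
qed

end

subsection \<open>Space-time test functions\<close>

lemma zero_off_support_deriv:
  fixes \<phi> :: "'b::euclidean_space \<Rightarrow> real"
  assumes "open U" "z \<in> U" "\<And>y. y \<in> U \<Longrightarrow> \<phi> y = 0"
  shows "frechet_derivative \<phi> (at z) v = 0"
proof -
  have "frechet_derivative \<phi> (at z) = frechet_derivative (\<lambda>y. 0) (at z)"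
    using assms by (intro frechet_derivative_cong_open(2)[of U]) auto
  then show ?thesis
    using frechet_derivative_at[OF has_derivative_const, of 0 z] by metis
qed

locale st_test_function =
  fixes T :: real and \<Omega> :: "'a::euclidean_space set" and \<phi> :: "real \<times> 'a \<Rightarrow> real"
  assumes T: "0 < T" and open_\<Omega>: "open \<Omega>" and \<phi>: "\<phi> \<in> spacetime_test_functions T \<Omega>"
begin

definition "K = closure {z \<in> {0..<T} \<times> \<Omega>. \<phi> z \<noteq> 0}"

lemma K: "compact K" "K \<subseteq> {0..<T} \<times> \<Omega>"
  using \<phi> by (auto simp: spacetime_test_functions_def K_def)

lemma zero_off_K: "z \<in> {0..<T} \<times> \<Omega> \<Longrightarrow> z \<notin> K \<Longrightarrow> \<phi> z = 0"
  unfolding K_def using closure_subset[of "{z \<in> {0..<T} \<times> \<Omega>. \<phi> z \<noteq> 0}"] by blast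

abbreviation "D \<equiv> {..<T} \<times> \<Omega>"

abbreviation "d\<phi> z \<equiv> frechet_derivative \<phi> (at z)"

lemma open_D: "open D"
  using open_\<Omega> by (simp add: open_Times)

lemma Ck_\<phi>: "Ck_on k D \<phi>"
  using \<phi> by (simp add: spacetime_test_functions_def smooth_on_def)

lemma has_derivative_\<phi>: "z \<in> D \<Longrightarrow> (\<phi> has_derivative d\<phi> z) (at z)"
  by (rule Ck_on_SucD[OF Ck_\<phi>])

lemma continuous_on_\<phi>: "continuous_on D \<phi>"
  using Ck_\<phi>[of 0] by simp

lemma continuous_on_d\<phi>: "continuous_on D (\<lambda>z. d\<phi> z v)"
  using Ck_\<phi>[of "Suc 0"] unfolding Ck_on.simps by blast

lemma linear_d\<phi>: "z \<in> D \<Longrightarrow> bounded_linear (d\<phi> z)"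
  using has_derivative_\<phi> has_derivative_bounded_linear by blast

lemma time_deriv:
  assumes "t < T" "x \<in> \<Omega>"
  shows "((\<lambda>s. \<phi> (s, x)) has_real_derivative d\<phi> (t, x) (1, 0)) (at t)"
    and "deriv (\<lambda>s. \<phi> (s, x)) t = d\<phi> (t, x) (1, 0)"
proof -
  have "((\<lambda>s. (s, x)) has_derivative (\<lambda>h. (h, 0))) (at t)"
    by (intro derivative_eq_intros) auto
  from has_derivative_compose[OF this, of \<phi>, OF has_derivative_\<phi>]
  have "((\<lambda>s. \<phi> (s, x)) has_derivative (\<lambda>h. d\<phi> (t, x) (h, 0))) (at t)"
    using assms by simp
  then show "((\<lambda>s. \<phi> (s, x)) has_real_derivative d\<phi> (t, x) (1, 0)) (at t)"
  proof (rule has_derivative_imp_has_field_derivative)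
    fix h show "h * d\<phi> (t, x) (1, 0) = d\<phi> (t, x) (h, 0)"
      using linear_scale[OF bounded_linear.linear[OF linear_d\<phi>], of "(t, x)" h "(1, 0)"] assms by simp
  qed
  then show "deriv (\<lambda>s. \<phi> (s, x)) t = d\<phi> (t, x) (1, 0)"
    by (rule DERIV_imp_deriv)
qed

lemma space_deriv:
  assumes "t < T" "x \<in> \<Omega>"
  shows "((\<lambda>y. \<phi> (t, y)) has_derivative (\<lambda>v. d\<phi> (t, x) (0, v))) (at x)"
proof -
  have "((\<lambda>y. (t, y)) has_derivative (\<lambda>h. (0, h))) (at x)"
    by (intro derivative_eq_intros) auto
  from has_derivative_compose[OF this, of \<phi>, OF has_derivative_\<phi>] show ?thesis
    using assms by simp
qed

text \<open>Smoothness on \<open>D\<close> alone gives no bound, since nothing is known near time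
  \<open>T\<close> or for large negative times. The bound comes from the compact set
  \<open>K\<close>, which lies inside \<open>D\<close>.\<close>

lemma bounded_off_K:
  fixes F :: "real \<times> 'a \<Rightarrow> real"
  assumes "continuous_on D F" "\<And>z. z \<in> S - K \<Longrightarrow> F z = 0"
  shows "\<exists>B\<ge>0. \<forall>z\<in>S. \<bar>F z\<bar> \<le> B"
proof -
  have "compact (F ` K)"
    using K by (intro compact_continuous_image continuous_on_subset[OF assms(1)]) auto
  then obtain B where B: "\<And>z. z \<in> K \<Longrightarrow> \<bar>F z\<bar> \<le> B"
    using compact_imp_bounded[of "F ` K"] unfolding bounded_iff by auto
  have "\<bar>F z\<bar> \<le> max 0 B" if "z \<in> S" for z
    using B[of z] assms(2)[of z] that by (cases "z \<in> K") auto
  then show ?thesis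
    by (intro exI[of _ "max 0 B"]) auto
qed

lemma bounded_\<phi>: "\<exists>B\<ge>0. \<forall>z\<in>{0..<T} \<times> \<Omega>. \<bar>\<phi> z\<bar> \<le> B"
  by (rule bounded_off_K[OF continuous_on_\<phi>]) (auto intro: zero_off_K)

lemma bounded_d\<phi>: "\<exists>B\<ge>0. \<forall>z\<in>{0<..<T} \<times> \<Omega>. \<bar>d\<phi> z v\<bar> \<le> B"
proof (rule bounded_off_K[OF continuous_on_d\<phi>])
  fix z assume z: "z \<in> {0<..<T} \<times> \<Omega> - K"
  \<comment> \<open>Time 0 has to be left out: \<phi> is not prescribed at negative times, so it
    need not vanish in a full neighbourhood of a point \<open>(0, x)\<close> off
    \<open>K\<close>.\<close>
  have "open ({0<..<T} \<times> \<Omega> - K)"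
    using K(1) open_\<Omega> by (intro open_Diff open_Times compact_imp_closed) auto
  then show "d\<phi> z v = 0"
    using z zero_off_K by (intro zero_off_support_deriv[where U="{0<..<T} \<times> \<Omega> - K"]) auto
qed

text \<open>The projection of \<open>K\<close> to the time axis is compact and contained in
  \<open>{0..<T}\<close>, so its maximum stays below \<open>T\<close>. This provides the terminal
  value 0 for the integration in time.\<close>

lemma vanishes_near_T: "\<exists>S<T. 0 \<le> S \<and> (\<forall>t x. S < t \<longrightarrow> t < T \<longrightarrow> x \<in> \<Omega> \<longrightarrow> \<phi> (t, x) = 0)"
proof (cases "K = {}")
  case True
  then show ?thesis
    using T zero_off_K by (intro exI[of _ 0]) auto
next
  case False
  have "compact (fst ` K)"
    using K(1) by (intro compact_continuous_image continuous_intros)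
  then obtain S where S: "S \<in> fst ` K" "\<And>t. t \<in> fst ` K \<Longrightarrow> t \<le> S"
    using compact_attains_sup[of "fst ` K"] False by auto
  have "S < T" "0 \<le> S"
    using S(1) K(2) by auto
  moreover have "\<phi> (t, x) = 0" if "S < t" "t < T" "x \<in> \<Omega>" for t x
  proof -
    have "t \<notin> fst ` K"
      using S(2)[of t] that by auto
    then have "(t, x) \<notin> K"
      by (metis fst_conv imageI)
    then show ?thesis
      using zero_off_K[of "(t, x)"] that \<open>0 \<le> S\<close> by simp
  qed
  ultimately show ?thesis
    by blast
qed

text \<open>Because \<open>\<beta> 0 = 0\<close>, composition does not enlarge the support, which
  stays in the section of \<open>K\<close> at time \<open>t\<close>. The function is smooth on
  \<Omega> and is zero on the open complement of that section, and these two open sets cover the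
  space. The explicit zero is needed because the values of \<phi> outside \<Omega> are
  arbitrary.\<close>

lemma slice_in_test_functions:
  assumes t: "0 \<le> t" "t < T" and \<beta>: "\<beta> 0 = 0" and Ck: "\<And>k. Ck_on k \<Omega> (\<lambda>x. \<beta> (\<phi> (t, x)))"
  shows "(\<lambda>x. if x \<in> \<Omega> then \<beta> (\<phi> (t, x)) else 0 :: real) \<in> test_functions \<Omega>" (is "?\<psi> \<in> _")
proof -
  define Kt where "Kt = snd ` (K \<inter> ({t} \<times> UNIV))"
  have Kt_iff: "x \<in> Kt \<longleftrightarrow> (t, x) \<in> K" for x
    by (force simp: Kt_def)
  have compact_Kt: "compact Kt"
    unfolding Kt_def using K(1)
    by (intro compact_continuous_image continuous_intros compact_Int_closed closed_Times) auto
  have Kt_sub: "Kt \<subseteq> \<Omega>"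
    using K(2) Kt_iff by auto
  have zero: "?\<psi> x = 0" if "x \<notin> Kt" for x
    using zero_off_K[of "(t, x)"] that t \<beta> by (auto simp: Kt_iff)
  have "{x. ?\<psi> x \<noteq> 0} \<subseteq> Kt"
    using zero by blast
  then have cl: "closure {x. ?\<psi> x \<noteq> 0} \<subseteq> Kt"
    using compact_Kt by (intro closure_minimal compact_imp_closed)
  moreover have "compact (closure {x. ?\<psi> x \<noteq> 0})"
    using compact_Int_closed[OF compact_Kt closed_closure, of "{x. ?\<psi> x \<noteq> 0}"] cl
    by (simp add: inf.absorb2)
  moreover have "Ck_on k UNIV ?\<psi>" for k
  proof -
    have "Ck_on k \<Omega> ?\<psi>"
      using Ck[of k] by (subst Ck_on_cong[OF open_\<Omega>, where g="\<lambda>x. \<beta> (\<phi> (t, x))"]) auto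
    moreover have opn: "open (- Kt)"
      using compact_Kt by (simp add: compact_imp_closed open_Compl)
    moreover have "Ck_on k (- Kt) ?\<psi>"
      using zero opn by (subst Ck_on_cong[OF opn, where g="\<lambda>x. 0"]) (auto intro: Ck_on_const)
    ultimately have "Ck_on k (\<Omega> \<union> - Kt) ?\<psi>"
      using open_\<Omega> by (intro Ck_on_Un) auto
    moreover have "\<Omega> \<union> - Kt = UNIV"
      using Kt_sub by auto
    ultimately show ?thesis by simp
  qed
  ultimately show ?thesis
    using Kt_sub by (auto simp: test_functions_def smooth_on_def)
qed

lemma Ck_slice:
  assumes "t < T"
  shows "Ck_on k \<Omega> (\<lambda>x. \<phi> (t, x))"
proof -
  have "bounded_linear (\<lambda>x :: 'a. (0 :: real, x))"
    by (intro bounded_linear_Pair bounded_linear_zero bounded_linear_ident)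
  then show ?thesis
    using Ck_on_compose_affine[of "\<lambda>x. (0, x)" \<Omega> "(t, 0)" D k \<phi>] assms Ck_\<phi> open_\<Omega> by simp
qed

end

subsection \<open>The a priori estimate\<close>

context velocity
begin

text \<open>Differentiating in the direction \<open>(- 1, w)\<close> yields the operator
  \<open>- \<phi>\<^sub>t + w \<bullet> \<nabla>\<phi>\<close> in one piece. The value 0 off the
  cylinder makes \<open>transport\<close> linear as a map between total functions, as needed for its
  pairs with data to form a subspace.\<close>

definition transport :: "(real \<times> 'a \<Rightarrow> real) \<Rightarrow> real \<times> 'a \<Rightarrow> real" where
  "transport \<phi> z =
     (if z \<in> {0<..<T} \<times> \<Omega> then frechet_derivative \<phi> (at z) (- 1, w (fst z) (snd z)) else 0)"

lemma V_integrable: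
  assumes g: "g \<in> V"
  shows "integrable M g"
proof -
  obtain \<kappa> where \<kappa>: "0 \<le> \<kappa>" "\<forall>z\<in>space M. \<bar>g z\<bar> \<le> \<kappa> * W z"
    using V_D(2)[OF g] by blast
  show ?thesis
  proof (rule Bochner_Integration.integrable_bound)
    show "integrable M (\<lambda>z. \<kappa> * W z)"
      using W_integrable by (rule integrable_mult_right)
    show "AE z in M. norm (g z) \<le> norm (\<kappa> * W z)"
      using \<kappa> by (intro AE_I2) (auto intro: order_trans[OF _ abs_ge_self])
  qed (rule V_D(1)[OF g])
qed

lemma V_slice_integrable:
  assumes g: "g \<in> V" and t: "t \<in> {0<..<T}"
  shows "integrable X (\<lambda>x. g (t, x))"
proof -
  have [measurable]: "(\<lambda>x. g (t, x)) \<in> borel_measurable X"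
    by (rule V_slice(1)[OF g t])
  have "integrable X (\<lambda>x. \<bar>g (t, x)\<bar>)"
    using Holder(1)[of q "\<lambda>x. 1" X "\<lambda>x. \<bar>g (t, x)\<bar>"] V_slice(2)[OF g t] q by simp
  then show ?thesis
    by (subst (asm) real_norm_def[symmetric]) (rule integrable_norm_cancel, auto)
qed

lemma V_add: "g \<in> V \<Longrightarrow> h \<in> V \<Longrightarrow> (\<lambda>z. g z + h z) \<in> V"
  using subspace_add[OF subspace_V, of g h] by (simp add: plus_fun_def)

text \<open>\<open>M\<close> is a product of completed measures. Its coordinate maps are Borel
  measurable, so its measurable sets include the relatively Borel ones.\<close>

lemma continuous_measurable_M:
  fixes F :: "real \<times> 'a \<Rightarrow> real"
  assumes "continuous_on ({0<..<T} \<times> \<Omega>) F"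
  shows "F \<in> borel_measurable M"
proof -
  have "(\<lambda>z. id (fst z)) \<in> borel_measurable M" "(\<lambda>z. id (snd z)) \<in> borel_measurable M"
    by (rule measurable_compose[OF measurable_fst id_borel_measurable_lebesgue_on]
        measurable_compose[OF measurable_snd id_borel_measurable_lebesgue_on])+
  then have "(\<lambda>z. (fst z, snd z)) \<in> borel_measurable M"
    unfolding id_def by (rule borel_measurable_Pair)
  then have "(\<lambda>z. z) \<in> measurable M (restrict_space borel ({0<..<T} \<times> \<Omega>))"
    by (intro measurable_restrict_space2) (auto simp: space_M)
  from measurable_compose[OF this borel_measurable_continuous_on_restrict[OF assms]] show ?thesis .
qed

end

locale velocity_test = velocity T \<Omega> q w + tf: st_test_function T \<Omega> \<phi>
  for T :: real and \<Omega> :: "'a::euclidean_space set" and q w \<phi>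
begin

abbreviation "Q \<equiv> {0<..<T} \<times> \<Omega>"

lemma Q_sub: "Q \<subseteq> tf.D" "z \<in> Q \<Longrightarrow> z \<in> tf.D"
  by auto

lemma \<phi>_measurable [measurable]: "\<phi> \<in> borel_measurable M"
  by (intro continuous_measurable_M continuous_on_subset[OF tf.continuous_on_\<phi> Q_sub(1)])

lemma d\<phi>_measurable [measurable]: "(\<lambda>z. tf.d\<phi> z v) \<in> borel_measurable M"
  by (intro continuous_measurable_M continuous_on_subset[OF tf.continuous_on_d\<phi> Q_sub(1)])

text \<open>In \<open>flux\<close> both the base point and the direction of the derivative vary with
  \<open>z\<close>. Expanding the direction in coordinates separates the two and yields
  measurability and the bound by \<open>W\<close>.\<close>

lemma d\<phi>_space: "z \<in> Q \<Longrightarrow> tf.d\<phi> z (0, v) = (\<Sum>b\<in>Basis. (v \<bullet> b) * tf.d\<phi> z (0, b))"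
proof -
  assume "z \<in> Q"
  then interpret bounded_linear "tf.d\<phi> z"
    by (intro tf.linear_d\<phi> Q_sub)
  have "(0, v) = (\<Sum>b\<in>Basis. (v \<bullet> b) *\<^sub>R (0 :: real, b))"
    by (simp add: prod_eq_iff fst_sum snd_sum euclidean_representation)
  then have "tf.d\<phi> z (0, v) = tf.d\<phi> z (\<Sum>b\<in>Basis. (v \<bullet> b) *\<^sub>R (0, b))"
    by (rule arg_cong)
  then show ?thesis
    by (simp only: sum scaleR real_scaleR_def)
qed

definition flux :: "real \<times> 'a \<Rightarrow> real" where
  "flux z = (if z \<in> Q then tf.d\<phi> z (0, w (fst z) (snd z)) else 0)"

lemma transport_eq: "z \<in> Q \<Longrightarrow> transport \<phi> z = - tf.d\<phi> z (1, 0) + flux z"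
proof -
  assume z: "z \<in> Q"
  then interpret bounded_linear "tf.d\<phi> z"
    by (intro tf.linear_d\<phi> Q_sub)
  have "tf.d\<phi> z (- 1, w (fst z) (snd z)) = tf.d\<phi> z (- (1, 0) + (0, w (fst z) (snd z)))"
    by simp
  also have "\<dots> = - tf.d\<phi> z (1, 0) + tf.d\<phi> z (0, w (fst z) (snd z))"
    by (simp only: add neg)
  finally have "tf.d\<phi> z (- 1, w (fst z) (snd z)) = - tf.d\<phi> z (1, 0) + tf.d\<phi> z (0, w (fst z) (snd z))" .
  then show ?thesis
    unfolding transport_def flux_def if_P[OF z] .
qed

lemma time_deriv_V: "(\<lambda>z. tf.d\<phi> z (1, 0)) \<in> V"
  using tf.bounded_d\<phi>[of "(1, 0)"] by (auto intro!: bounded_in_V simp: space_M)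

lemma flux_V: "flux \<in> V"
proof -
  have "\<forall>b. \<exists>B\<ge>0. \<forall>z\<in>Q. \<bar>tf.d\<phi> z (0, b)\<bar> \<le> B"
    using tf.bounded_d\<phi> by blast
  then obtain B where B: "\<And>b. 0 \<le> B b" "\<And>b z. z \<in> Q \<Longrightarrow> \<bar>tf.d\<phi> z (0, b)\<bar> \<le> B b"
    by metis
  have eq: "flux z = (\<Sum>b\<in>Basis. (w (fst z) (snd z) \<bullet> b) * tf.d\<phi> z (0, b))" if "z \<in> space M" for z
    using that d\<phi>_space by (simp add: flux_def space_M)
  have "(\<lambda>z. \<Sum>b\<in>Basis. (w (fst z) (snd z) \<bullet> b) * tf.d\<phi> z (0, b)) \<in> borel_measurable M"
    by measurable
  then have "flux \<in> borel_measurable M"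
    using eq by (simp cong: measurable_cong)
  moreover have "\<bar>flux z\<bar> \<le> (\<Sum>b\<in>Basis. B b) * \<bar>W z\<bar>" if z: "z \<in> space M" for z
  proof -
    have "\<bar>flux z\<bar> \<le> (\<Sum>b\<in>Basis. \<bar>(w (fst z) (snd z) \<bullet> b) * tf.d\<phi> z (0, b)\<bar>)"
      unfolding eq[OF z] by (rule sum_abs)
    also have "\<dots> \<le> (\<Sum>b\<in>Basis. B b * \<bar>W z\<bar>)"
    proof (rule sum_mono)
      fix b :: 'a assume b: "b \<in> Basis"
      have "\<bar>w (fst z) (snd z) \<bullet> b\<bar> \<le> \<bar>W z\<bar>"
        using Basis_le_norm[OF b, of "w (fst z) (snd z)"] by (simp add: W_def)
      then show "\<bar>(w (fst z) (snd z) \<bullet> b) * tf.d\<phi> z (0, b)\<bar> \<le> B b * \<bar>W z\<bar>"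
        using B(2)[of z b] B(1)[of b] z unfolding space_M abs_mult
        by (subst mult.commute) (intro mult_mono, auto)
    qed
    finally show ?thesis
      by (simp add: sum_distrib_right)
  qed
  ultimately show ?thesis
    by (rule V_bound[OF W_in_V]) (auto intro: sum_nonneg B(1))
qed

lemma transport_V: "transport \<phi> \<in> V"
proof -
  have *: "(\<lambda>z. - 1 * tf.d\<phi> z (1, 0) + flux z) \<in> V"
    using V_D(1)[OF time_deriv_V] by (intro V_add flux_V V_bound[OF time_deriv_V, of _ 1]) auto
  have eq: "transport \<phi> z = - 1 * tf.d\<phi> z (1, 0) + flux z" if "z \<in> space M" for z
    using transport_eq that by (simp add: space_M)
  have "transport \<phi> \<in> borel_measurable M"
    using V_D(1)[OF *] eq by (simp cong: measurable_cong)
  then show ?thesis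
    by (rule V_bound[OF *, of _ 1]) (simp_all add: eq)
qed

section \<open>The chain rule for nonlinear functions of a test function\<close>

context
  fixes G G' :: "real \<Rightarrow> real"
  assumes G: "\<And>s. (G has_real_derivative G' s) (at s)" and G0: "G 0 = 0"
    and G'_cont: "continuous_on UNIV G'"
    and Ck_G: "\<And>k t. t < T \<Longrightarrow> Ck_on k \<Omega> (\<lambda>x. G (\<phi> (t, x)))"
begin

lemma G'_measurable [measurable]: "G' \<in> borel_measurable borel"
  using G'_cont by (rule borel_measurable_continuous_onI)

lemma G'_bounded: "\<exists>B\<ge>0. \<forall>z\<in>{0..<T} \<times> \<Omega>. \<bar>G' (\<phi> z)\<bar> \<le> B"
proof -
  obtain B where B: "\<forall>z\<in>{0..<T} \<times> \<Omega>. \<bar>\<phi> z\<bar> \<le> B"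
    using tf.bounded_\<phi> by blast
  have "compact (G' ` {- B..B})"
    by (intro compact_continuous_image continuous_on_subset[OF G'_cont]) auto
  then have "bounded (G' ` {- B..B})"
    by (rule compact_imp_bounded)
  then obtain c where "\<forall>y\<in>G' ` {- B..B}. norm y \<le> c"
    unfolding bounded_iff ..
  then have c: "\<bar>G' s\<bar> \<le> c" if "s \<in> {- B..B}" for s
    using that by auto
  have "\<bar>G' (\<phi> z)\<bar> \<le> max 0 c" if "z \<in> {0..<T} \<times> \<Omega>" for z
    using c[of "\<phi> z"] bspec[OF B that] by (simp add: abs_le_iff)
  then show ?thesis
    by (intro exI[of _ "max 0 c"]) auto
qed

lemma G'_mult_V:
  assumes h: "h \<in> V"
  shows "(\<lambda>z. G' (\<phi> z) * h z) \<in> V"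
proof -
  obtain B where B: "0 \<le> B" "\<forall>z\<in>{0..<T} \<times> \<Omega>. \<bar>G' (\<phi> z)\<bar> \<le> B"
    using G'_bounded by blast
  have [measurable]: "h \<in> borel_measurable M"
    by (rule V_D(1)[OF h])
  show ?thesis
    by (rule V_bound[OF h _ _ B(1)]) (use B(2) in \<open>auto simp: abs_mult space_M intro!: mult_right_mono\<close>)
qed

text \<open>Integration runs from \<open>t0\<close> to a time at which \<phi> has already vanished,
  where \<open>G 0 = 0\<close> removes the boundary term. The start \<open>t0 = 0\<close> is no
  exception, as \<phi> is differentiable across time 0.\<close>

lemma time_FTC:
  assumes t0: "0 \<le> t0" "t0 < T" and x: "x \<in> \<Omega>"
  shows "(LINT t|A. indicator {t0<..} t * (G' (\<phi> (t, x)) * tf.d\<phi> (t, x) (1, 0))) = - G (\<phi> (t0, x))"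
proof -
  define f where "f t = G' (\<phi> (t, x)) * tf.d\<phi> (t, x) (1, 0)" for t
  define F where "F t = indicator {t0<..} t * f t" for t
  obtain S where S: "S < T" "0 \<le> S" "\<And>t x. S < t \<Longrightarrow> t < T \<Longrightarrow> x \<in> \<Omega> \<Longrightarrow> \<phi> (t, x) = 0"
    using tf.vanishes_near_T by blast
  \<comment> \<open>A time beyond \<open>t0\<close> and beyond the support, but strictly before
    \<open>T\<close>, where \<phi> need not be differentiable.\<close>
  define T1 where "T1 = (max t0 S + T) / 2"
  have T1: "t0 < T1" "S < T1" "T1 < T"
    using S(1) t0 by (auto simp: T1_def)
  have deriv: "((\<lambda>s. G (\<phi> (s, x))) has_real_derivative f t) (at t)" if "t < T" for t
    unfolding f_def using DERIV_chain2[OF G tf.time_deriv(1)[OF that x]] .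
  have "(f has_integral G (\<phi> (T1, x)) - G (\<phi> (t0, x))) {t0..T1}"
  proof (rule fundamental_theorem_of_calculus)
    fix t assume "t \<in> {t0..T1}"
    then show "((\<lambda>s. G (\<phi> (s, x))) has_vector_derivative f t) (at t within {t0..T1})"
      using deriv[of t] T1 unfolding has_real_derivative_iff_has_vector_derivative[symmetric]
      by (auto intro: has_field_derivative_at_within)
  qed (use T1 in simp)
  then have "(f has_integral - G (\<phi> (t0, x))) {t0..T1}"
    using S(3)[of T1 x] T1 x G0 by simp
  then have "((\<lambda>t. if t \<in> {t0..T1} then f t else 0) has_integral - G (\<phi> (t0, x))) UNIV"
    by (simp only: has_integral_restrict_UNIV)
  then have "((\<lambda>t. if t \<in> {0<..<T} then F t else 0) has_integral - G (\<phi> (t0, x))) UNIV"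
  \<comment> \<open>The closed interval contains \<open>t0\<close> while \<open>{t0<..}\<close> does
    not; this single point is the exceptional set.\<close>
  proof (rule has_integral_spike[where S="{t0}", rotated 2])
    fix t assume t: "t \<in> UNIV - {t0}"
    have "f t = 0" if "T1 < t" "t < T"
    proof -
      have "tf.d\<phi> (t, x) (1, 0) = 0"
        using that T1 x S(3) open_\<Omega>
        by (intro zero_off_support_deriv[where U="{S<..<T} \<times> \<Omega>"]) (auto intro: open_Times)
      then show ?thesis
        by (simp add: f_def)
    qed
    then show "(if t \<in> {0<..<T} then F t else 0) = (if t \<in> {t0..T1} then f t else 0)"
      using t t0 T1 by (auto simp: F_def indicator_def)
  qed simp
  then have F_hk: "(F has_integral - G (\<phi> (t0, x))) {0<..<T}"
    by (simp only: has_integral_restrict_UNIV)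
  have cont: "continuous_on {0<..<T} f"
  proof -
    have "continuous_on {0<..<T} (\<lambda>t. (t, x))"
      by (intro continuous_intros)
    then have "continuous_on {0<..<T} (\<lambda>t. \<phi> (t, x))" "continuous_on {0<..<T} (\<lambda>t. tf.d\<phi> (t, x) (1, 0))"
      using x by (auto intro!: continuous_on_compose2[OF tf.continuous_on_\<phi>] continuous_on_compose2[OF tf.continuous_on_d\<phi>])
    then show ?thesis
      unfolding f_def by (intro continuous_on_mult continuous_on_compose2[OF G'_cont]) auto
  qed
  \<comment> \<open>The fundamental theorem gives a gauge integral. Once \<open>F\<close> is known
    to be Lebesgue integrable, uniqueness identifies the two integrals.\<close>
  have "integrable A F"
  proof -
    obtain B where "\<And>z. z \<in> space M \<Longrightarrow> \<bar>G' (\<phi> z) * tf.d\<phi> z (1, 0)\<bar> \<le> B"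
    proof -
      obtain B1 B2 where B1: "0 \<le> B1" "\<forall>z\<in>{0..<T} \<times> \<Omega>. \<bar>G' (\<phi> z)\<bar> \<le> B1"
        and B2: "\<forall>z\<in>Q. \<bar>tf.d\<phi> z (1, 0)\<bar> \<le> B2"
        using G'_bounded tf.bounded_d\<phi>[of "(1, 0)"] by blast
      have "\<bar>G' (\<phi> z) * tf.d\<phi> z (1, 0)\<bar> \<le> B1 * B2" if "z \<in> space M" for z
        using that B1 B2 unfolding abs_mult by (intro mult_mono) (auto simp: space_M)
      then show ?thesis
        by (rule that)
    qed
    then have bd: "\<bar>f t\<bar> \<le> B" if "t \<in> {0<..<T}" for t
      using that x by (simp add: f_def space_M)
    have [measurable]: "f \<in> borel_measurable A"
      using cont by (rule continuous_imp_measurable_on_sets_lebesgue) simp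
    have [measurable]: "indicator {t0<..} \<in> borel_measurable A"
      by (rule measurable_compose[OF id_borel_measurable_lebesgue_on, simplified id_def]) simp
    show ?thesis
    proof (rule A.integrable_const_bound[where B="\<bar>B\<bar>"])
      show "AE t in A. norm (F t) \<le> \<bar>B\<bar>"
        using bd by (intro AE_I2) (fastforce simp: F_def indicator_def)
      show "F \<in> borel_measurable A"
        unfolding F_def by measurable
    qed
  qed
  then have "(F has_integral (LINT t|A. F t)) {0<..<T}"
    by (rule has_integral_integral_lebesgue_on) simp
  then show ?thesis
    using F_hk has_integral_unique unfolding F_def f_def by blast
qed

lemma space_time_FTC:
  assumes t0: "0 \<le> t0" "t0 < T"
  shows "(LINT x|X. G (\<phi> (t0, x)))
    = - (LINT t|A. indicator {t0<..} t * (LINT x|X. G' (\<phi> (t, x)) * tf.d\<phi> (t, x) (1, 0)))"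
proof -
  define H where "H t x = indicator {t0<..} t * (G' (\<phi> (t, x)) * tf.d\<phi> (t, x) (1, 0))" for t x
  have [measurable]: "indicator {t0<..} \<in> borel_measurable A"
    by (rule measurable_compose[OF id_borel_measurable_lebesgue_on, simplified id_def]) simp
  have V1: "(\<lambda>z. G' (\<phi> z) * tf.d\<phi> z (1, 0)) \<in> V"
    by (rule G'_mult_V[OF time_deriv_V])
  have [measurable]: "(\<lambda>z. G' (\<phi> z) * tf.d\<phi> z (1, 0)) \<in> borel_measurable M"
    by (rule V_D(1)[OF V1])
  have "(\<lambda>z. indicator {t0<..} (fst z) * (G' (\<phi> z) * tf.d\<phi> z (1, 0))) \<in> borel_measurable M"
    by measurable
  then have "(\<lambda>z. indicator {t0<..} (fst z) * (G' (\<phi> z) * tf.d\<phi> z (1, 0))) \<in> V"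
    by (rule V_bound[OF V1, of _ 1]) (auto simp: indicator_def)
  from V_integrable[OF this] have int: "integrable M (case_prod H)"
    by (simp add: H_def case_prod_beta')
  have "(LINT x|X. G (\<phi> (t0, x))) = (LINT x|X. - (LINT t|A. H t x))"
    using time_FTC[OF t0] by (intro Bochner_Integration.integral_cong) (simp_all add: H_def)
  also have "\<dots> = - (LINT t|A. LINT x|X. H t x)"
    using P.Fubini_integral[OF int] by simp
  finally show ?thesis
    by (simp add: H_def)
qed

text \<open>The slice \<open>G (\<phi> (t, x))\<close>, extended by zero, is an admissible test
  function for the divergence condition, and its gradient is \<open>G'\<close> times that of \<phi>.
  Hence the flux part of \<open>transport\<close>, weighted with \<open>G'\<close>, integrates to
  zero.\<close>

lemma transport_integral:
  "AE t in A. - (LINT x|X. G' (\<phi> (t, x)) * tf.d\<phi> (t, x) (1, 0)) = (LINT x|X. G' (\<phi> (t, x)) * transport \<phi> (t, x))"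
  using w_div AE_space
proof eventually_elim
  case (elim t)
  then have t: "t \<in> {0<..<T}" by simp
  define \<psi> where "\<psi> = (\<lambda>x. if x \<in> \<Omega> then G (\<phi> (t, x)) else 0)"
  have "\<psi> \<in> test_functions \<Omega>"
    unfolding \<psi>_def using t by (intro tf.slice_in_test_functions G0 Ck_G) auto
  then have "(LINT x|X. w t x \<bullet> grad \<psi> x) = 0"
    using elim by blast
  moreover have "w t x \<bullet> grad \<psi> x = G' (\<phi> (t, x)) * flux (t, x)" if x: "x \<in> \<Omega>" for x
  proof -
    have "((\<lambda>y. G (\<phi> (t, y))) has_derivative (\<lambda>v. tf.d\<phi> (t, x) (0, v) * G' (\<phi> (t, x)))) (at x)"
      using DERIV_compose_FDERIV[OF G tf.space_deriv] t x by auto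
    then have "(\<psi> has_derivative (\<lambda>v. tf.d\<phi> (t, x) (0, v) * G' (\<phi> (t, x)))) (at x)"
      by (rule has_derivative_transform_within_open[OF _ open_\<Omega> x]) (simp add: \<psi>_def)
    then show ?thesis
      using t x by (simp add: inner_grad flux_def mult.commute)
  qed
  then have "(LINT x|X. w t x \<bullet> grad \<psi> x) = (LINT x|X. G' (\<phi> (t, x)) * flux (t, x))"
    by (intro Bochner_Integration.integral_cong) simp_all
  ultimately have zero: "(LINT x|X. G' (\<phi> (t, x)) * flux (t, x)) = 0"
    by simp
  have "(LINT x|X. G' (\<phi> (t, x)) * transport \<phi> (t, x))
      = (LINT x|X. - (G' (\<phi> (t, x)) * tf.d\<phi> (t, x) (1, 0)) + G' (\<phi> (t, x)) * flux (t, x))"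
    using t by (intro Bochner_Integration.integral_cong) (simp_all add: transport_eq algebra_simps)
  also have "\<dots> = - (LINT x|X. G' (\<phi> (t, x)) * tf.d\<phi> (t, x) (1, 0))"
    using V_slice_integrable[OF G'_mult_V[OF time_deriv_V] t] V_slice_integrable[OF G'_mult_V[OF flux_V] t] zero
    by simp
  finally show ?case by simp
qed

end

text \<open>With \<open>Y t\<close> the integral of a smoothed \<open>q\<close>-th power of the
  positive part, integration from \<open>t0\<close> to \<open>T\<close> bounds \<open>Y t0\<close>
  by a small constant plus \<open>q\<close> times the time integral of
  \<open>Y t powr (1 - 1 / q) * lnorm q X (P t)\<close>. Replacing \<open>Y t\<close> by its
  supremum closes the estimate.\<close>

theorem a_priori_estimate: "lnorm q X (\<lambda>x. max 0 (\<phi> (0, x))) \<le> q * N (transport \<phi>)"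
proof -
  obtain B where B: "0 \<le> B" "\<forall>z\<in>{0..<T} \<times> \<Omega>. \<bar>\<phi> z\<bar> \<le> B"
    using tf.bounded_\<phi> by blast
  have slice[measurable]: "(\<lambda>x. \<phi> (t, x)) \<in> borel_measurable X" if "t < T" for t
  proof -
    have "continuous_on \<Omega> (\<lambda>x. \<phi> (t, x))"
      using tf.Ck_slice[OF that, of 0] by simp
    then show ?thesis
      using open_\<Omega> by (intro continuous_imp_measurable_on_sets_lebesgue) auto
  qed
  define m where "m = measure X (space X)"
  define P where "P t = (\<lambda>x. max 0 (transport \<phi> (t, x)))" for t
  have P_nn: "0 \<le> P t x" for t x
    by (simp add: P_def)
  have P_V: "(\<lambda>z. max 0 (transport \<phi> z)) \<in> V"
    by (rule V_max_0[OF transport_V])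
  have est: "lnorm q X (\<lambda>x. max 0 (\<phi> (0, x))) \<le> m powr (1 / q) * \<epsilon> / 2 + q * N (transport \<phi>)"
    if \<epsilon>: "\<epsilon> > 0" for \<epsilon>
  proof -
    define \<theta> where "\<theta> = smooth_pos \<epsilon>"
    \<comment> \<open>Subtracting the value of \<open>\<theta> s powr q\<close> at
      \<open>s = 0\<close> gives \<open>G 0 = 0\<close>, which keeps the support compact. The total
      contribution of this constant is \<open>c\<close> below.\<close>
    define G where "G s = \<theta> s powr q - (\<epsilon> / 2) powr q" for s
    define G' where "G' s = q * \<theta> s powr (q - 1) * (\<theta> s / sqrt (s\<^sup>2 + \<epsilon>\<^sup>2))" for s
    have \<theta>_pos: "0 < \<theta> s" for s
      using smooth_pos_pos[OF \<epsilon>] by (simp add: \<theta>_def)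
    have \<theta>_cont: "continuous_on UNIV \<theta>"
      unfolding \<theta>_def smooth_pos_def[abs_def] by (intro continuous_intros) auto
    have [measurable]: "\<theta> \<in> borel_measurable borel"
      using \<theta>_cont by (rule borel_measurable_continuous_onI)
    have G: "(G has_real_derivative G' s) (at s)" for s
      unfolding G_def[abs_def] G'_def \<theta>_def
      using DERIV_diff[OF smooth_pos_powr_deriv[OF \<epsilon>] DERIV_const] by simp
    have G0: "G 0 = 0"
      by (simp add: G_def \<theta>_def smooth_pos_0[OF \<epsilon>])
    have G'_cont: "continuous_on UNIV G'"
    proof -
      have "sqrt (s\<^sup>2 + \<epsilon>\<^sup>2) \<noteq> 0" for s
        using smooth_pos_aux(1)[OF \<epsilon>, of s] by (subst real_sqrt_eq_zero_cancel_iff) linarith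
      moreover have "\<theta> s \<noteq> 0" for s
        using \<theta>_pos[of s] by simp
      ultimately show ?thesis
        unfolding G'_def by (intro continuous_intros \<theta>_cont) auto
    qed
    have Ck_G: "Ck_on k \<Omega> (\<lambda>x. G (\<phi> (t, x)))" if "t < T" for k t
      using Ck_on_add[OF open_\<Omega> Ck_on_smooth_pos_powr[OF \<epsilon> open_\<Omega> tf.Ck_slice[OF that]] Ck_on_const[OF open_\<Omega>],
          of k q "- ((\<epsilon> / 2) powr q)"] by (simp add: G_def \<theta>_def)
    note facts = G G0 G'_cont Ck_G
    \<comment> \<open>The sign allows \<open>transport \<phi>\<close> to be replaced by its positive
      part, and the upper bound has the form of the first factor in \<open>Holder\<close>.\<close>
    have G'_le: "0 \<le> G' s" "G' s \<le> q * \<theta> s powr (q - 1)" for s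
    proof -
      show "0 \<le> G' s"
        unfolding G'_def \<theta>_def using q_pos smooth_pos_deriv_le(1)[OF \<epsilon>, of s] by (intro mult_nonneg_nonneg) auto
      have "G' s \<le> q * \<theta> s powr (q - 1) * 1"
        unfolding G'_def \<theta>_def using q_pos smooth_pos_deriv_le(2)[OF \<epsilon>, of s] by (intro mult_left_mono) auto
      then show "G' s \<le> q * \<theta> s powr (q - 1)"
        by simp
    qed
    have transported: "AE t in A. - (LINT x|X. G' (\<phi> (t, x)) * tf.d\<phi> (t, x) (1, 0))
        = (LINT x|X. G' (\<phi> (t, x)) * transport \<phi> (t, x))"
      by (rule transport_integral[OF facts])
    define Y where "Y t = (LINT x|X. \<theta> (\<phi> (t, x)) powr q)" for t
    define c where "c = m * (\<epsilon> / 2) powr q"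
    have c_nn: "0 \<le> c"
      by (simp add: c_def m_def)
    have \<theta>_bd: "\<theta> (\<phi> z) \<le> B + \<epsilon>" if "z \<in> {0..<T} \<times> \<Omega>" for z
    proof -
      have s: "\<bar>\<phi> z\<bar> \<le> B"
        using B(2) that by blast
      have "sqrt ((\<phi> z)\<^sup>2 + \<epsilon>\<^sup>2) \<le> \<bar>\<phi> z\<bar> + \<epsilon>"
        using sqrt_add_le_add_sqrt[of "(\<phi> z)\<^sup>2" "\<epsilon>\<^sup>2"] \<epsilon> by simp
      then show ?thesis
        using s \<epsilon> by (simp add: \<theta>_def smooth_pos_def)
    qed
    have \<theta>_int: "integrable X (\<lambda>x. \<theta> (\<phi> (t, x)) powr q)" if t: "0 \<le> t" "t < T" for t
    proof (rule X.integrable_const_bound[where B="(B + \<epsilon>) powr q"])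
      show "AE x in X. norm (\<theta> (\<phi> (t, x)) powr q) \<le> (B + \<epsilon>) powr q"
        using \<theta>_bd t q_pos less_imp_le[OF \<theta>_pos] by (intro AE_I2) (auto intro!: powr_mono2)
      show "(\<lambda>x. \<theta> (\<phi> (t, x)) powr q) \<in> borel_measurable X"
        using slice[OF t(2)] by measurable
    qed
    have Y_le: "Y t \<le> m * (B + \<epsilon>) powr q" if t: "0 \<le> t" "t < T" for t
    proof -
      have "Y t \<le> (LINT x|X. (B + \<epsilon>) powr q)"
        unfolding Y_def using \<theta>_bd t q_pos less_imp_le[OF \<theta>_pos]
        by (intro integral_mono \<theta>_int) (auto intro!: powr_mono2)
      then show ?thesis
        by (simp add: m_def)
    qed
    have bdd: "bdd_above (Y ` {0..<T})"
      by (rule bdd_aboveI2[where M="m * (B + \<epsilon>) powr q"]) (use Y_le in auto)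
    define S where "S = (SUP t\<in>{0..<T}. Y t)"
    have Y_S: "Y t \<le> S" if "0 \<le> t" "t < T" for t
      unfolding S_def using that by (intro cSUP_upper bdd) auto
    have Y_nn: "0 \<le> Y t" for t
      by (simp add: Y_def)
    have S_nn: "0 \<le> S"
      using Y_nn[of 0] Y_S[of 0] T by linarith
    have P_slice: "P t \<in> borel_measurable X" "integrable X (\<lambda>x. P t x powr q)" if "t \<in> {0<..<T}" for t
      using V_slice[OF P_V that] by (simp_all add: P_def)
    \<comment> \<open>The restriction to times after \<open>t0\<close> is dropped in the course of
      the estimate, because the bound on the integrand is nonnegative.\<close>
    have step: "Y t0 \<le> c + q * S powr (1 - 1 / q) * N (transport \<phi>)" if t0: "0 \<le> t0" "t0 < T" for t0
    proof -
      have inner: "(LINT x|X. G' (\<phi> (t, x)) * transport \<phi> (t, x)) \<le> q * S powr (1 - 1 / q) * lnorm q X (P t)"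
        if t: "t \<in> {0<..<T}" for t
      proof -
        have t': "0 \<le> t" "t < T"
          using t by auto
        have [measurable]: "(\<lambda>x. \<theta> (\<phi> (t, x))) \<in> borel_measurable X"
          using slice[OF t'(2)] by measurable
        note [measurable] = P_slice(1)[OF t]
        note Hol = Holder[of q "\<lambda>x. \<theta> (\<phi> (t, x))" X "P t", OF q _ _ less_imp_le[OF \<theta>_pos] P_nn \<theta>_int[OF t'] P_slice(2)[OF t]]
        have "(LINT x|X. G' (\<phi> (t, x)) * transport \<phi> (t, x)) \<le> (LINT x|X. q * (\<theta> (\<phi> (t, x)) powr (q - 1) * P t x))"
        proof (rule integral_mono[OF V_slice_integrable[OF G'_mult_V[OF facts transport_V] t]])
          show "integrable X (\<lambda>x. q * (\<theta> (\<phi> (t, x)) powr (q - 1) * P t x))"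
            using Hol(1) by (intro integrable_mult_right) auto
          fix x
          have "G' (\<phi> (t, x)) * transport \<phi> (t, x) \<le> G' (\<phi> (t, x)) * P t x"
            using G'_le(1) by (intro mult_left_mono) (auto simp: P_def)
          also have "\<dots> \<le> q * \<theta> (\<phi> (t, x)) powr (q - 1) * P t x"
            using G'_le(2) P_nn by (intro mult_right_mono) auto
          finally show "G' (\<phi> (t, x)) * transport \<phi> (t, x) \<le> q * (\<theta> (\<phi> (t, x)) powr (q - 1) * P t x)"
            by (simp add: mult.assoc)
        qed
        also have "\<dots> = q * (LINT x|X. \<theta> (\<phi> (t, x)) powr (q - 1) * P t x)"
          by simp
        also have "\<dots> \<le> q * (Y t powr (1 - 1 / q) * lnorm q X (P t))"
          unfolding Y_def using Hol(2) q_pos by (intro mult_left_mono) auto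
        also have "\<dots> \<le> q * (S powr (1 - 1 / q) * lnorm q X (P t))"
          using q Y_nn Y_S[OF t'] by (intro mult_left_mono mult_right_mono powr_mono2) auto
        finally show ?thesis
          by (simp add: mult.assoc)
      qed
      have int_N: "integrable A (\<lambda>t. lnorm q X (P t))"
        using V_lnorm[OF P_V] by (simp add: P_def)
      have int_L: "integrable A (\<lambda>t. LINT x|X. G' (\<phi> (t, x)) * transport \<phi> (t, x))"
        using P.integrable_fst'[OF V_integrable[OF G'_mult_V[OF facts transport_V]]] by simp
      have [measurable]: "indicator {t0<..} \<in> borel_measurable A"
        by (rule measurable_compose[OF id_borel_measurable_lebesgue_on, simplified id_def]) simp
      have int_D: "integrable A (\<lambda>t. LINT x|X. G' (\<phi> (t, x)) * tf.d\<phi> (t, x) (1, 0))"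
        using P.integrable_fst'[OF V_integrable[OF G'_mult_V[OF facts time_deriv_V]]] by simp
      have "Y t0 - c = (LINT x|X. G (\<phi> (t0, x)))"
        using \<theta>_int[OF t0] by (simp add: G_def Y_def c_def m_def)
      also have "\<dots> = (LINT t|A. indicator {t0<..} t * - (LINT x|X. G' (\<phi> (t, x)) * tf.d\<phi> (t, x) (1, 0)))"
        using space_time_FTC[OF facts t0] by simp
      also have "\<dots> \<le> (LINT t|A. q * S powr (1 - 1 / q) * lnorm q X (P t))"
      proof (rule integral_mono_AE)
        show "integrable A (\<lambda>t. indicator {t0<..} t * - (LINT x|X. G' (\<phi> (t, x)) * tf.d\<phi> (t, x) (1, 0)))"
        proof (rule Bochner_Integration.integrable_bound[OF int_D])
          have [measurable]: "(\<lambda>t. LINT x|X. G' (\<phi> (t, x)) * tf.d\<phi> (t, x) (1, 0)) \<in> borel_measurable A"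
            by (rule borel_measurable_integrable[OF int_D])
          show "(\<lambda>t. indicator {t0<..} t * - (LINT x|X. G' (\<phi> (t, x)) * tf.d\<phi> (t, x) (1, 0))) \<in> borel_measurable A"
            by measurable
        qed (auto simp: indicator_def)
        show "integrable A (\<lambda>t. q * S powr (1 - 1 / q) * lnorm q X (P t))"
          using int_N by (rule integrable_mult_right)
        show "AE t in A. indicator {t0<..} t * - (LINT x|X. G' (\<phi> (t, x)) * tf.d\<phi> (t, x) (1, 0))
           \<le> q * S powr (1 - 1 / q) * lnorm q X (P t)"
          using transported AE_space
        proof eventually_elim
          case (elim t)
          have "0 \<le> q * S powr (1 - 1 / q) * lnorm q X (P t)"
            using q_pos by simp
          moreover have "(LINT x|X. G' (\<phi> (t, x)) * transport \<phi> (t, x)) \<le> q * S powr (1 - 1 / q) * lnorm q X (P t)"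
            using inner elim by simp
          ultimately show ?case
            using elim(1) by (simp add: indicator_def)
        qed
      qed
      also have "\<dots> = q * S powr (1 - 1 / q) * N (transport \<phi>)"
        by (simp add: N_def P_def)
      finally show ?thesis
        by simp
    qed
    have S_le: "S \<le> c + q * S powr (1 - 1 / q) * N (transport \<phi>)"
      unfolding S_def by (rule cSUP_least) (use step T S_def in auto)
    \<comment> \<open>A Gronwall argument for the supremum \<open>S\<close> of \<open>Y\<close>; it loses the factor \<open>q\<close>, which is harmless.\<close>
    have root: "S powr (1 / q) \<le> c powr (1 / q) + q * N (transport \<phi>)"
    proof (cases "S \<le> c")
      case True
      then have "S powr (1 / q) \<le> c powr (1 / q)"
        using S_nn q_pos by (intro powr_mono2) auto
      then show ?thesis
        using q_pos N_nonneg[of "transport \<phi>"] by (simp add: add_increasing2)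
    next
      case False
      then have S: "0 < S" "c < S"
        using c_nn by auto
      \<comment> \<open>\<open>c\<close> is split so that both terms share the factor
        \<open>S powr (1 - 1 / q)\<close>, which is positive in this case and cancels.\<close>
      have "c = c powr (1 / q) * c powr (1 - 1 / q)"
        using c_nn by (cases "c = 0") (auto simp flip: powr_add)
      also have "\<dots> \<le> c powr (1 / q) * S powr (1 - 1 / q)"
        using S c_nn q by (intro mult_left_mono powr_mono2) auto
      finally have "S \<le> (c powr (1 / q) + q * N (transport \<phi>)) * S powr (1 - 1 / q)"
        using S_le by (simp add: algebra_simps)
      moreover have "S = S powr (1 / q) * S powr (1 - 1 / q)"
        using S by (simp flip: powr_add)
      ultimately have "S powr (1 / q) * S powr (1 - 1 / q) \<le> (c powr (1 / q) + q * N (transport \<phi>)) * S powr (1 - 1 / q)"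
        by simp
      then show ?thesis
        using S by simp
    qed
    have "lnorm q X (\<lambda>x. max 0 (\<phi> (0, x))) \<le> lnorm q X (\<lambda>x. \<theta> (\<phi> (0, x)))"
    proof (rule lnorm_mono(2)[OF q_pos])
      show "(\<lambda>x. max 0 (\<phi> (0, x))) \<in> borel_measurable X"
        using slice[OF T] by measurable
      show "integrable X (\<lambda>x. \<bar>\<theta> (\<phi> (0, x))\<bar> powr q)"
        using \<theta>_int[of 0] T less_imp_le[OF \<theta>_pos] by simp
      show "\<bar>max 0 (\<phi> (0, x))\<bar> \<le> \<bar>\<theta> (\<phi> (0, x))\<bar>" for x
        using smooth_pos_ge[OF \<epsilon>, of "\<phi> (0, x)"] by (simp add: \<theta>_def)
    qed
    also have "\<dots> = Y 0 powr (1 / q)"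
      using less_imp_le[OF \<theta>_pos] by (simp add: lnorm_def Y_def)
    also have "\<dots> \<le> S powr (1 / q)"
      using Y_S[of 0] Y_nn T q_pos by (intro powr_mono2) auto
    also note root
    also have "c powr (1 / q) = m powr (1 / q) * \<epsilon> / 2"
      using q_pos \<epsilon> by (simp add: c_def m_def powr_mult powr_powr)
    finally show ?thesis .
  qed
  show ?thesis
  proof (rule field_le_epsilon)
    fix e :: real assume e: "e > 0"
    \<comment> \<open>Makes the error term at most \<open>e\<close>. The added 1 guards against
      \<open>m = 0\<close>.\<close>
    define \<epsilon> where "\<epsilon> = 2 * e / (m powr (1 / q) + 1)"
    have pos: "0 < m powr (1 / q) + 1"
      using powr_ge_zero[of m "1 / q"] by linarith
    then have "\<epsilon> > 0"
      using e by (simp add: \<epsilon>_def)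
    have half: "\<epsilon> / 2 = e / (m powr (1 / q) + 1)"
      unfolding \<epsilon>_def by (metis nonzero_mult_div_cancel_left times_divide_eq_right zero_neq_numeral)
    have "m powr (1 / q) * \<epsilon> / 2 = m powr (1 / q) * (\<epsilon> / 2)"
      by (rule times_divide_eq_right[symmetric])
    also have "\<dots> = e * (m powr (1 / q) / (m powr (1 / q) + 1))"
      unfolding half by simp
    also have "\<dots> \<le> e * 1"
      using pos e by (intro mult_left_mono) (auto simp: divide_le_eq_1)
    finally show "lnorm q X (\<lambda>x. max 0 (\<phi> (0, x))) \<le> q * N (transport \<phi>) + e"
      using est[OF \<open>\<epsilon> > 0\<close>] by linarith
  qed
qed

end

subsection \<open>Jointly measurable representatives\<close>

lemma Lp_norm_finite_exponent:
  assumes "1 \<le> q"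
  shows "Lp_norm (ennreal q) \<Omega> f =
    (let I = (\<integral>\<^sup>+ x. ennreal (norm (f x) powr q) \<partial>lebesgue_on \<Omega>)
     in if I = \<infinity> then \<infinity> else ennreal (enn2real I powr (1 / q)))"
proof -
  have "enn2real (ennreal q) = q"
    using assms by simp
  then show ?thesis
    by (simp add: Lp_norm_def Let_def)
qed

lemma Lp_norm_finite_iff:
  assumes "1 \<le> q"
  shows "Lp_norm (ennreal q) \<Omega> f < \<infinity> \<longleftrightarrow> (\<integral>\<^sup>+ x. ennreal (norm (f x) powr q) \<partial>lebesgue_on \<Omega>) < \<infinity>"
  using assms by (simp add: Lp_norm_finite_exponent Let_def top.not_eq_extremum)

lemma Lp_norm_less_imp:
  assumes q: "1 \<le> q" and e: "0 < e" and less: "Lp_norm (ennreal q) \<Omega> f < ennreal (e powr (1 / q))"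
  shows "(\<integral>\<^sup>+ x. ennreal (norm (f x) powr q) \<partial>lebesgue_on \<Omega>) < ennreal e"
proof -
  define I where "I = (\<integral>\<^sup>+ x. ennreal (norm (f x) powr q) \<partial>lebesgue_on \<Omega>)"
  have fin: "I \<noteq> \<infinity>"
    using less q by (auto simp: Lp_norm_finite_exponent Let_def I_def)
  then have "enn2real I powr (1 / q) < e powr (1 / q)"
    using less q e by (simp add: Lp_norm_finite_exponent Let_def I_def[symmetric] ennreal_less_iff)
  then have "enn2real I < e"
    using q e by (metis enn2real_nonneg less_eq_real_def linorder_not_le powr_mono2 divide_nonneg_nonneg zero_le_one order_trans)
  then have "ennreal (enn2real I) < ennreal e"
    using e by (simp add: ennreal_less_iff)
  moreover have "ennreal (enn2real I) = I"
    using fin by (simp add: top.not_eq_extremum)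
  ultimately show ?thesis
    by (simp add: I_def)
qed

lemma Lp_norm_tendsto_0_imp:
  assumes q: "1 \<le> q" and lim: "(\<lambda>n. Lp_norm (ennreal q) \<Omega> (f n)) \<longlonglongrightarrow> 0"
  shows "(\<lambda>n. \<integral>\<^sup>+ x. ennreal (norm (f n x) powr q) \<partial>lebesgue_on \<Omega>) \<longlonglongrightarrow> 0"
proof (rule order_tendstoI)
  fix a :: ennreal assume "0 < a"
  then obtain b where b: "0 < b" "b < a"
    using dense by blast
  define e where "e = enn2real b"
  have "b < top"
    by (rule order.strict_trans2[OF b(2) top_greatest])
  then have e: "0 < e" "ennreal e < a"
    using b by (simp_all add: e_def enn2real_positive_iff)
  have "\<forall>\<^sub>F n in sequentially. Lp_norm (ennreal q) \<Omega> (f n) < ennreal (e powr (1 / q))"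
  proof (rule order_tendstoD(2)[OF lim])
    show "0 < ennreal (e powr (1 / q))"
      using e by (subst ennreal_less_zero_iff) simp
  qed
  then show "\<forall>\<^sub>F n in sequentially. (\<integral>\<^sup>+ x. ennreal (norm (f n x) powr q) \<partial>lebesgue_on \<Omega>) < a"
    by eventually_elim (use Lp_norm_less_imp[OF q e(1)] e(2) in \<open>blast intro: order.strict_trans\<close>)
qed simp

text \<open>A triangle inequality for \<open>q\<close>-th powers at the price of the factor
  \<open>2 powr q\<close>; it serves where only smallness of the integrals is at stake.\<close>

lemma nn_integral_powr_triangle:
  fixes f g h :: "'a \<Rightarrow> 'b::{second_countable_topology, real_normed_vector}"
  assumes q: "0 \<le> q" and [measurable]: "f \<in> borel_measurable N" "g \<in> borel_measurable N" "h \<in> borel_measurable N"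
  shows "(\<integral>\<^sup>+ x. ennreal (norm (f x - h x) powr q) \<partial>N) \<le> ennreal (2 powr q) *
    ((\<integral>\<^sup>+ x. ennreal (norm (f x - g x) powr q) \<partial>N) + (\<integral>\<^sup>+ x. ennreal (norm (g x - h x) powr q) \<partial>N))"
proof -
  have "ennreal (norm (f x - h x) powr q)
      \<le> ennreal (2 powr q) * (ennreal (norm (f x - g x) powr q) + ennreal (norm (g x - h x) powr q))" for x
  proof -
    have "norm (f x - h x) \<le> norm (f x - g x) + norm (g x - h x)"
      using norm_triangle_ineq[of "f x - g x" "g x - h x"] by simp
    then have "norm (f x - h x) powr q \<le> (norm (f x - g x) + norm (g x - h x)) powr q"
      using q by (intro powr_mono2) auto
    also have "\<dots> \<le> 2 powr q * (norm (f x - g x) powr q + norm (g x - h x) powr q)"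
      using q by (intro powr_add_le) auto
    finally show ?thesis
      by (simp add: ennreal_leI flip: ennreal_plus ennreal_mult)
  qed
  then have "(\<integral>\<^sup>+ x. ennreal (norm (f x - h x) powr q) \<partial>N)
    \<le> (\<integral>\<^sup>+ x. ennreal (2 powr q) * (ennreal (norm (f x - g x) powr q) + ennreal (norm (g x - h x) powr q)) \<partial>N)"
    by (rule nn_integral_mono)
  also have "\<dots> = ennreal (2 powr q) *
    ((\<integral>\<^sup>+ x. ennreal (norm (f x - g x) powr q) \<partial>N) + (\<integral>\<^sup>+ x. ennreal (norm (g x - h x) powr q) \<partial>N))"
    by (simp add: nn_integral_cmult nn_integral_add)
  finally show ?thesis .
qed

text \<open>Sum and integral may be exchanged, so the series of \<open>q\<close>-th powers is finite
  almost everywhere and its terms tend to 0 there.\<close>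

lemma AE_tendsto_of_summable_powr:
  fixes v :: "nat \<Rightarrow> 'a \<Rightarrow> 'b::{second_countable_topology, real_normed_vector}"
  assumes q: "0 < q" and [measurable]: "\<And>k. v k \<in> borel_measurable N" "f \<in> borel_measurable N"
    and sum: "(\<Sum>k. \<integral>\<^sup>+ x. ennreal (norm (v k x - f x) powr q) \<partial>N) < \<infinity>"
  shows "AE x in N. (\<lambda>k. v k x) \<longlonglongrightarrow> f x"
proof -
  have "(\<integral>\<^sup>+ x. (\<Sum>k. ennreal (norm (v k x - f x) powr q)) \<partial>N) \<noteq> \<infinity>"
    using sum by (simp add: nn_integral_suminf)
  then have "AE x in N. (\<Sum>k. ennreal (norm (v k x - f x) powr q)) \<noteq> \<infinity>"
    by (intro nn_integral_noteq_infinite) auto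
  then show ?thesis
  proof eventually_elim
    case (elim x)
    then have "summable (\<lambda>k. norm (v k x - f x) powr q)"
      by (intro summable_suminf_not_top) auto
    then have "(\<lambda>k. norm (v k x - f x) powr q) \<longlonglongrightarrow> 0"
      by (rule summable_LIMSEQ_zero)
    then have "(\<lambda>k. (norm (v k x - f x) powr q) powr (1 / q)) \<longlonglongrightarrow> 0"
      by (rule tendsto_zero_powrI[OF _ tendsto_const]) (use q in auto)
    moreover have "(norm y powr q) powr (1 / q) = norm y" for y :: 'b
      using q by (simp add: powr_powr)
    ultimately have "(\<lambda>k. norm (v k x - f x)) \<longlonglongrightarrow> 0"
      by (simp only:)
    then show "(\<lambda>k. v k x) \<longlonglongrightarrow> f x"
      by (simp add: LIM_zero_iff tendsto_norm_zero_iff)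
  qed
qed

text \<open>The values of \<open>s\<close> are whole functions of the second variable. Since there
  are finitely many, joint measurability reduces to gluing measurable functions along measurable
  sets of times.\<close>

lemma simple_function_pair_measurable:
  assumes s: "simple_function A s" and meas: "\<And>t. t \<in> space A \<Longrightarrow> s t \<in> borel_measurable N"
  shows "(\<lambda>z. s (fst z) (snd z)) \<in> borel_measurable (A \<Otimes>\<^sub>M N)"
proof (rule measurable_compose_countable'[where f="\<lambda>v z. v (snd z)" and g="\<lambda>z. s (fst z)" and I="s ` space A"])
  show "(\<lambda>z. v (snd z)) \<in> borel_measurable (A \<Otimes>\<^sub>M N)" if "v \<in> s ` space A" for v
    using that meas by (auto intro: measurable_compose[OF measurable_snd])
  have "s \<in> measurable A (count_space (s ` space A))"
    using simple_functionD(2)[OF s] by (intro measurableI) auto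
  then show "(\<lambda>z. s (fst z)) \<in> measurable (A \<Otimes>\<^sub>M N) (count_space (s ` space A))"
    by (rule measurable_compose[OF measurable_fst])
  show "countable (s ` space A)"
    using simple_functionD(1)[OF s] by (rule countable_finite)
qed

text \<open>\<open>J k t\<close> is an index from which on the sequence is \<open>2\<^sup>-\<^sup>k\<close>-Cauchy at time \<open>t\<close>.  It depends
  measurably on \<open>t\<close>, so the sequence sampled at \<open>J k t\<close> converges almost everywhere to a jointly
  measurable limit.\<close>

lemma ex_jointly_measurable_limit:
  fixes s :: "nat \<Rightarrow> real \<Rightarrow> 'a \<Rightarrow> 'b::{second_countable_topology, banach}"
  assumes q: "0 < q" and N: "sigma_finite_measure N"
    and s[measurable]: "\<And>n. (\<lambda>z. s n (fst z) (snd z)) \<in> borel_measurable (A \<Otimes>\<^sub>M N)"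
    and s_slice: "\<And>n t. t \<in> space A \<Longrightarrow> s n t \<in> borel_measurable N"
    and u: "AE t in A. u t \<in> borel_measurable N"
    and lim: "AE t in A. (\<lambda>n. \<integral>\<^sup>+ x. ennreal (norm (u t x - s n t x) powr q) \<partial>N) \<longlonglongrightarrow> 0"
  shows "\<exists>w. (\<lambda>z. w (fst z) (snd z)) \<in> borel_measurable (A \<Otimes>\<^sub>M N) \<and> (AE t in A. AE x in N. w t x = u t x)"
proof -
  interpret N: sigma_finite_measure N by fact
  define E where "E n m t = (\<integral>\<^sup>+ x. ennreal (norm (s n t x - s m t x) powr q) \<partial>N)" for n m t
  have "(\<lambda>z. ennreal (norm (s n (fst z) (snd z) - s m (fst z) (snd z)) powr q)) \<in> borel_measurable (A \<Otimes>\<^sub>M N)" for n m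
    by measurable
  then have E_meas[measurable]: "E n m \<in> borel_measurable A" for n m
    unfolding E_def using N.borel_measurable_nn_integral[of "\<lambda>t x. ennreal (norm (s n t x - s m t x) powr q)" A]
    by (simp add: case_prod_beta')
  define J where "J k t = (LEAST j. \<forall>n\<ge>j. \<forall>m\<ge>j. E n m t \<le> ennreal ((1 / 2) ^ k))" for k :: nat and t
  have J_meas[measurable]: "J k \<in> measurable A (count_space UNIV)" for k
    unfolding J_def by measurable
  define v where "v k z = s (J k (fst z)) (fst z) (snd z)" for k z
  have v_meas[measurable]: "v k \<in> borel_measurable (A \<Otimes>\<^sub>M N)" for k
    unfolding v_def
    by (rule measurable_compose_countable[where f="\<lambda>n z. s n (fst z) (snd z)" and g="\<lambda>z. J k (fst z)"]) measurable
  define w where "w t x = lim (\<lambda>k. v k (t, x))" for t x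
  have "(\<lambda>z. lim (\<lambda>k. v k z)) \<in> borel_measurable (A \<Otimes>\<^sub>M N)"
    by measurable
  then have "(\<lambda>z. w (fst z) (snd z)) \<in> borel_measurable (A \<Otimes>\<^sub>M N)"
    by (simp add: w_def)
  moreover have "AE t in A. AE x in N. w t x = u t x"
    using u lim AE_space
  proof eventually_elim
    case (elim t)
    note [measurable] = elim(1) s_slice[OF elim(3)]
    define e where "e n = (\<integral>\<^sup>+ x. ennreal (norm (s n t x - u t x) powr q) \<partial>N)" for n
    have e_lim: "e \<longlonglongrightarrow> 0"
      using elim(2) by (simp add: e_def[abs_def] norm_minus_commute)
    have E_le: "E n m t \<le> ennreal (2 powr q) * (e n + e m)" for n m
      using nn_integral_powr_triangle[of q "s n t" N "u t" "s m t"] q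
      by (simp add: E_def e_def norm_minus_commute)
    have J: "E n m t \<le> ennreal ((1 / 2) ^ k)" if nm: "J k t \<le> n" "J k t \<le> m" for n m k
    proof -
      let ?P = "\<lambda>j. \<forall>n\<ge>j. \<forall>m\<ge>j. E n m t \<le> ennreal ((1 / 2) ^ k)"
      \<comment> \<open>Chosen so that two errors below \<open>d\<close> give exactly
        \<open>(1 / 2) ^ k\<close> after the factor \<open>2 powr q\<close>.\<close>
      define d where "d = (1 / 2) ^ k / (2 * 2 powr q)"
      have d: "0 < d"
        by (simp add: d_def)
      have "\<forall>\<^sub>F n in sequentially. e n < ennreal d"
        by (rule order_tendstoD(2)[OF e_lim]) (use d in \<open>simp only: ennreal_less_zero_iff\<close>)
      then obtain j where j: "\<And>n. n \<ge> j \<Longrightarrow> e n < ennreal d"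
        by (auto simp: eventually_sequentially)
      have "E n m t \<le> ennreal ((1 / 2) ^ k)" if "n \<ge> j" "m \<ge> j" for n m
      proof -
        have "E n m t \<le> ennreal (2 powr q) * (ennreal d + ennreal d)"
          using E_le[of n m] j[OF that(1)] j[OF that(2)]
          by (meson add_mono less_imp_le mult_left_mono order_trans zero_le)
        also have "\<dots> = ennreal (2 powr q * (d + d))"
          using d by (simp add: ennreal_mult flip: ennreal_plus)
        also have "2 powr q * (d + d) = (1 / 2) ^ k"
          by (simp add: d_def field_simps)
        finally show ?thesis .
      qed
      then have "?P j"
        by blast
      then have "?P (Least ?P)"
        by (rule LeastI)
      then show ?thesis
        using nm unfolding J_def by blast
    qed
    \<comment> \<open>The Cauchy bound at index \<open>J k t\<close> is turned into a bound on the
      distance to the limit by letting the second index tend to infinity.\<close>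
    have e_J: "e (J k t) \<le> ennreal (2 powr q) * ennreal ((1 / 2) ^ k)" for k
    proof (rule LIMSEQ_le_const)
      show "(\<lambda>m. ennreal (2 powr q) * (ennreal ((1 / 2) ^ k) + e m)) \<longlonglongrightarrow> ennreal (2 powr q) * ennreal ((1 / 2) ^ k)"
        using ennreal_tendsto_cmult[OF _ tendsto_add[OF tendsto_const e_lim], of "ennreal (2 powr q)" "ennreal ((1 / 2) ^ k)"]
        by simp
      have "e (J k t) \<le> ennreal (2 powr q) * (ennreal ((1 / 2) ^ k) + e m)" if "J k t \<le> m" for m
      proof -
        have "e (J k t) \<le> ennreal (2 powr q) * (E (J k t) m t + e m)"
          using nn_integral_powr_triangle[of q "s (J k t) t" N "s m t" "u t"] q by (simp add: E_def e_def)
        also have "\<dots> \<le> ennreal (2 powr q) * (ennreal ((1 / 2) ^ k) + e m)"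
          using J[OF order_refl that] by (intro mult_left_mono add_right_mono) auto
        finally show ?thesis .
      qed
      then show "\<exists>j. \<forall>m\<ge>j. e (J k t) \<le> ennreal (2 powr q) * (ennreal ((1 / 2) ^ k) + e m)"
        by blast
    qed
    have "(\<Sum>k. e (J k t)) \<le> (\<Sum>k. ennreal (2 powr q) * ennreal ((1 / 2) ^ k))"
      using e_J by (intro suminf_le) auto
    also have "\<dots> = (\<Sum>k. ennreal (2 powr q * (1 / 2) ^ k))"
      by (intro suminf_cong ennreal_mult[symmetric]) simp_all
    also have "\<dots> = ennreal (\<Sum>k. 2 powr q * (1 / 2) ^ k)"
      by (intro suminf_ennreal2 summable_mult summable_geometric) simp_all
    also have "\<dots> < \<infinity>"
      by simp
    finally have "(\<Sum>k. \<integral>\<^sup>+ x. ennreal (norm (s (J k t) t x - u t x) powr q) \<partial>N) < \<infinity>"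
      by (simp only: e_def)
    then have "AE x in N. (\<lambda>k. s (J k t) t x) \<longlonglongrightarrow> u t x"
      by (rule AE_tendsto_of_summable_powr[OF q s_slice[OF elim(3)] elim(1)])
    then show ?case
      by eventually_elim (simp add: w_def v_def limI)
  qed
  ultimately show ?thesis
    by blast
qed

text \<open>The \<open>W1_norm\<close> dominates the \<open>Lp_norm\<close>, so the simple functions
  approximating \<open>u\<close> also converge to it in \<open>L\<^sup>q\<close> at almost every
  time, which provides the jointly measurable representative. The divergence condition passes from
  \<open>u\<close> to \<open>w\<close>, since they agree almost everywhere in space at almost every
  time.\<close>

lemma L1_time_imp_velocity:
  fixes \<Omega> :: "'a::euclidean_space set" and u :: "real \<Rightarrow> 'a \<Rightarrow> 'a"
  assumes T: "0 < T" and \<Omega>: "open \<Omega>" "bounded \<Omega>" and q: "1 \<le> q"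
    and u: "u \<in> L1_time T (W10_space (ennreal q) \<Omega>) (W1_norm (ennreal q) \<Omega>)"
    and div: "weakly_divergence_free T \<Omega> u"
  shows "\<exists>w. velocity T \<Omega> q w \<and>
    (AE t in lebesgue_on {0<..<T}. u t \<in> borel_measurable (lebesgue_on \<Omega>) \<and> (AE x in lebesgue_on \<Omega>. w t x = u t x))"
proof -
  let ?A = "lebesgue_on {0<..<T}" and ?X = "lebesgue_on \<Omega>" and ?W = "W10_space (ennreal q) \<Omega> :: ('a \<Rightarrow> 'a) set"
  have "\<Omega> \<in> lmeasurable"
    using \<Omega> by (simp add: lmeasurable_open)
  then interpret X: finite_measure ?X
    by (rule finite_measure_lebesgue_on)
  have W_Lp: "f \<in> borel_measurable ?X" "Lp_norm (ennreal q) \<Omega> f < \<infinity>" if "f \<in> ?W" for f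
    using that by (auto simp: W10_space_def W1_space_def Lp_space_def)
  have Lp_le_W1: "Lp_norm (ennreal q) \<Omega> f \<le> W1_norm (ennreal q) \<Omega> f" for f :: "'a \<Rightarrow> 'a"
    by (simp add: W1_norm_def add_increasing2)
  have u_W: "AE t in ?A. u t \<in> ?W"
    and u_int: "(\<integral>\<^sup>+ t. W1_norm (ennreal q) \<Omega> (u t) \<partial>?A) < \<infinity>"
    using u by (simp_all add: L1_time_def bochner_measurable_def)
  obtain s where s: "\<And>n. simple_function ?A (s n)" "\<And>n t. t \<in> {0<..<T} \<Longrightarrow> s n t \<in> ?W"
    and s_lim: "AE t in ?A. (\<lambda>n::nat. W1_norm (ennreal q) \<Omega> (u t - s n t)) \<longlonglongrightarrow> 0"
    using u unfolding L1_time_def bochner_measurable_def by blast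
  have u_meas: "AE t in ?A. u t \<in> borel_measurable ?X"
    using u_W by eventually_elim (rule W_Lp)
  have "AE t in ?A. (\<lambda>n. \<integral>\<^sup>+ x. ennreal (norm (u t x - s n t x) powr q) \<partial>?X) \<longlonglongrightarrow> 0"
    using s_lim
  proof eventually_elim
    case (elim t)
    have "(\<lambda>n. Lp_norm (ennreal q) \<Omega> (u t - s n t)) \<longlonglongrightarrow> 0"
      by (rule tendsto_sandwich[OF _ _ tendsto_const elim]) (simp_all add: Lp_le_W1)
    from Lp_norm_tendsto_0_imp[OF q this] show ?case
      by simp
  qed
  then have "\<exists>w. (\<lambda>z. w (fst z) (snd z)) \<in> borel_measurable (?A \<Otimes>\<^sub>M ?X) \<and> (AE t in ?A. AE x in ?X. w t x = u t x)"
    using q W_Lp(1)[OF s(2)]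
    by (intro ex_jointly_measurable_limit[OF _ X.sigma_finite_measure_axioms
          simple_function_pair_measurable[OF s(1)] _ u_meas]) simp_all
  then obtain v where v[measurable]: "(\<lambda>z. v (fst z) (snd z)) \<in> borel_measurable (?A \<Otimes>\<^sub>M ?X)"
    and v_u: "AE t in ?A. AE x in ?X. v t x = u t x"
    by blast
  define I where "I t = (\<integral>\<^sup>+ x. ennreal (norm (v t x) powr q) \<partial>?X)" for t
  have I_meas[measurable]: "I \<in> borel_measurable ?A"
    unfolding I_def by (rule X.borel_measurable_nn_integral) (simp add: case_prod_beta')
  \<comment> \<open>Erasing the times of infinite norm changes \<open>v\<close> on a null set of
    times and makes every slice integrable to the power \<open>q\<close>.\<close>
  define w where "w t x = (if I t < \<infinity> then v t x else 0)" for t x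
  have w_meas[measurable]: "(\<lambda>z. w (fst z) (snd z)) \<in> borel_measurable (?A \<Otimes>\<^sub>M ?X)"
    unfolding w_def by measurable
  have I_u: "AE t in ?A. I t = (\<integral>\<^sup>+ x. ennreal (norm (u t x) powr q) \<partial>?X)"
    using v_u
  proof eventually_elim
    case (elim t)
    then have "AE x in ?X. ennreal (norm (v t x) powr q) = ennreal (norm (u t x) powr q)"
      by eventually_elim simp
    then show ?case
      unfolding I_def by (rule nn_integral_cong_AE)
  qed
  have fin: "AE t in ?A. I t < \<infinity>"
    using I_u u_W by eventually_elim (use W_Lp(2) Lp_norm_finite_iff[OF q] in auto)
  have w_u: "AE t in ?A. AE x in ?X. w t x = u t x"
    using fin v_u by eventually_elim (simp add: w_def)
  have w_slice: "integrable ?X (\<lambda>x. norm (w t x) powr q)" if t: "t \<in> {0<..<T}" for t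
  proof (cases "I t < \<infinity>")
    case True
    have [measurable]: "(\<lambda>x. v t x) \<in> borel_measurable ?X"
      using measurable_compose[OF measurable_Pair1' v, of t] t by simp
    show ?thesis
      using True by (intro integrableI_nonneg) (simp_all add: w_def I_def)
  qed (simp add: w_def)
  have "velocity T \<Omega> q w"
  proof
    show "case_prod w \<in> borel_measurable (?A \<Otimes>\<^sub>M ?X)"
      using w_meas by (simp add: case_prod_beta')
    show "integrable ?A (\<lambda>t. lnorm q ?X (\<lambda>x. norm (w t x)))"
    proof (rule integrableI_nonneg)
      show "(\<lambda>t. lnorm q ?X (\<lambda>x. norm (w t x))) \<in> borel_measurable ?A"
        by (rule measurable_slice_lnorm[OF X.sigma_finite_measure_axioms]) (simp add: case_prod_beta')
      have "AE t in ?A. ennreal (lnorm q ?X (\<lambda>x. norm (w t x))) \<le> W1_norm (ennreal q) \<Omega> (u t)"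
        using fin I_u AE_space
      proof eventually_elim
        case (elim t)
        have "(\<lambda>x. w t x) = (\<lambda>x. v t x)"
          using elim by (simp add: w_def)
        then have "I t = (\<integral>\<^sup>+ x. ennreal (norm (w t x) powr q) \<partial>?X)"
          by (simp add: I_def)
        also have "\<dots> = ennreal (LINT x|?X. norm (w t x) powr q)"
          using w_slice[of t] elim by (intro nn_integral_eq_integral) auto
        finally have "enn2real (I t) = (LINT x|?X. norm (w t x) powr q)"
          by simp
        then have "ennreal (lnorm q ?X (\<lambda>x. norm (w t x))) = Lp_norm (ennreal q) \<Omega> (u t)"
          using elim by (simp add: lnorm_def Lp_norm_finite_exponent[OF q] Let_def less_top)
        then show ?case
          using Lp_le_W1 by simp
      qed
      then have "(\<integral>\<^sup>+ t. ennreal (lnorm q ?X (\<lambda>x. norm (w t x))) \<partial>?A) \<le> (\<integral>\<^sup>+ t. W1_norm (ennreal q) \<Omega> (u t) \<partial>?A)"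
        by (rule nn_integral_mono_AE)
      then show "(\<integral>\<^sup>+ t. ennreal (lnorm q ?X (\<lambda>x. norm (w t x))) \<partial>?A) < \<infinity>"
        using u_int by (rule le_less_trans)
    qed simp
    show "AE t in ?A. \<forall>\<phi>\<in>test_functions \<Omega>. (LINT x|?X. w t x \<bullet> grad \<phi> x) = 0"
      using div[unfolded weakly_divergence_free_def] w_u u_meas AE_space
    proof eventually_elim
      case (elim t)
      show ?case
      proof
        fix \<phi> :: "'a \<Rightarrow> real" assume \<phi>: "\<phi> \<in> test_functions \<Omega>"
        have [measurable]: "u t \<in> borel_measurable ?X" "(\<lambda>x. w t x) \<in> borel_measurable ?X"
          using elim measurable_compose[OF measurable_Pair1' w_meas, of t] by simp_all
        have "Ck_on 1 UNIV \<phi>"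
          using \<phi> by (simp add: test_functions_def smooth_on_def)
        then have "continuous_on UNIV (\<lambda>x. frechet_derivative \<phi> (at x) b)" for b
          by simp
        then have "continuous_on UNIV (grad \<phi>)"
          unfolding grad_def[abs_def] by (intro continuous_intros)
        then have "continuous_on \<Omega> (grad \<phi>)"
          by (rule continuous_on_subset) simp
        then have [measurable]: "grad \<phi> \<in> borel_measurable ?X"
          using \<Omega>(1) by (intro continuous_imp_measurable_on_sets_lebesgue) auto
        have "AE x in ?X. w t x \<bullet> grad \<phi> x = u t x \<bullet> grad \<phi> x"
          using elim(2) by eventually_elim simp
        then have "(LINT x|?X. w t x \<bullet> grad \<phi> x) = (LINT x|?X. u t x \<bullet> grad \<phi> x)"
          by (intro integral_cong_AE) measurable
        then show "(LINT x|?X. w t x \<bullet> grad \<phi> x) = 0"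
          using elim(1) \<phi> by simp
      qed
    qed
  qed (use T \<Omega> q w_slice in auto)
  moreover have "AE t in ?A. u t \<in> borel_measurable ?X \<and> (AE x in ?X. w t x = u t x)"
    using u_meas w_u by eventually_elim simp
  ultimately show ?thesis
    by blast
qed

subsection \<open>Solutions for nonnegative initial data\<close>

text \<open>The support of \<eta> is a closed subset of the union of two compact supports. Sums and
  multiples are both instances.\<close>

lemma spacetime_test_functions_combine:
  fixes \<phi> \<psi> \<eta> :: "real \<times> 'a::euclidean_space \<Rightarrow> real"
  assumes \<phi>: "\<phi> \<in> spacetime_test_functions T \<Omega>" and \<psi>: "\<psi> \<in> spacetime_test_functions T \<Omega>"
    and smooth: "smooth_on ({..<T} \<times> \<Omega>) \<eta>"
    and zero: "\<And>z. \<phi> z = 0 \<Longrightarrow> \<psi> z = 0 \<Longrightarrow> \<eta> z = 0"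
  shows "\<eta> \<in> spacetime_test_functions T \<Omega>"
proof -
  let ?S = "\<lambda>f :: real \<times> 'a \<Rightarrow> real. closure {z \<in> {0..<T} \<times> \<Omega>. f z \<noteq> 0}"
  have supp: "compact (?S \<phi>)" "?S \<phi> \<subseteq> {0..<T} \<times> \<Omega>" "compact (?S \<psi>)" "?S \<psi> \<subseteq> {0..<T} \<times> \<Omega>"
    using \<phi> \<psi> by (simp_all add: spacetime_test_functions_def)
  note K = compact_Un[OF supp(1,3)] Un_least[OF supp(2,4)]
  have "{z \<in> {0..<T} \<times> \<Omega>. \<eta> z \<noteq> 0} \<subseteq> {z \<in> {0..<T} \<times> \<Omega>. \<phi> z \<noteq> 0} \<union> {z \<in> {0..<T} \<times> \<Omega>. \<psi> z \<noteq> 0}"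
    using zero by blast
  then have sub: "?S \<eta> \<subseteq> ?S \<phi> \<union> ?S \<psi>"
    using closure_mono unfolding closure_Un[symmetric] by blast
  have "compact (?S \<eta>)"
    using compact_Int_closed[OF K(1) closed_closure, of "{z \<in> {0..<T} \<times> \<Omega>. \<eta> z \<noteq> 0}"] sub
    by (simp add: inf.absorb2)
  moreover have "?S \<eta> \<subseteq> {0..<T} \<times> \<Omega>"
    using sub K(2) by (rule order_trans)
  ultimately show ?thesis
    using smooth by (simp add: spacetime_test_functions_def)
qed

context velocity
begin

lemma velocity_test: "\<phi> \<in> spacetime_test_functions T \<Omega> \<Longrightarrow> velocity_test T \<Omega> q w \<phi>"
  using T open_\<Omega> by unfold_locales auto

lemma transport_add:
  assumes "\<phi> \<in> spacetime_test_functions T \<Omega>" "\<psi> \<in> spacetime_test_functions T \<Omega>"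
  shows "transport (\<lambda>z. \<phi> z + \<psi> z) = (\<lambda>z. transport \<phi> z + transport \<psi> z)"
proof
  fix z
  interpret \<phi>: velocity_test T \<Omega> q w \<phi>
    using assms(1) by (rule velocity_test)
  interpret \<psi>: velocity_test T \<Omega> q w \<psi>
    using assms(2) by (rule velocity_test)
  show "transport (\<lambda>z. \<phi> z + \<psi> z) z = transport \<phi> z + transport \<psi> z"
  proof (cases "z \<in> {0<..<T} \<times> \<Omega>")
    case True
    then have "z \<in> {..<T} \<times> \<Omega>"
      by auto
    note frechet_derivative_at[OF has_derivative_add[OF
      \<phi>.tf.has_derivative_\<phi>[OF this] \<psi>.tf.has_derivative_\<phi>[OF this]], THEN fun_cong]
    then show ?thesis
      unfolding transport_def if_P[OF True] by (rule sym)
  qed (simp only: transport_def if_False add_0)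
qed

lemma transport_scale:
  assumes "\<phi> \<in> spacetime_test_functions T \<Omega>"
  shows "transport (\<lambda>z. c * \<phi> z) = (\<lambda>z. c * transport \<phi> z)"
proof
  fix z
  interpret \<phi>: velocity_test T \<Omega> q w \<phi>
    using assms(1) by (rule velocity_test)
  show "transport (\<lambda>z. c * \<phi> z) z = c * transport \<phi> z"
  proof (cases "z \<in> {0<..<T} \<times> \<Omega>")
    case True
    then have "z \<in> {..<T} \<times> \<Omega>"
      by auto
    note frechet_derivative_at[OF has_derivative_mult_right[OF \<phi>.tf.has_derivative_\<phi>[OF this], of c], THEN fun_cong]
    then show ?thesis
      unfolding transport_def if_P[OF True] by (rule sym)
  qed (simp only: transport_def if_False mult_zero_right)
qed

text \<open>The graph to be extended consists of the pairs of \<open>transport \<phi>\<close> and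
  the pairing of \<open>r\<close> with the initial value of \<phi>. The factor \<open>q\<close> in
  the bound is the one lost in the a priori estimate. Equal transports of different test functions
  need no separate treatment, as the bound itself forces equal pairings.\<close>

theorem ex_nonneg_solution:
  fixes r :: "'a \<Rightarrow> real"
  assumes r_nn: "\<And>x. 0 \<le> r x" and C: "0 \<le> C"
    and r: "\<And>h. h \<in> borel_measurable X \<Longrightarrow> (\<And>x. 0 \<le> h x) \<Longrightarrow> integrable X (\<lambda>x. h x powr q) \<Longrightarrow>
      integrable X (\<lambda>x. r x * h x) \<and> (LINT x|X. r x * h x) \<le> C * lnorm q X h"
  shows "\<exists>\<rho>\<in>borel_measurable M. (\<forall>z. 0 \<le> \<rho> z) \<and>
    (\<forall>g\<in>V. integrable M (\<lambda>z. \<rho> z * g z) \<and> (LINT z|M. \<rho> z * g z) \<le> (C * q) * N g) \<and>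
    (\<forall>\<phi>\<in>spacetime_test_functions T \<Omega>. integrable X (\<lambda>x. r x * \<phi> (0, x)) \<and>
      (LINT z|M. \<rho> z * transport \<phi> z) = (LINT x|X. r x * \<phi> (0, x)))"
proof -
  let ?F = "spacetime_test_functions T \<Omega>"
  define G where "G = (\<lambda>\<phi>. (transport \<phi>, LINT x|X. r x * \<phi> (0, x))) ` ?F"
  have int: "integrable X (\<lambda>x. r x * \<phi> (0, x))" "(LINT x|X. r x * \<phi> (0, x)) \<le> (C * q) * N (transport \<phi>)"
    if \<phi>: "\<phi> \<in> ?F" for \<phi>
  proof -
    interpret \<phi>: velocity_test T \<Omega> q w \<phi>
      using \<phi> by (rule velocity_test)
    have "continuous_on \<Omega> (\<lambda>x. \<phi> (0, x))"
      using \<phi>.tf.Ck_slice[OF T, of 0] by simp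
    then have [measurable]: "(\<lambda>x. \<phi> (0, x)) \<in> borel_measurable X"
      using open_\<Omega> by (intro continuous_imp_measurable_on_sets_lebesgue) auto
    obtain B where B: "0 \<le> B" "\<forall>z\<in>{0..<T} \<times> \<Omega>. \<bar>\<phi> z\<bar> \<le> B"
      using \<phi>.tf.bounded_\<phi> by blast
    have bd: "\<bar>\<phi> (0, x)\<bar> \<le> B" if "x \<in> \<Omega>" for x
      using B(2) that T by auto
    have "integrable X (\<lambda>x. max 0 (\<phi> (0, x)) powr q)" "integrable X (\<lambda>x. max 0 (- \<phi> (0, x)) powr q)"
      using bd B(1) q_pos
      by (intro X.integrable_const_bound[where B="B powr q"] AE_I2; force intro!: powr_mono2 simp: abs_le_iff)+
    then have 1: "integrable X (\<lambda>x. r x * max 0 (\<phi> (0, x)))"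
        "(LINT x|X. r x * max 0 (\<phi> (0, x))) \<le> C * lnorm q X (\<lambda>x. max 0 (\<phi> (0, x)))"
      and 2: "integrable X (\<lambda>x. r x * max 0 (- \<phi> (0, x)))"
      using r[of "\<lambda>x. max 0 (\<phi> (0, x))"] r[of "\<lambda>x. max 0 (- \<phi> (0, x))"] by simp_all
    have "r x * \<phi> (0, x) = r x * max 0 (\<phi> (0, x)) - r x * max 0 (- \<phi> (0, x))" for x
      by (simp add: max_def)
    then show int1: "integrable X (\<lambda>x. r x * \<phi> (0, x))"
      using 1(1) 2 by simp
    \<comment> \<open>Since \<open>r\<close> is nonnegative, dropping the negative part of \<phi>
      only increases the integral; this matches the one-sided estimate.\<close>
    have "(LINT x|X. r x * \<phi> (0, x)) \<le> (LINT x|X. r x * max 0 (\<phi> (0, x)))"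
      using r_nn by (intro integral_mono int1 1(1) mult_left_mono) auto
    also have "\<dots> \<le> C * lnorm q X (\<lambda>x. max 0 (\<phi> (0, x)))"
      by (rule 1(2))
    also have "\<dots> \<le> C * (q * N (transport \<phi>))"
      by (rule mult_left_mono[OF \<phi>.a_priori_estimate C])
    finally show "(LINT x|X. r x * \<phi> (0, x)) \<le> (C * q) * N (transport \<phi>)"
      by (simp add: mult.assoc)
  qed
  have open_D: "open ({..<T} \<times> \<Omega>)"
    using open_\<Omega> by (simp add: open_Times)
  have F_add: "(\<lambda>z. \<phi> z + \<psi> z) \<in> ?F" if "\<phi> \<in> ?F" "\<psi> \<in> ?F" for \<phi> \<psi>
  proof (rule spacetime_test_functions_combine[OF that])
    show "smooth_on ({..<T} \<times> \<Omega>) (\<lambda>z. \<phi> z + \<psi> z)"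
      using that by (auto simp: smooth_on_def spacetime_test_functions_def intro: Ck_on_add[OF open_D])
  qed simp
  have F_scale: "(\<lambda>z. c * \<phi> z) \<in> ?F" if "\<phi> \<in> ?F" for c \<phi>
  proof (rule spacetime_test_functions_combine[OF that that])
    show "smooth_on ({..<T} \<times> \<Omega>) (\<lambda>z. c * \<phi> z)"
      using that by (auto simp: smooth_on_def spacetime_test_functions_def intro: Ck_on_mult[OF open_D] Ck_on_const[OF open_D])
  qed simp
  have F_0: "(\<lambda>z. 0) \<in> ?F"
    by (auto simp: spacetime_test_functions_def smooth_on_def intro: Ck_on_const[OF open_D])
  have "subspace G"
  proof (rule subspaceI)
    have "transport (\<lambda>z. 0) = (\<lambda>z. 0)"
      using transport_scale[OF F_0, of 0] by simp
    then have "0 = (transport (\<lambda>z. 0), LINT x|X. r x * 0)"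
      by (simp add: zero_prod_def zero_fun_def)
    then show "0 \<in> G"
      unfolding G_def by (rule image_eqI[OF _ F_0])
  next
    fix a b assume "a \<in> G" "b \<in> G"
    then obtain \<phi> \<psi> where \<phi>: "\<phi> \<in> ?F" "a = (transport \<phi>, LINT x|X. r x * \<phi> (0, x))"
      and \<psi>: "\<psi> \<in> ?F" "b = (transport \<psi>, LINT x|X. r x * \<psi> (0, x))"
      unfolding G_def by blast
    have "a + b = (transport (\<lambda>z. \<phi> z + \<psi> z), LINT x|X. r x * (\<phi> (0, x) + \<psi> (0, x)))"
      using int(1)[OF \<phi>(1)] int(1)[OF \<psi>(1)] transport_add[OF \<phi>(1) \<psi>(1)]
      by (simp add: \<phi>(2) \<psi>(2) plus_fun_def distrib_left)
    then show "a + b \<in> G"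
      unfolding G_def by (rule image_eqI[OF _ F_add[OF \<phi>(1) \<psi>(1)]])
  next
    fix c :: real and a assume "a \<in> G"
    then obtain \<phi> where \<phi>: "\<phi> \<in> ?F" "a = (transport \<phi>, LINT x|X. r x * \<phi> (0, x))"
      unfolding G_def by blast
    have "c *\<^sub>R a = (transport (\<lambda>z. c * \<phi> z), LINT x|X. r x * (c * \<phi> (0, x)))"
      using transport_scale[OF \<phi>(1)] by (simp add: \<phi>(2) scaleR_fun_def mult.left_commute)
    then show "c *\<^sub>R a \<in> G"
      unfolding G_def by (rule image_eqI[OF _ F_scale[OF \<phi>(1)]])
  qed
  moreover have "fst ` G \<subseteq> V"
  proof
    fix g assume "g \<in> fst ` G"
    then obtain \<phi> where "\<phi> \<in> ?F" "g = transport \<phi>"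
      unfolding G_def by force
    then show "g \<in> V"
      using velocity_test.transport_V[OF velocity_test] by simp
  qed
  moreover have "\<forall>(g, a)\<in>G. a \<le> (C * q) * N g"
    using int(2) by (auto simp: G_def)
  ultimately have below: "graph_below V (\<lambda>g. (C * q) * N g) G"
    by (simp add: graph_below_def)
  have "0 \<le> C * q"
    using C q_pos by simp
  from ex_density[OF this below] obtain \<rho> where \<rho>: "\<rho> \<in> borel_measurable M" "\<forall>z. 0 \<le> \<rho> z"
    "\<forall>g\<in>V. integrable M (\<lambda>z. \<rho> z * g z) \<and> (LINT z|M. \<rho> z * g z) \<le> (C * q) * N g"
    and eq: "\<forall>(g, a)\<in>G. (LINT z|M. \<rho> z * g z) = a"
    by (elim bexE conjE)
  have "\<forall>\<phi>\<in>?F. integrable X (\<lambda>x. r x * \<phi> (0, x)) \<and>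
      (LINT z|M. \<rho> z * transport \<phi> z) = (LINT x|X. r x * \<phi> (0, x))"
    using eq int(1) unfolding G_def by simp
  then show ?thesis
    using \<rho> by (intro bexI[OF _ \<rho>(1)] conjI)
qed

end

subsection \<open>Conjugate exponents\<close>

lemma conjugate_exponent_cases:
  fixes p q :: ennreal
  assumes "1 < p" "1 / p + 1 / q = 1"
  obtains "p = \<infinity>" "q = ennreal 1"
  | q' where "1 < q'" "q = ennreal q'" "p = ennreal (q' / (q' - 1))"
proof -
  have "q \<noteq> 0"
    using assms(2) by auto
  show ?thesis
  proof (cases "p = \<infinity>")
    case True
    then have q1: "1 / q = ennreal 1"
      using assms(2) by simp
    then have "q \<noteq> \<infinity>"
      by auto
    with \<open>q \<noteq> 0\<close> obtain b where b: "q = ennreal b" "0 < b"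
      by (cases q) auto
    then have "ennreal (1 / b) = ennreal 1"
      using q1 divide_ennreal[of 1 b] by simp
    then have "1 / b = 1"
      using b(2) by (subst (asm) ennreal_inj) auto
    then show ?thesis
      using True b that(1) by simp
  next
    case False
    then obtain a where a: "p = ennreal a" "0 \<le> a"
      by (cases p) auto
    have a1: "1 < a"
      using assms(1) a by simp
    have ip: "1 / p = ennreal (1 / a)"
      using a a1 divide_ennreal[of 1 a] by simp
    have "q \<noteq> \<infinity>"
    proof
      assume "q = \<infinity>"
      then have "ennreal (1 / a) = ennreal 1"
        using assms(2) ip by simp
      then show False
        using a1 by (subst (asm) ennreal_inj) auto
    qed
    with \<open>q \<noteq> 0\<close> obtain b where b: "q = ennreal b" "0 < b"
      by (cases q) auto
    have iq: "1 / q = ennreal (1 / b)"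
      using b divide_ennreal[of 1 b] by simp
    have "ennreal (1 / a + 1 / b) = ennreal 1"
      using assms(2) ip iq a1 b by (simp add: ennreal_plus)
    then have sum: "1 / a + 1 / b = 1"
      using a1 b by (subst (asm) ennreal_inj) auto
    moreover have "0 < 1 / a"
      using a1 by simp
    ultimately have "1 / b < 1"
      by linarith
    then have b1: "1 < b"
      using b by (simp add: divide_less_eq)
    moreover have "a = b / (b - 1)"
      using sum a1 b1 by (simp add: field_simps)
    ultimately show ?thesis
      using that(2) a b by simp
  qed
qed

lemma Lp_pairing_bound_infinity:
  fixes r0 :: "'a::euclidean_space \<Rightarrow> 'b::euclidean_space" and r :: "'a \<Rightarrow> real"
  assumes r0: "r0 \<in> Lp_space \<infinity> \<Omega>"
    and [measurable]: "r \<in> borel_measurable (lebesgue_on \<Omega>)" and r_nn: "\<And>x. 0 \<le> r x"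
    and r_le: "\<And>x. r x \<le> norm (r0 x)"
  shows "\<exists>C\<ge>0. \<forall>h :: 'a \<Rightarrow> real. h \<in> borel_measurable (lebesgue_on \<Omega>) \<longrightarrow> (\<forall>x. 0 \<le> h x) \<longrightarrow>
    integrable (lebesgue_on \<Omega>) (\<lambda>x. h x powr 1) \<longrightarrow>
    integrable (lebesgue_on \<Omega>) (\<lambda>x. r x * h x) \<and> (LINT x|lebesgue_on \<Omega>. r x * h x) \<le> C * lnorm 1 (lebesgue_on \<Omega>) h"
proof -
  let ?X = "lebesgue_on \<Omega>"
  define C where "C = enn2real (Lp_norm \<infinity> \<Omega> r0)"
  have fin: "Lp_norm \<infinity> \<Omega> r0 < \<infinity>"
    using r0 by (simp add: Lp_space_def)
  have "AE x in ?X. ennreal (norm (r0 x)) \<le> Lp_norm \<infinity> \<Omega> r0"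
    using esssup_AE[of "\<lambda>x. ennreal (norm (r0 x))" ?X] by (simp add: Lp_norm_def)
  then have AE_r: "AE x in ?X. r x \<le> C"
  proof eventually_elim
    case (elim x)
    then have "ennreal (norm (r0 x)) \<le> ennreal C"
      using fin by (simp add: C_def)
    then have "norm (r0 x) \<le> C"
      by (simp add: C_def)
    then show ?case
      using r_le[of x] by simp
  qed
  show ?thesis
  proof (intro exI[of _ C] conjI allI impI)
    show "0 \<le> C"
      by (simp add: C_def)
    fix h :: "'a \<Rightarrow> real" assume h: "h \<in> borel_measurable ?X" "\<forall>x. 0 \<le> h x" "integrable ?X (\<lambda>x. h x powr 1)"
    note [measurable] = h(1)
    have int: "integrable ?X (\<lambda>x. C * h x)"
      using h(2,3) by simp
    have le: "AE x in ?X. r x * h x \<le> C * h x"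
      using AE_r by eventually_elim (use h(2) in \<open>simp add: mult_right_mono\<close>)
    show int2: "integrable ?X (\<lambda>x. r x * h x)"
    proof (rule Bochner_Integration.integrable_bound[OF int])
      show "AE x in ?X. norm (r x * h x) \<le> norm (C * h x)"
        using le by eventually_elim (use r_nn h(2) in simp)
    qed measurable
    have "(LINT x|?X. r x * h x) \<le> (LINT x|?X. C * h x)"
      by (rule integral_mono_AE[OF int2 int le])
    then show "(LINT x|?X. r x * h x) \<le> C * lnorm 1 ?X h"
      using h(2) by (simp add: lnorm_def)
  qed
qed

text \<open>With \<open>f = r powr (1 / (q - 1))\<close> one has \<open>f powr (q - 1) = r\<close>
  and \<open>f powr q = r powr p\<close>, which puts the pairing into the form of
  \<open>Holder\<close>. The constant is the norm of \<open>r\<close> in \<open>L\<^sup>p\<close>,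
  because \<open>1 - 1 / q = 1 / p\<close>.\<close>

lemma Lp_pairing_bound:
  fixes r0 :: "'a::euclidean_space \<Rightarrow> 'b::euclidean_space" and r :: "'a \<Rightarrow> real"
  assumes q: "1 < q" and p: "p = q / (q - 1)" and r0: "r0 \<in> Lp_space (ennreal p) \<Omega>"
    and [measurable]: "r \<in> borel_measurable (lebesgue_on \<Omega>)" and r_nn: "\<And>x. 0 \<le> r x"
    and r_le: "\<And>x. r x \<le> norm (r0 x)"
  shows "\<exists>C\<ge>0. \<forall>h :: 'a \<Rightarrow> real. h \<in> borel_measurable (lebesgue_on \<Omega>) \<longrightarrow> (\<forall>x. 0 \<le> h x) \<longrightarrow>
    integrable (lebesgue_on \<Omega>) (\<lambda>x. h x powr q) \<longrightarrow>
    integrable (lebesgue_on \<Omega>) (\<lambda>x. r x * h x) \<and> (LINT x|lebesgue_on \<Omega>. r x * h x) \<le> C * lnorm q (lebesgue_on \<Omega>) h"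
proof -
  let ?X = "lebesgue_on \<Omega>"
  have p1: "1 \<le> p" and pq: "(1 / (q - 1)) * q = p" and one: "(1 / (q - 1)) * (q - 1) = 1"
    using q by (auto simp: p field_simps)
  have r0_meas[measurable]: "r0 \<in> borel_measurable ?X"
    using r0 by (simp add: Lp_space_def)
  define f where "f x = r x powr (1 / (q - 1))" for x
  have [measurable]: "f \<in> borel_measurable ?X"
    unfolding f_def by measurable
  have f_nn: "0 \<le> f x" for x
    by (simp add: f_def)
  have f_q: "f x powr q = r x powr p" and f_q1: "f x powr (q - 1) = r x" for x
    unfolding f_def powr_powr pq one using r_nn by simp_all
  have "(\<integral>\<^sup>+ x. ennreal (norm (r0 x) powr p) \<partial>?X) < \<infinity>"
    using r0 Lp_norm_finite_iff[OF p1, of \<Omega> r0] by (simp add: Lp_space_def)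
  then have "integrable ?X (\<lambda>x. norm (r0 x) powr p)"
    by (intro integrableI_nonneg) auto
  then have int_f: "integrable ?X (\<lambda>x. f x powr q)"
  proof (rule Bochner_Integration.integrable_bound)
    show "AE x in ?X. norm (f x powr q) \<le> norm (norm (r0 x) powr p)"
      unfolding f_q using r_nn r_le p1 by (intro AE_I2) (simp add: powr_mono2)
  qed measurable
  show ?thesis
  proof (intro exI[of _ "(LINT x|?X. f x powr q) powr (1 - 1 / q)"] conjI allI impI)
    fix h :: "'a \<Rightarrow> real" assume h: "h \<in> borel_measurable ?X" "\<forall>x. 0 \<le> h x" "integrable ?X (\<lambda>x. h x powr q)"
    show "integrable ?X (\<lambda>x. r x * h x)"
      "(LINT x|?X. r x * h x) \<le> (LINT x|?X. f x powr q) powr (1 - 1 / q) * lnorm q ?X h"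
      using Holder[of q f ?X h, OF _ _ h(1) f_nn _ int_f h(3)] h(2) q by (simp_all add: f_q1)
  qed simp
qed

subsection \<open>Measurability on the space-time cylinder\<close>

text \<open>A Lebesgue set differs from a Borel set by a subset of a Borel null set, so preimages
  cause no trouble once those of null sets are null.\<close>

lemma lebesgue_preimage_null:
  fixes g :: "'a::euclidean_space \<Rightarrow> 'b::euclidean_space"
  assumes g: "g \<in> borel_measurable borel" and null: "\<And>N. N \<in> null_sets lborel \<Longrightarrow> g -` N \<in> null_sets lborel"
  shows "g \<in> measurable lebesgue lebesgue"
proof (rule complete_measure.measurable_completion2)
  show "complete_measure (lebesgue :: 'a measure)"
    by (rule completion.complete_measure_axioms)
  show *: "g \<in> measurable lebesgue lborel"
    using g by (intro measurable_completion) simp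
  show "null_sets lborel \<subseteq> null_sets (distr lebesgue lborel g)"
  proof
    fix N :: "'b set" assume N: "N \<in> null_sets lborel"
    then have "g -` N \<in> null_sets (lebesgue :: 'a measure)"
      using null null_sets_completionI by blast
    then show "N \<in> null_sets (distr lebesgue lborel g)"
      using null_setsD2[OF N] * by (simp add: null_sets_distr_iff)
  qed
qed

text \<open>The preimage of a null set is a strip of measure zero times infinity, which is
  zero.\<close>

lemma lebesgue_fst: "fst \<in> measurable (lebesgue :: ('a::euclidean_space \<times> 'b::euclidean_space) measure) lebesgue"
proof (rule lebesgue_preimage_null)
  show "fst \<in> borel_measurable (borel :: ('a \<times> 'b) measure)"
    by (intro borel_measurable_continuous_onI continuous_intros)
  fix N :: "'a set" assume N: "N \<in> null_sets lborel"
  have "fst -` N = N \<times> (UNIV :: 'b set)"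
    by auto
  moreover have "emeasure (lborel \<Otimes>\<^sub>M lborel) (N \<times> (UNIV :: 'b set)) = emeasure lborel N * emeasure lborel (UNIV :: 'b set)"
    using N by (intro lborel.emeasure_pair_measure_Times) auto
  then have "emeasure (lborel \<Otimes>\<^sub>M lborel) (N \<times> (UNIV :: 'b set)) = 0"
    unfolding null_setsD1[OF N] by simp
  then have "N \<times> (UNIV :: 'b set) \<in> null_sets (lborel \<Otimes>\<^sub>M lborel)"
    using N by (intro null_setsI pair_measureI) auto
  ultimately show "fst -` N \<in> null_sets (lborel :: ('a \<times> 'b) measure)"
    unfolding lborel_prod by simp
qed

lemma lebesgue_snd: "snd \<in> measurable (lebesgue :: ('a::euclidean_space \<times> 'b::euclidean_space) measure) lebesgue"
proof (rule lebesgue_preimage_null)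
  show "snd \<in> borel_measurable (borel :: ('a \<times> 'b) measure)"
    by (intro borel_measurable_continuous_onI continuous_intros)
  fix N :: "'b set" assume N: "N \<in> null_sets lborel"
  have "snd -` N = (UNIV :: 'a set) \<times> N"
    by auto
  moreover have "emeasure (lborel \<Otimes>\<^sub>M lborel) ((UNIV :: 'a set) \<times> N) = emeasure lborel (UNIV :: 'a set) * emeasure lborel N"
    using N by (intro lborel.emeasure_pair_measure_Times) auto
  then have "emeasure (lborel \<Otimes>\<^sub>M lborel) ((UNIV :: 'a set) \<times> N) = 0"
    unfolding null_setsD1[OF N] by simp
  then have "(UNIV :: 'a set) \<times> N \<in> null_sets (lborel \<Otimes>\<^sub>M lborel)"
    using N by (intro null_setsI pair_measureI) auto
  ultimately show "snd -` N \<in> null_sets (lborel :: ('a \<times> 'b) measure)"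
    unfolding lborel_prod by simp
qed

text \<open>The density is obtained on the product of two completed measures, whereas
  \<open>Linf_time_Lp\<close> refers to the completion on the product space. The latter is finer,
  because the projections are measurable for the completions.\<close>

lemma lebesgue_on_Times_measurable:
  fixes S :: "'a::euclidean_space set" and R :: "'b::euclidean_space set"
  assumes "f \<in> borel_measurable (lebesgue_on S \<Otimes>\<^sub>M lebesgue_on R)"
  shows "f \<in> borel_measurable (lebesgue_on (S \<times> R))"
proof -
  have "fst \<in> measurable (lebesgue_on (S \<times> R)) (lebesgue_on S)"
    by (intro measurable_restrict_space2 measurable_restrict_space1 lebesgue_fst) auto
  moreover have "snd \<in> measurable (lebesgue_on (S \<times> R)) (lebesgue_on R)"
    by (intro measurable_restrict_space2 measurable_restrict_space1 lebesgue_snd) auto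
  ultimately have "(\<lambda>z. (fst z, snd z)) \<in> measurable (lebesgue_on (S \<times> R)) (lebesgue_on S \<Otimes>\<^sub>M lebesgue_on R)"
    by (rule measurable_Pair)
  from measurable_compose[OF this assms] show ?thesis
    by simp
qed

lemma AE_lebesgue_on_of_AE_lborel:
  assumes "S \<in> sets lebesgue" "AE x in lborel. P x"
  shows "AE x in lebesgue_on S. P x"
proof -
  have "AE x in lebesgue. x \<in> S \<longrightarrow> P x"
    using AE_completion[OF assms(2)] by eventually_elim simp
  then show ?thesis
    using assms(1) by (subst AE_restrict_space_iff) simp_all
qed

text \<open>A negligible set need not be measurable for the product of the completed measures. It is
  enclosed in a Borel null set, which is, and to which Fubini applies.\<close>

lemma AE_pair_of_negligible:
  fixes S :: "'a::euclidean_space set" and R :: "'b::euclidean_space set"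
  assumes S: "S \<in> lmeasurable" and R: "R \<in> lmeasurable" and Z: "negligible Z"
  shows "AE z in lebesgue_on S \<Otimes>\<^sub>M lebesgue_on R. z \<notin> Z"
proof -
  have "Z \<in> null_sets lebesgue"
    using Z by (simp add: negligible_iff_null_sets)
  then obtain N where N: "N \<in> null_sets lborel" "Z \<subseteq> N"
    unfolding null_sets_completion_iff2 by (elim bexE)
  have N_borel: "N \<in> sets borel"
    using N by auto
  have "AE z in lborel \<Otimes>\<^sub>M lborel. z \<notin> N"
    using N(1) by (simp add: lborel_prod AE_not_in)
  then have "AE x in lborel. AE y in lborel. (x, y) \<notin> N"
    by (rule lborel_pair.AE_pair)
  then have "AE x in lborel. AE y in lebesgue_on R. (x, y) \<notin> N"
    by eventually_elim (rule AE_lebesgue_on_of_AE_lborel[OF fmeasurableD[OF R]])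
  then have AE: "AE x in lebesgue_on S. AE y in lebesgue_on R. (x, y) \<notin> N"
    by (rule AE_lebesgue_on_of_AE_lborel[OF fmeasurableD[OF S]])
  interpret S: finite_measure "lebesgue_on S"
    using S by (rule finite_measure_lebesgue_on)
  interpret R: finite_measure "lebesgue_on R"
    using R by (rule finite_measure_lebesgue_on)
  interpret pair_sigma_finite "lebesgue_on S" "lebesgue_on R" ..
  have "(\<lambda>z. id (fst z)) \<in> borel_measurable (lebesgue_on S \<Otimes>\<^sub>M lebesgue_on R)"
    "(\<lambda>z. id (snd z)) \<in> borel_measurable (lebesgue_on S \<Otimes>\<^sub>M lebesgue_on R)"
    by (rule measurable_compose[OF measurable_fst id_borel_measurable_lebesgue_on]
        measurable_compose[OF measurable_snd id_borel_measurable_lebesgue_on])+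
  then have id: "(\<lambda>z. z) \<in> borel_measurable (lebesgue_on S \<Otimes>\<^sub>M lebesgue_on R)"
    using borel_measurable_Pair[of "\<lambda>z. id (fst z)" _ "\<lambda>z. id (snd z)"] by simp
  have "{z \<in> space (lebesgue_on S \<Otimes>\<^sub>M lebesgue_on R). z \<notin> N} \<in> sets (lebesgue_on S \<Otimes>\<^sub>M lebesgue_on R)"
    using measurable_sets[OF id, of "- N"] N_borel by (simp add: vimage_def Int_def conj_commute)
  from AE_pair_measure[OF this AE] show ?thesis
    by eventually_elim (use N(2) in auto)
qed

subsection \<open>Strong measurability of density evolutions\<close>

lemma Lp_norm_tendsto_0:
  assumes q: "1 \<le> q" and lim: "(\<lambda>n. \<integral>\<^sup>+ x. ennreal (norm (f n x) powr q) \<partial>lebesgue_on \<Omega>) \<longlonglongrightarrow> 0"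
  shows "(\<lambda>n. Lp_norm (ennreal q) \<Omega> (f n)) \<longlonglongrightarrow> 0"
proof -
  define I where "I n = (\<integral>\<^sup>+ x. ennreal (norm (f n x) powr q) \<partial>lebesgue_on \<Omega>)" for n
  have I: "I \<longlonglongrightarrow> 0"
    using lim by (simp add: I_def[abs_def])
  have "\<forall>\<^sub>F n in sequentially. I n < \<infinity>"
    by (rule order_tendstoD(2)[OF I]) simp
  then have eq: "\<forall>\<^sub>F n in sequentially. ennreal (enn2real (I n) powr (1 / q)) = Lp_norm (ennreal q) \<Omega> (f n)"
    by eventually_elim (simp add: Lp_norm_finite_exponent[OF q] Let_def I_def[symmetric] less_top)
  have "(\<lambda>n. enn2real (I n)) \<longlonglongrightarrow> enn2real 0"
    using I by (intro tendsto_enn2real) simp_all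
  then have "(\<lambda>n. enn2real (I n) powr (1 / q)) \<longlonglongrightarrow> 0"
    by (intro tendsto_zero_powrI[OF _ tendsto_const]) (use q in auto)
  then have "(\<lambda>n. ennreal (enn2real (I n) powr (1 / q))) \<longlonglongrightarrow> ennreal 0"
    by (rule tendsto_ennrealI)
  then show ?thesis
    by (simp add: tendsto_cong[OF eq])
qed

lemma nn_integral_powr_tendsto_0:
  fixes f :: "nat \<Rightarrow> 'a \<Rightarrow> real"
  assumes p: "0 < p" and [measurable]: "\<And>n. f n \<in> borel_measurable N" "g \<in> borel_measurable N"
    and lim: "AE x in N. (\<lambda>n. f n x) \<longlonglongrightarrow> 0" and le: "\<And>n x. x \<in> space N \<Longrightarrow> \<bar>f n x\<bar> \<le> g x"
    and g: "(\<integral>\<^sup>+ x. ennreal (g x powr p) \<partial>N) < \<infinity>"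
  shows "(\<lambda>n. \<integral>\<^sup>+ x. ennreal (\<bar>f n x\<bar> powr p) \<partial>N) \<longlonglongrightarrow> 0"
proof -
  have "(\<lambda>n. \<integral>\<^sup>+ x. ennreal (\<bar>f n x\<bar> powr p) \<partial>N) \<longlonglongrightarrow> (\<integral>\<^sup>+ x. 0 \<partial>N)"
  proof (rule nn_integral_dominated_convergence[where w="\<lambda>x. ennreal (g x powr p)"])
    show "AE x in N. ennreal (\<bar>f n x\<bar> powr p) \<le> ennreal (g x powr p)" for n
      using le p by (intro AE_I2 ennreal_leI powr_mono2) auto
    show "AE x in N. (\<lambda>n. ennreal (\<bar>f n x\<bar> powr p)) \<longlonglongrightarrow> 0"
      using lim
    proof eventually_elim
      case (elim x)
      have "(\<lambda>n. \<bar>f n x\<bar> powr p) \<longlonglongrightarrow> 0"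
        by (rule tendsto_zero_powrI[OF tendsto_rabs_zero[OF elim] tendsto_const]) (use p in auto)
      from tendsto_ennrealI[OF this] show ?case
        by simp
    qed
  qed (use g in simp_all)
  then show ?thesis
    by simp
qed

definition cutoff :: "real \<Rightarrow> real \<Rightarrow> real" where
  "cutoff c y = max (- c) (min c y)"

lemma abs_cutoff_le: "0 \<le> c \<Longrightarrow> \<bar>cutoff c y\<bar> \<le> c"
  by (auto simp: cutoff_def)

lemma cutoff_eq: "\<bar>y\<bar> \<le> c \<Longrightarrow> cutoff c y = y"
  by (auto simp: cutoff_def)

lemma abs_diff_cutoff_le: "0 \<le> c \<Longrightarrow> \<bar>y - cutoff c y\<bar> \<le> \<bar>y\<bar>"
  by (auto simp: cutoff_def)

lemma continuous_on_cutoff [continuous_intros]: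
  "continuous_on S f \<Longrightarrow> continuous_on S (\<lambda>x. cutoff c (f x))"
  unfolding cutoff_def by (intro continuous_intros)

lemma cutoff_measurable [measurable]: "cutoff c \<in> borel_measurable borel"
  by (intro borel_measurable_continuous_onI continuous_on_cutoff continuous_on_id)

section \<open>Approximation by functions that are simple in time\<close>

context
  fixes T :: real and \<Omega> :: "'a::euclidean_space set" and p :: real
  assumes T: "0 < T" and \<Omega>: "open \<Omega>" "bounded \<Omega>" and p: "1 \<le> p"
begin

abbreviation (input) "At \<equiv> lebesgue_on {0<..<T}"
abbreviation (input) "Xt \<equiv> lebesgue_on \<Omega>"

lemma finite_At: "finite_measure At" and finite_Xt: "finite_measure Xt"
  and At_lmeasurable: "{0<..<T} \<in> lmeasurable" and Xt_lmeasurable: "\<Omega> \<in> lmeasurable"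
  using \<Omega> by (auto intro!: finite_measure_lebesgue_on lmeasurable_open)

text \<open>The time argument is rounded down to the grid of mesh \<open>1 / n\<close>. Uniform
  continuity on the compact closed cylinder controls the error, and rounding down keeps the grid
  points within \<open>{0..T}\<close>. Since \<open>s\<close> takes only values of \<open>h\<close>,
  it inherits every bound on \<open>h\<close>.\<close>

lemma step_approximation:
  fixes h :: "real \<times> 'a \<Rightarrow> real"
  assumes h: "continuous_on UNIV h" and \<epsilon>: "0 < \<epsilon>"
  shows "\<exists>s. simple_function At s \<and> (\<forall>t. continuous_on UNIV (s t)) \<and> (\<forall>c. (\<forall>z. \<bar>h z\<bar> \<le> c) \<longrightarrow> (\<forall>t x. \<bar>s t x\<bar> \<le> c))
    \<and> (\<forall>t\<in>{0<..<T}. \<forall>x\<in>\<Omega>. \<bar>h (t, x) - s t x\<bar> < \<epsilon>)"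
proof -
  have "compact ({0..T} \<times> closure \<Omega>)"
    using \<Omega> by (intro compact_Times) (auto simp: compact_closure)
  then have "uniformly_continuous_on ({0..T} \<times> closure \<Omega>) h"
    by (intro compact_uniformly_continuous continuous_on_subset[OF h]) auto
  then have "\<exists>\<delta>>0. \<forall>z\<in>{0..T} \<times> closure \<Omega>. \<forall>z'\<in>{0..T} \<times> closure \<Omega>. dist z' z < \<delta> \<longrightarrow> dist (h z') (h z) < \<epsilon>"
    using \<epsilon> unfolding uniformly_continuous_on_def by (elim allE[of _ \<epsilon>] impE)
  then obtain \<delta> where \<delta>: "0 < \<delta>"
    and close: "\<forall>z\<in>{0..T} \<times> closure \<Omega>. \<forall>z'\<in>{0..T} \<times> closure \<Omega>. dist z' z < \<delta> \<longrightarrow> dist (h z') (h z) < \<epsilon>"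
    by (elim exE conjE)
  obtain n0 where "inverse (real (Suc n0)) < \<delta>"
    using reals_Archimedean[OF \<delta>] by blast
  define n where "n = Suc n0"
  have n: "0 < n" "1 / real n < \<delta>"
    using \<open>inverse (real (Suc n0)) < \<delta>\<close> by (simp_all only: n_def inverse_eq_divide zero_less_Suc)
  define k where "k t = \<lfloor>t * real n\<rfloor>" for t :: real
  define s where "s t x = h (real_of_int (k t) / real n, x)" for t x
  have k: "0 \<le> real_of_int (k t) / n" "real_of_int (k t) / n \<le> t" "t - real_of_int (k t) / n < 1 / n" if "0 < t" for t
  proof -
    have "0 \<le> real_of_int (k t)" "real_of_int (k t) \<le> t * n" "t * n < real_of_int (k t) + 1"
      using that by (simp_all add: k_def)
    moreover from this have "(t * n - real_of_int (k t)) / n < 1 / n"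
      using n(1) by (intro divide_strict_right_mono) simp_all
    moreover have "t - real_of_int (k t) / n = (t * n - real_of_int (k t)) / n"
      using n(1) by (simp add: diff_divide_distrib)
    ultimately show "0 \<le> real_of_int (k t) / n" "real_of_int (k t) / n \<le> t" "t - real_of_int (k t) / n < 1 / n"
      using n(1) by (simp_all add: divide_le_eq)
  qed
  have "simple_function At k"
    unfolding simple_function_def
  proof
    have "k ` space At \<subseteq> {0..\<lfloor>T * real n\<rfloor>}"
      using n(1) by (auto simp: k_def intro!: floor_mono mult_right_mono)
    then show "finite (k ` space At)"
      by (rule finite_subset) simp
    have "(\<lambda>t. id t * real n) \<in> borel_measurable At"
      by (intro borel_measurable_times borel_measurable_const id_borel_measurable_lebesgue_on)
    then have "k \<in> measurable At (count_space UNIV)"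
      unfolding k_def id_def by measurable
    then have "k -` {j} \<inter> space At \<in> sets At" for j
      by (rule measurable_sets) simp
    then show "\<forall>j\<in>k ` space At. k -` {j} \<inter> space At \<in> sets At"
      by (intro ballI)
  qed
  \<comment> \<open>The step function depends on \<open>t\<close> only through the integer
    \<open>k t\<close>, which takes finitely many values.\<close>
  then have "simple_function At (\<lambda>t. (\<lambda>j x. h (real_of_int j / real n, x)) (k t))"
    by (rule simple_function_compose1)
  then have "simple_function At s"
    by (simp add: s_def[abs_def])
  moreover have "continuous_on UNIV (s t)" for t
    unfolding s_def[abs_def] by (intro continuous_on_compose2[OF h] continuous_intros) auto
  moreover have "\<bar>h (t, x) - s t x\<bar> < \<epsilon>" if "t \<in> {0<..<T}" "x \<in> \<Omega>" for t x
  proof -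
    have "dist (t, x) (real_of_int (k t) / n, x) < \<delta>"
      using k[of t] that n by (simp add: dist_Pair_Pair dist_real_def)
    moreover have "x \<in> closure \<Omega>"
      using that closure_subset by blast
    ultimately have "dist (h (t, x)) (h (real_of_int (k t) / n, x)) < \<epsilon>"
      using k[of t] that by (intro close[rule_format]) auto
    then show ?thesis
      by (simp add: s_def dist_real_def)
  qed
  moreover have "(\<forall>z. \<bar>h z\<bar> \<le> c) \<longrightarrow> (\<forall>t x. \<bar>s t x\<bar> \<le> c)" for c
    by (simp add: s_def)
  ultimately show ?thesis
    by (intro exI[of _ s] conjI ballI allI)
qed

text \<open>Three approximations are chained: \<open>F\<close> by a bounded truncation, the
  truncation by a continuous function, and that by a step function in time with continuous
  values.\<close>

lemma simple_approximation:
  fixes F :: "real \<times> 'a \<Rightarrow> real"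
  assumes F: "F \<in> borel_measurable (At \<Otimes>\<^sub>M Xt)"
    and fin: "(\<integral>\<^sup>+ z. ennreal (\<bar>F z\<bar> powr p) \<partial>(At \<Otimes>\<^sub>M Xt)) < \<infinity>" and \<epsilon>: "0 < \<epsilon>"
  shows "\<exists>s. simple_function At s \<and> (\<forall>t. s t \<in> Lp_space (ennreal p) \<Omega>) \<and>
    (\<integral>\<^sup>+ z. ennreal (\<bar>F z - s (fst z) (snd z)\<bar> powr p) \<partial>(At \<Otimes>\<^sub>M Xt)) < ennreal \<epsilon>"
proof -
  let ?M = "At \<Otimes>\<^sub>M Xt"
  interpret A: finite_measure At
    by (rule finite_At)
  interpret X: finite_measure Xt
    by (rule finite_Xt)
  interpret M: finite_measure ?M
    by (rule finite_measure_pair_measure) unfold_locales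
  note [measurable] = F
  have p0: "0 < p"
    using p by simp
  have space_M: "space ?M = {0<..<T} \<times> \<Omega>"
    by (simp add: space_pair_measure)
  define I where "I f = (\<integral>\<^sup>+ z. ennreal (\<bar>f z\<bar> powr p) \<partial>?M)" for f :: "real \<times> 'a \<Rightarrow> real"
  \<comment> \<open>Two uses of the triangle inequality turn three errors of size \<eta> into
    \<open>2 powr p * \<eta> + 4 powr p * (2 * \<eta>)\<close>, which is less than
    \<open>3 * 4 powr p * \<eta> = \<epsilon>\<close>.\<close>
  define \<eta> where "\<eta> = \<epsilon> / (3 * 4 powr p)"
  have \<eta>: "0 < \<eta>"
    using \<epsilon> by (simp add: \<eta>_def)
  have const_fin: "(\<integral>\<^sup>+ z. ennreal (c powr p) \<partial>?M) < \<infinity>" for c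
    using M.emeasure_finite[of "space ?M", unfolded less_top] by (simp add: ennreal_mult_less_top)
  have "(\<lambda>n. I (\<lambda>z. F z - cutoff (real n) (F z))) \<longlonglongrightarrow> 0"
    unfolding I_def
  proof (rule nn_integral_powr_tendsto_0[OF p0, where g="\<lambda>z. \<bar>F z\<bar>"])
    show "AE z in ?M. (\<lambda>n. F z - cutoff (real n) (F z)) \<longlonglongrightarrow> 0"
    proof (rule AE_I2)
      fix z
      obtain m :: nat where "\<bar>F z\<bar> \<le> real m"
        using real_arch_simple by blast
      then have "\<forall>\<^sub>F n in sequentially. F z - cutoff (real n) (F z) = 0"
        unfolding eventually_sequentially by (intro exI[of _ m]) (auto simp: cutoff_eq)
      then show "(\<lambda>n. F z - cutoff (real n) (F z)) \<longlonglongrightarrow> 0"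
        by (rule tendsto_eventually)
    qed
    show "\<bar>F z - cutoff (real n) (F z)\<bar> \<le> \<bar>F z\<bar>" for n z
      by (rule abs_diff_cutoff_le) simp
  qed (use fin in simp_all)
  then have "\<forall>\<^sub>F n in sequentially. I (\<lambda>z. F z - cutoff (real n) (F z)) < ennreal \<eta>"
    by (rule order_tendstoD(2)) (use \<eta> in \<open>simp only: ennreal_less_zero_iff\<close>)
  from eventually_happens'[OF sequentially_bot this] obtain n where n: "I (\<lambda>z. F z - cutoff (real n) (F z)) < ennreal \<eta>" ..
  define c where "c = real n"
  \<comment> \<open>Lebesgue measurability supplies continuous functions converging to
    \<open>F\<close> almost everywhere on the cylinder. Truncating them at the same level gives a
    constant majorant on a space of finite measure.\<close>
  have "F measurable_on ({0<..<T} \<times> \<Omega>)"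
  proof (subst measurable_on_iff_borel_measurable)
    show "{0<..<T} \<times> \<Omega> \<in> sets lebesgue"
      using \<Omega>(1) by (intro sets_completionI_sets) (simp add: open_Times)
    show "F \<in> borel_measurable (lebesgue_on ({0<..<T} \<times> \<Omega>))"
      using F by (rule lebesgue_on_Times_measurable)
  qed
  then obtain Z g where Z: "negligible Z" and g: "\<forall>n. continuous_on UNIV (g n)"
    and lim: "\<forall>z. z \<notin> Z \<longrightarrow> (\<lambda>n. g n z) \<longlonglongrightarrow> (if z \<in> {0<..<T} \<times> \<Omega> then F z else 0)"
    unfolding measurable_on_def by (elim exE conjE)
  have g_lim: "(\<lambda>n. g n z) \<longlonglongrightarrow> F z" if "z \<notin> Z" "z \<in> {0<..<T} \<times> \<Omega>" for z
    using lim[rule_format, OF that(1)] unfolding if_P[OF that(2)] .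
  have g_cutoff: "continuous_on UNIV (\<lambda>z. cutoff c (g n z))" for n
    by (rule continuous_on_cutoff[OF g[rule_format]])
  have cont_meas: "f \<in> borel_measurable ?M" if f: "continuous_on UNIV f" for f :: "real \<times> 'a \<Rightarrow> real"
  proof -
    have "(\<lambda>z. id (fst z)) \<in> borel_measurable ?M" "(\<lambda>z. id (snd z)) \<in> borel_measurable ?M"
      by (rule measurable_compose[OF measurable_fst id_borel_measurable_lebesgue_on]
          measurable_compose[OF measurable_snd id_borel_measurable_lebesgue_on])+
    then have "(\<lambda>z. z) \<in> borel_measurable ?M"
      using borel_measurable_Pair[of "\<lambda>z. id (fst z)" ?M "\<lambda>z. id (snd z)"] by simp
    from measurable_compose[OF this borel_measurable_continuous_onI[OF f]] show ?thesis .
  qed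
  note [measurable] = cont_meas[OF g_cutoff]
  have "(\<lambda>n. I (\<lambda>z. cutoff c (F z) - cutoff c (g n z))) \<longlonglongrightarrow> 0"
    unfolding I_def
  proof (rule nn_integral_powr_tendsto_0[OF p0, where g="\<lambda>z. 2 * c"])
    show "AE z in ?M. (\<lambda>n. cutoff c (F z) - cutoff c (g n z)) \<longlonglongrightarrow> 0"
      using AE_pair_of_negligible[OF At_lmeasurable Xt_lmeasurable Z] AE_space
    proof eventually_elim
      case (elim z)
      then have "(\<lambda>n. g n z) \<longlonglongrightarrow> F z"
        unfolding space_M by (rule g_lim)
      then have "(\<lambda>n. cutoff c (g n z)) \<longlonglongrightarrow> cutoff c (F z)"
        unfolding cutoff_def by (intro tendsto_intros)
      from tendsto_diff[OF tendsto_const this] show ?case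
        by (metis cancel_comm_monoid_add_class.diff_cancel)
    qed
    show "\<bar>cutoff c (F z) - cutoff c (g n z)\<bar> \<le> 2 * c" for n z
      using abs_cutoff_le[of c "F z"] abs_cutoff_le[of c "g n z"] by (simp add: c_def)
  qed (use const_fin in simp_all)
  then have "\<forall>\<^sub>F n in sequentially. I (\<lambda>z. cutoff c (F z) - cutoff c (g n z)) < ennreal \<eta>"
    by (rule order_tendstoD(2)) (use \<eta> in \<open>simp only: ennreal_less_zero_iff\<close>)
  from eventually_happens'[OF sequentially_bot this] obtain m where m: "I (\<lambda>z. cutoff c (F z) - cutoff c (g m z)) < ennreal \<eta>" ..
  define h where "h z = cutoff c (g m z)" for z
  have h_cont: "continuous_on UNIV h"
    unfolding h_def[abs_def] by (rule g_cutoff)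
  have h_bd: "\<bar>h z\<bar> \<le> c" for z
    unfolding h_def by (rule abs_cutoff_le) (simp add: c_def)
  define b where "b = measure ?M (space ?M)"
  \<comment> \<open>A uniform error \<delta> then costs at most
    \<open>\<eta> / (b + 1) * b \<le> \<eta>\<close>; the added 1 guards against
    \<open>b = 0\<close>.\<close>
  define \<delta> where "\<delta> = (\<eta> / (b + 1)) powr (1 / p)"
  have b: "0 \<le> b"
    by (simp add: b_def)
  have \<delta>: "0 < \<delta>"
    using \<eta> b by (simp add: \<delta>_def)
  obtain s where s: "simple_function At s" "\<forall>t. continuous_on UNIV (s t)" "\<forall>t x. \<bar>s t x\<bar> \<le> c"
    and hs: "\<forall>t\<in>{0<..<T}. \<forall>x\<in>\<Omega>. \<bar>h (t, x) - s t x\<bar> < \<delta>"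
  proof -
    obtain s where "simple_function At s" "\<forall>t. continuous_on UNIV (s t)"
      "\<forall>c. (\<forall>z. \<bar>h z\<bar> \<le> c) \<longrightarrow> (\<forall>t x. \<bar>s t x\<bar> \<le> c)" "\<forall>t\<in>{0<..<T}. \<forall>x\<in>\<Omega>. \<bar>h (t, x) - s t x\<bar> < \<delta>"
      using step_approximation[OF h_cont \<delta>] by (elim exE conjE)
    then show ?thesis
      using h_bd by (intro that[of s]) simp_all
  qed
  have s_slice: "s t \<in> borel_measurable Xt" for t
    using \<Omega>(1) continuous_on_subset[OF s(2)[rule_format, of t], of \<Omega>]
    by (intro continuous_imp_measurable_on_sets_lebesgue) auto
  have [measurable]: "(\<lambda>z. s (fst z) (snd z)) \<in> borel_measurable ?M"
    by (rule simple_function_pair_measurable[OF s(1) s_slice])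
  have [measurable]: "h \<in> borel_measurable ?M"
    by (rule cont_meas[OF h_cont])
  have s_Lp: "s t \<in> Lp_space (ennreal p) \<Omega>" for t
  proof -
    have "(\<integral>\<^sup>+ x. ennreal (norm (s t x) powr p) \<partial>Xt) \<le> (\<integral>\<^sup>+ x. ennreal (c powr p) \<partial>Xt)"
      using s(3) p0 by (intro nn_integral_mono ennreal_leI powr_mono2) auto
    also have "\<dots> < \<infinity>"
      using X.emeasure_finite[of "space Xt", unfolded less_top] by (simp add: ennreal_mult_less_top)
    finally show ?thesis
      using s_slice Lp_norm_finite_iff[OF p, of \<Omega> "s t"] by (simp add: Lp_space_def)
  qed
  have I_hs: "I (\<lambda>z. h z - s (fst z) (snd z)) \<le> ennreal \<eta>"
  proof -
    have "I (\<lambda>z. h z - s (fst z) (snd z)) \<le> (\<integral>\<^sup>+ z. ennreal (\<delta> powr p) \<partial>?M)"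
      unfolding I_def
    proof (rule nn_integral_mono)
      fix z assume "z \<in> space ?M"
      then have "\<bar>h (fst z, snd z) - s (fst z) (snd z)\<bar> \<le> \<delta>"
        using hs unfolding space_M by (intro less_imp_le) auto
      then show "ennreal (\<bar>h z - s (fst z) (snd z)\<bar> powr p) \<le> ennreal (\<delta> powr p)"
        using p0 by (intro ennreal_leI powr_mono2) auto
    qed
    also have "\<dots> = ennreal (\<delta> powr p * b)"
      by (simp add: b_def M.emeasure_eq_measure ennreal_mult)
    also have "\<delta> powr p = \<eta> / (b + 1)"
      using \<eta> b p0 by (simp add: \<delta>_def powr_powr)
    also have "\<eta> / (b + 1) * b \<le> \<eta>"
      using \<eta> b by (simp add: divide_le_eq)
    finally show ?thesis
      using \<eta> by (simp add: ennreal_leI)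
  qed
  have I_tri: "I (\<lambda>z. f z - k z) \<le> ennreal (2 powr p) * (I (\<lambda>z. f z - l z) + I (\<lambda>z. l z - k z))"
    if "f \<in> borel_measurable ?M" "k \<in> borel_measurable ?M" "l \<in> borel_measurable ?M" for f k l
    using nn_integral_powr_triangle[of p f ?M l k] that p0 by (simp add: I_def)
  have "I (\<lambda>z. F z - s (fst z) (snd z))
    \<le> ennreal (2 powr p) * (I (\<lambda>z. F z - cutoff c (F z)) + I (\<lambda>z. cutoff c (F z) - s (fst z) (snd z)))"
    by (intro I_tri) measurable
  also have "\<dots> \<le> ennreal (2 powr p) * (ennreal \<eta> + ennreal (2 powr p) * (ennreal \<eta> + ennreal \<eta>))"
  proof (intro mult_left_mono add_mono)
    show "I (\<lambda>z. F z - cutoff c (F z)) \<le> ennreal \<eta>"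
      using n by (simp add: c_def)
    have "I (\<lambda>z. cutoff c (F z) - s (fst z) (snd z))
      \<le> ennreal (2 powr p) * (I (\<lambda>z. cutoff c (F z) - h z) + I (\<lambda>z. h z - s (fst z) (snd z)))"
      by (intro I_tri) measurable
    also have "\<dots> \<le> ennreal (2 powr p) * (ennreal \<eta> + ennreal \<eta>)"
      using m I_hs by (intro mult_left_mono add_mono) (simp_all add: h_def)
    finally show "I (\<lambda>z. cutoff c (F z) - s (fst z) (snd z)) \<le> ennreal (2 powr p) * (ennreal \<eta> + ennreal \<eta>)" .
  qed simp
  also have "\<dots> = ennreal (2 powr p * (\<eta> + 2 powr p * (\<eta> + \<eta>)))"
  proof -
    have nn: "0 \<le> \<eta>" "0 \<le> 2 powr p * (\<eta> + \<eta>)" "0 \<le> \<eta> + \<eta>" "0 \<le> \<eta> + 2 powr p * (\<eta> + \<eta>)" "0 \<le> 2 powr p"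
      using \<eta> by simp_all
    show ?thesis
      by (simp only: ennreal_plus[OF nn(1) nn(1)] ennreal_mult[OF nn(5) nn(3)]
          ennreal_plus[OF nn(1) nn(2)] ennreal_mult[OF nn(5) nn(4)])
  qed
  also have "\<dots> < ennreal \<epsilon>"
  proof -
    have four: "4 powr p = 2 powr p * 2 powr p"
      by (simp flip: powr_mult)
    have one: "1 < 2 powr p"
      using p0 by simp
    have "2 powr p * (\<eta> + 2 powr p * (\<eta> + \<eta>)) = 2 powr p * \<eta> + 4 powr p * (2 * \<eta>)"
      by (simp add: four algebra_simps)
    also have "2 powr p * \<eta> < 4 powr p * \<eta>"
      using \<eta> one by (simp add: four)
    also have "4 powr p * \<eta> + 4 powr p * (2 * \<eta>) = \<epsilon>"
      by (simp add: \<eta>_def field_simps)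
    finally show ?thesis
      using \<epsilon> by (simp add: ennreal_less_iff \<eta> less_imp_le)
  qed
  finally show ?thesis
    using s(1) s_Lp by (auto simp: I_def)
qed

text \<open>Space-time approximants with errors below \<open>(1 / 2) ^ k\<close> have summable
  errors, so the spatial errors are summable, and hence tend to 0, at almost every time.\<close>

lemma bochner_measurable_Lp:
  fixes \<rho> :: "real \<times> 'a \<Rightarrow> real"
  assumes \<rho>[measurable]: "\<rho> \<in> borel_measurable (At \<Otimes>\<^sub>M Xt)"
    and fin: "(\<integral>\<^sup>+ z. ennreal (\<bar>\<rho> z\<bar> powr p) \<partial>(At \<Otimes>\<^sub>M Xt)) < \<infinity>"
    and slice: "AE t in At. (\<lambda>x. \<rho> (t, x)) \<in> Lp_space (ennreal p) \<Omega>"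
  shows "bochner_measurable T (Lp_space (ennreal p) \<Omega>) (Lp_norm (ennreal p) \<Omega>) (\<lambda>t x. \<rho> (t, x))"
proof -
  let ?M = "At \<Otimes>\<^sub>M Xt"
  interpret X: finite_measure Xt
    by (rule finite_Xt)
  have "\<forall>k. \<exists>s. simple_function At s \<and> (\<forall>t. s t \<in> Lp_space (ennreal p) \<Omega>) \<and>
    (\<integral>\<^sup>+ z. ennreal (\<bar>\<rho> z - s (fst z) (snd z)\<bar> powr p) \<partial>?M) < ennreal ((1 / 2) ^ k)"
    using simple_approximation[OF \<rho> fin] by simp
  from choice[OF this] obtain s where "\<forall>k. simple_function At (s k) \<and> (\<forall>t. s k t \<in> Lp_space (ennreal p) \<Omega>) \<and>
    (\<integral>\<^sup>+ z. ennreal (\<bar>\<rho> z - s k (fst z) (snd z)\<bar> powr p) \<partial>?M) < ennreal ((1 / 2) ^ k)" ..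
  then have s: "\<And>k. simple_function At (s k)" "\<And>k t. s k t \<in> Lp_space (ennreal p) \<Omega>"
    and close: "\<And>k. (\<integral>\<^sup>+ z. ennreal (\<bar>\<rho> z - s k (fst z) (snd z)\<bar> powr p) \<partial>?M) < ennreal ((1 / 2) ^ k)"
    by simp_all
  have [measurable]: "(\<lambda>z. s k (fst z) (snd z)) \<in> borel_measurable ?M" for k
    using s by (intro simple_function_pair_measurable) (auto simp: Lp_space_def)
  define I where "I k t = (\<integral>\<^sup>+ x. ennreal (\<bar>\<rho> (t, x) - s k t x\<bar> powr p) \<partial>Xt)" for k t
  have I_meas[measurable]: "I k \<in> borel_measurable At" for k
    unfolding I_def by (rule X.borel_measurable_nn_integral) (simp add: case_prod_beta')
  have I_int: "(\<integral>\<^sup>+ t. I k t \<partial>At) \<le> ennreal ((1 / 2) ^ k)" for k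
    using X.nn_integral_fst[of "\<lambda>z. ennreal (\<bar>\<rho> z - s k (fst z) (snd z)\<bar> powr p)" At] close[of k]
    by (simp add: I_def)
  have "(\<integral>\<^sup>+ t. (\<Sum>k. I k t) \<partial>At) = (\<Sum>k. \<integral>\<^sup>+ t. I k t \<partial>At)"
    by (rule nn_integral_suminf) simp
  also have "\<dots> \<le> (\<Sum>k. ennreal ((1 / 2) ^ k))"
    using I_int by (intro suminf_le) auto
  also have "\<dots> = ennreal (\<Sum>k. (1 / 2) ^ k)"
    by (intro suminf_ennreal2 summable_geometric) simp_all
  also have "\<dots> < \<infinity>"
    by simp
  finally have "AE t in At. (\<Sum>k. I k t) \<noteq> \<infinity>"
    by (intro nn_integral_noteq_infinite) simp_all
  then have "AE t in At. (\<lambda>k. Lp_norm (ennreal p) \<Omega> ((\<lambda>x. \<rho> (t, x)) - s k t)) \<longlonglongrightarrow> 0"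
  proof eventually_elim
    case (elim t)
    have I_fin: "I k t < \<infinity>" for k
      using elim by (metis ennreal_suminf_lessD less_top infinity_ennreal_def)
    then have I_eq: "ennreal (enn2real (I k t)) = I k t" for k
      by simp
    have "summable (\<lambda>k. enn2real (I k t))"
      using elim by (intro summable_suminf_not_top) (simp_all add: I_eq)
    from tendsto_ennrealI[OF summable_LIMSEQ_zero[OF this]] have "(\<lambda>k. I k t) \<longlonglongrightarrow> 0"
      by (simp add: I_eq)
    then show ?case
      by (intro Lp_norm_tendsto_0[OF p]) (simp add: I_def)
  qed
  then have "\<exists>s. (\<forall>n. simple_function At (s n) \<and> (\<forall>t\<in>{0<..<T}. s n t \<in> Lp_space (ennreal p) \<Omega>)) \<and>
    (AE t in At. (\<lambda>n::nat. Lp_norm (ennreal p) \<Omega> ((\<lambda>x. \<rho> (t, x)) - s n t)) \<longlonglongrightarrow> 0)"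
    using s by (intro exI[of _ s] conjI allI ballI)
  with slice show ?thesis
    unfolding bochner_measurable_def by (rule conjI)
qed

end

subsection \<open>Existence of weak solutions\<close>

text \<open>Measurability of \<open>f\<close> is a consequence of completeness. This matters when
  \<open>u\<close> is exchanged for \<open>w\<close> in the weak formulation, where nothing is known
  beforehand about the integrands containing \<open>u\<close>.\<close>

lemma integral_cong_lebesgue_on_AE:
  fixes f g :: "'a::euclidean_space \<Rightarrow> real"
  assumes S: "S \<in> sets lebesgue" and g: "g \<in> borel_measurable (lebesgue_on S)"
    and eq: "AE x in lebesgue_on S. f x = g x"
  shows "(LINT x|lebesgue_on S. f x) = (LINT x|lebesgue_on S. g x)"
proof -
  obtain N where N: "N \<in> null_sets (lebesgue_on S)" "{x \<in> space (lebesgue_on S). f x \<noteq> g x} \<subseteq> N"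
    using eq unfolding eventually_ae_filter by (elim bexE)
  have "negligible N"
    using N(1) S by (simp add: negligible_iff_null_sets null_sets_restrict_space)
  have "g measurable_on S"
    using g S by (simp add: measurable_on_iff_borel_measurable)
  then have "f measurable_on S"
    by (rule measurable_on_spike[OF _ \<open>negligible N\<close>]) (use N(2) in auto)
  then have "f \<in> borel_measurable (lebesgue_on S)"
    using S by (simp add: measurable_on_iff_borel_measurable)
  then show ?thesis
    using g eq by (rule integral_cong_AE)
qed

context velocity
begin

text \<open>The disjunction records the bound on the density in the two forms that arise, pointwise
  for \<open>p = \<infinity>\<close> and slice by slice for finite \<open>p\<close>, so that the
  splitting of the initial density into its parts can be done once for all exponents.\<close>

theorem ex_density_transported:
  fixes r :: "'a \<Rightarrow> real"
  assumes p: "1 < p" "1 / p + 1 / ennreal q = 1" and r: "r \<in> Lp_space p \<Omega>" and r_nn: "\<And>x. 0 \<le> r x"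
  shows "\<exists>\<rho>\<in>borel_measurable M. (\<forall>z. 0 \<le> \<rho> z) \<and> (\<forall>g\<in>V. integrable M (\<lambda>z. \<rho> z * g z)) \<and>
    (\<forall>\<phi>\<in>spacetime_test_functions T \<Omega>. integrable X (\<lambda>x. r x * \<phi> (0, x)) \<and>
       (LINT z|M. \<rho> z * transport \<phi> z) = (LINT x|X. r x * \<phi> (0, x))) \<and>
    (\<exists>C\<ge>0. (p = \<infinity> \<and> (AE z in M. \<rho> z \<le> C)) \<or>
      (\<exists>p'\<ge>1. p = ennreal p' \<and> (AE t in A. (\<integral>\<^sup>+ x. ennreal (\<rho> (t, x) powr p') \<partial>X) \<le> ennreal (C powr p'))))"
proof -
  have r_meas: "r \<in> borel_measurable X"
    using r by (simp add: Lp_space_def)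
  have exponents: "(p = \<infinity> \<and> q = 1) \<or> (1 < q \<and> p = ennreal (q / (q - 1)))"
  proof (rule conjugate_exponent_cases[OF p])
    assume "p = \<infinity>" "ennreal q = ennreal 1"
    then show ?thesis
      using q by (simp add: ennreal_inj)
  next
    fix q' assume "1 < q'" "ennreal q = ennreal q'" "p = ennreal (q' / (q' - 1))"
    then show ?thesis
      using q by (simp add: ennreal_inj)
  qed
  have "\<exists>C\<ge>0. \<forall>h :: 'a \<Rightarrow> real. h \<in> borel_measurable X \<longrightarrow> (\<forall>x. 0 \<le> h x) \<longrightarrow> integrable X (\<lambda>x. h x powr q) \<longrightarrow>
      integrable X (\<lambda>x. r x * h x) \<and> (LINT x|X. r x * h x) \<le> C * lnorm q X h"
    using exponents
  proof
    assume *: "p = \<infinity> \<and> q = 1"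
    then show ?thesis
      using Lp_pairing_bound_infinity[of r \<Omega> r, OF _ r_meas r_nn] r by simp
  next
    assume *: "1 < q \<and> p = ennreal (q / (q - 1))"
    then show ?thesis
      using Lp_pairing_bound[of q _ r \<Omega> r, OF _ refl _ r_meas r_nn] r by simp
  qed
  then obtain C where C: "0 \<le> C" and bound: "\<forall>h :: 'a \<Rightarrow> real. h \<in> borel_measurable X \<longrightarrow> (\<forall>x. 0 \<le> h x) \<longrightarrow>
      integrable X (\<lambda>x. h x powr q) \<longrightarrow> integrable X (\<lambda>x. r x * h x) \<and> (LINT x|X. r x * h x) \<le> C * lnorm q X h"
    by (elim exE conjE)
  have bound': "integrable X (\<lambda>x. r x * h x) \<and> (LINT x|X. r x * h x) \<le> C * lnorm q X h"
    if "h \<in> borel_measurable X" "\<And>x. 0 \<le> h x" "integrable X (\<lambda>x. h x powr q)" for h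
    using bound that by simp
  have "\<exists>\<rho>\<in>borel_measurable M. (\<forall>z. 0 \<le> \<rho> z) \<and>
    (\<forall>g\<in>V. integrable M (\<lambda>z. \<rho> z * g z) \<and> (LINT z|M. \<rho> z * g z) \<le> (C * q) * N g) \<and>
    (\<forall>\<phi>\<in>spacetime_test_functions T \<Omega>. integrable X (\<lambda>x. r x * \<phi> (0, x)) \<and>
      (LINT z|M. \<rho> z * transport \<phi> z) = (LINT x|X. r x * \<phi> (0, x)))"
    using r_nn C bound' by (rule ex_nonneg_solution)
  then obtain \<rho> where \<rho>: "\<rho> \<in> borel_measurable M" "\<forall>z. 0 \<le> \<rho> z"
    and V_\<rho>: "\<forall>g\<in>V. integrable M (\<lambda>z. \<rho> z * g z) \<and> (LINT z|M. \<rho> z * g z) \<le> (C * q) * N g"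
    and eq: "\<forall>\<phi>\<in>spacetime_test_functions T \<Omega>. integrable X (\<lambda>x. r x * \<phi> (0, x)) \<and>
      (LINT z|M. \<rho> z * transport \<phi> z) = (LINT x|X. r x * \<phi> (0, x))"
    by (elim bexE conjE)
  have Cq: "0 \<le> C * q"
    using C q_pos by simp
  have "(p = \<infinity> \<and> (AE z in M. \<rho> z \<le> C * q)) \<or>
      (\<exists>p'\<ge>1. p = ennreal p' \<and> (AE t in A. (\<integral>\<^sup>+ x. ennreal (\<rho> (t, x) powr p') \<partial>X) \<le> ennreal ((C * q) powr p')))"
    using exponents
  proof
    assume *: "p = \<infinity> \<and> q = 1"
    have "AE z in M. \<rho> z \<le> C * q"
    proof (rule density_bound_infinity[OF _ \<rho>(1)])
      fix g assume g: "g \<in> V"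
      show "integrable M (\<lambda>z. \<rho> z * g z)" "(LINT z|M. \<rho> z * g z) \<le> (C * q) * N g"
        using bspec[OF V_\<rho> g] by simp_all
    qed (use * in simp)
    then show ?thesis
      using * by (intro disjI1 conjI) simp_all
  next
    assume *: "1 < q \<and> p = ennreal (q / (q - 1))"
    have "AE t in A. (\<integral>\<^sup>+ x. ennreal (\<rho> (t, x) powr (q / (q - 1))) \<partial>X) \<le> ennreal ((C * q) powr (q / (q - 1)))"
    proof (rule density_bound[OF _ \<rho>(1) \<rho>(2)[rule_format] Cq _ _ refl])
      fix g assume g: "g \<in> V"
      show "integrable M (\<lambda>z. \<rho> z * g z)" "(LINT z|M. \<rho> z * g z) \<le> (C * q) * N g"
        using bspec[OF V_\<rho> g] by simp_all
    qed (use * in simp)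
    moreover have "1 \<le> q / (q - 1)" "p = ennreal (q / (q - 1))"
      using * by simp_all
    ultimately show ?thesis
      by (intro disjI2 exI[of _ "q / (q - 1)"] conjI)
  qed
  then have C_ex: "\<exists>C\<ge>0. (p = \<infinity> \<and> (AE z in M. \<rho> z \<le> C)) \<or>
      (\<exists>p'\<ge>1. p = ennreal p' \<and> (AE t in A. (\<integral>\<^sup>+ x. ennreal (\<rho> (t, x) powr p') \<partial>X) \<le> ennreal (C powr p')))"
    using Cq by (intro exI[of _ "C * q"] conjI)
  show ?thesis
    using \<rho>(2) V_\<rho> eq C_ex by (intro bexI[OF _ \<rho>(1)] conjI) simp_all
qed

text \<open>The equation is linear in the density together with its initial value, so the solutions
  for the positive and the negative part of \<rho>0 are subtracted.\<close>

theorem ex_weak_solution: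
  fixes \<rho>0 :: "'a \<Rightarrow> real"
  assumes p: "1 < p" "1 / p + 1 / ennreal q = 1" and \<rho>0: "\<rho>0 \<in> Lp_space p \<Omega>"
    and u: "AE t in A. u t \<in> borel_measurable X \<and> (AE x in X. w t x = u t x)"
  shows "\<exists>\<rho>. \<rho> \<in> Linf_time_Lp T p \<Omega> \<and> transport_weak_solution T p \<Omega> u \<rho>0 \<rho>"
proof -
  have \<rho>0_meas[measurable]: "\<rho>0 \<in> borel_measurable X"
    using \<rho>0 by (simp add: Lp_space_def)
  have Lp_part: "(\<lambda>x. max 0 (c * \<rho>0 x)) \<in> Lp_space p \<Omega>" if c: "\<bar>c\<bar> = 1" for c
  proof -
    have le: "norm (max 0 (c * \<rho>0 x)) \<le> norm (\<rho>0 x)" for x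
      using c by (auto simp: max_def abs_mult abs_if split: if_splits)
    have "Lp_norm p \<Omega> (\<lambda>x. max 0 (c * \<rho>0 x)) < \<infinity>"
    proof (cases "p = \<infinity>")
      case True
      have "esssup X (\<lambda>x. ennreal (norm (max 0 (c * \<rho>0 x)))) \<le> esssup X (\<lambda>x. ennreal (norm (\<rho>0 x)))"
        by (rule esssup_mono) (use le in \<open>auto intro!: ennreal_leI\<close>)
      also have "\<dots> < \<infinity>"
        using \<rho>0 True by (simp add: Lp_space_def Lp_norm_def)
      finally show ?thesis
        using True by (simp add: Lp_norm_def)
    next
      case False
      then obtain p' where p': "p = ennreal p'" "1 \<le> p'"
        using p(1) by (cases p) auto
      have "(\<integral>\<^sup>+ x. ennreal (norm (max 0 (c * \<rho>0 x)) powr p') \<partial>X) \<le> (\<integral>\<^sup>+ x. ennreal (norm (\<rho>0 x) powr p') \<partial>X)"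
        using le p'(2) by (intro nn_integral_mono ennreal_leI powr_mono2) auto
      also have "\<dots> < \<infinity>"
        using \<rho>0 Lp_norm_finite_iff[OF p'(2), of \<Omega> \<rho>0] p'(1) by (simp add: Lp_space_def)
      finally show ?thesis
        using Lp_norm_finite_iff[OF p'(2), of \<Omega> "\<lambda>x. max 0 (c * \<rho>0 x)"] p'(1) by simp
    qed
    then show ?thesis
      by (simp add: Lp_space_def)
  qed
  define r1 where "r1 x = max 0 (1 * \<rho>0 x)" for x
  define r2 where "r2 x = max 0 (- 1 * \<rho>0 x)" for x
  have r_diff: "\<rho>0 x = r1 x - r2 x" for x
    by (simp add: r1_def r2_def)
  have r1: "r1 \<in> Lp_space p \<Omega>" "\<And>x. 0 \<le> r1 x"
    unfolding r1_def[abs_def] by (rule Lp_part) simp_all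
  have r2: "r2 \<in> Lp_space p \<Omega>" "\<And>x. 0 \<le> r2 x"
    unfolding r2_def[abs_def] by (rule Lp_part) simp_all
  let ?F = "spacetime_test_functions T \<Omega>"
  obtain \<rho>1 where \<rho>1[measurable]: "\<rho>1 \<in> borel_measurable M" and \<rho>1_nn: "\<forall>z. 0 \<le> \<rho>1 z"
    and \<rho>1_V: "\<forall>g\<in>V. integrable M (\<lambda>z. \<rho>1 z * g z)"
    and \<rho>1_eq: "\<forall>\<phi>\<in>?F. integrable X (\<lambda>x. r1 x * \<phi> (0, x)) \<and> (LINT z|M. \<rho>1 z * transport \<phi> z) = (LINT x|X. r1 x * \<phi> (0, x))"
    and \<rho>1_bd: "\<exists>C\<ge>0. (p = \<infinity> \<and> (AE z in M. \<rho>1 z \<le> C)) \<or>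
      (\<exists>p'\<ge>1. p = ennreal p' \<and> (AE t in A. (\<integral>\<^sup>+ x. ennreal (\<rho>1 (t, x) powr p') \<partial>X) \<le> ennreal (C powr p')))"
    using ex_density_transported[OF p r1] by (elim bexE conjE)
  obtain \<rho>2 where \<rho>2[measurable]: "\<rho>2 \<in> borel_measurable M" and \<rho>2_nn: "\<forall>z. 0 \<le> \<rho>2 z"
    and \<rho>2_V: "\<forall>g\<in>V. integrable M (\<lambda>z. \<rho>2 z * g z)"
    and \<rho>2_eq: "\<forall>\<phi>\<in>?F. integrable X (\<lambda>x. r2 x * \<phi> (0, x)) \<and> (LINT z|M. \<rho>2 z * transport \<phi> z) = (LINT x|X. r2 x * \<phi> (0, x))"
    and \<rho>2_bd: "\<exists>C\<ge>0. (p = \<infinity> \<and> (AE z in M. \<rho>2 z \<le> C)) \<or>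
      (\<exists>p'\<ge>1. p = ennreal p' \<and> (AE t in A. (\<integral>\<^sup>+ x. ennreal (\<rho>2 (t, x) powr p') \<partial>X) \<le> ennreal (C powr p')))"
    using ex_density_transported[OF p r2] by (elim bexE conjE)
  obtain C1 where C1: "0 \<le> C1" and bd1: "(p = \<infinity> \<and> (AE z in M. \<rho>1 z \<le> C1)) \<or>
      (\<exists>p'\<ge>1. p = ennreal p' \<and> (AE t in A. (\<integral>\<^sup>+ x. ennreal (\<rho>1 (t, x) powr p') \<partial>X) \<le> ennreal (C1 powr p')))"
    using \<rho>1_bd by (elim exE conjE)
  obtain C2 where C2: "0 \<le> C2" and bd2: "(p = \<infinity> \<and> (AE z in M. \<rho>2 z \<le> C2)) \<or>
      (\<exists>p'\<ge>1. p = ennreal p' \<and> (AE t in A. (\<integral>\<^sup>+ x. ennreal (\<rho>2 (t, x) powr p') \<partial>X) \<le> ennreal (C2 powr p')))"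
    using \<rho>2_bd by (elim exE conjE)
  define \<rho> where "\<rho> z = \<rho>1 z - \<rho>2 z" for z
  have \<rho>_meas[measurable]: "\<rho> \<in> borel_measurable M"
    unfolding \<rho>_def by measurable
  \<comment> \<open>Both densities are nonnegative, so their difference is bounded by the larger
    one. Powers of it are then at most the sum of the two powers, without a constant.\<close>
  have \<rho>_abs: "\<bar>\<rho> z\<bar> \<le> max (\<rho>1 z) (\<rho>2 z)" for z
    using \<rho>1_nn[rule_format, of z] \<rho>2_nn[rule_format, of z] by (simp add: \<rho>_def abs_if max_def)
  have slice: "(\<lambda>x. \<rho> (t, x)) \<in> borel_measurable X" if "t \<in> space A" for t
    using \<rho>_meas that by (rule P.measurable_slice)
  have \<rho>_Linf: "(\<lambda>t x. \<rho> (t, x)) \<in> Linf_time_Lp T p \<Omega>"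
  proof (cases "p = \<infinity>")
    case True
    then have "AE z in M. \<rho>1 z \<le> C1" "AE z in M. \<rho>2 z \<le> C2"
      using bd1 bd2 by simp_all
    then have "AE z in M. \<bar>\<rho> z\<bar> \<le> max C1 C2"
      by eventually_elim (rule order_trans[OF \<rho>_abs max.mono])
    then have "AE t in A. AE x in X. \<bar>\<rho> (t, x)\<bar> \<le> max C1 C2"
      by (rule P.AE_pair)
    with AE_space have "AE t in A. (\<lambda>x. \<rho> (t, x)) \<in> Lp_space p \<Omega> \<and> Lp_norm p \<Omega> (\<lambda>x. \<rho> (t, x)) \<le> ennreal (max C1 C2)"
    proof eventually_elim
      case (elim t)
      have [measurable]: "(\<lambda>x. \<rho> (t, x)) \<in> borel_measurable X"
        using elim(1) by (rule slice)
      have "AE x in X. ennreal (norm (\<rho> (t, x))) \<le> ennreal (max C1 C2)"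
        using elim(2) by eventually_elim (simp add: ennreal_leI)
      then have "Lp_norm p \<Omega> (\<lambda>x. \<rho> (t, x)) \<le> ennreal (max C1 C2)"
        unfolding Lp_norm_def if_P[OF True] by (intro esssup_I) measurable
      moreover from this have "Lp_norm p \<Omega> (\<lambda>x. \<rho> (t, x)) < \<infinity>"
        by (rule le_less_trans) simp
      ultimately show ?case
        by (simp add: Lp_space_def)
    qed
    then have "\<exists>C::real. AE t in A. (\<lambda>x. \<rho> (t, x)) \<in> Lp_space p \<Omega> \<and> Lp_norm p \<Omega> (\<lambda>x. \<rho> (t, x)) \<le> ennreal C"
      by (rule exI)
    moreover have "(\<lambda>(t, x). \<rho> (t, x)) \<in> borel_measurable (lebesgue_on ({0<..<T} \<times> \<Omega>))"
      using lebesgue_on_Times_measurable[OF \<rho>_meas] by (simp add: case_prod_beta')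
    ultimately show ?thesis
      unfolding Linf_time_Lp_def mem_Collect_eq using True by (intro conjI impI) simp_all
  next
    case False
    then have "\<exists>p'\<ge>1. p = ennreal p' \<and> (AE t in A. (\<integral>\<^sup>+ x. ennreal (\<rho>1 (t, x) powr p') \<partial>X) \<le> ennreal (C1 powr p'))"
      "\<exists>p'\<ge>1. p = ennreal p' \<and> (AE t in A. (\<integral>\<^sup>+ x. ennreal (\<rho>2 (t, x) powr p') \<partial>X) \<le> ennreal (C2 powr p'))"
      using bd1 bd2 by simp_all
    then obtain p' p'' where p': "1 \<le> p'" "p = ennreal p'" and p'': "1 \<le> p''" "p = ennreal p''"
      and b: "AE t in A. (\<integral>\<^sup>+ x. ennreal (\<rho>1 (t, x) powr p') \<partial>X) \<le> ennreal (C1 powr p')"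
      "AE t in A. (\<integral>\<^sup>+ x. ennreal (\<rho>2 (t, x) powr p'') \<partial>X) \<le> ennreal (C2 powr p'')"
      by (elim exE conjE)
    have "p'' = p'"
      using p' p'' by simp
    note b = b[unfolded this]
    define D where "D = C1 powr p' + C2 powr p'"
    have D: "0 \<le> D"
      by (simp add: D_def)
    have I_le: "AE t in A. (\<integral>\<^sup>+ x. ennreal (norm (\<rho> (t, x)) powr p') \<partial>X) \<le> ennreal D"
      using b AE_space
    proof eventually_elim
      case (elim t)
      have [measurable]: "(\<lambda>x. \<rho>1 (t, x)) \<in> borel_measurable X" "(\<lambda>x. \<rho>2 (t, x)) \<in> borel_measurable X"
        using P.measurable_slice[OF \<rho>1 elim(3)] P.measurable_slice[OF \<rho>2 elim(3)] by simp_all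
      have "(\<integral>\<^sup>+ x. ennreal (norm (\<rho> (t, x)) powr p') \<partial>X)
        \<le> (\<integral>\<^sup>+ x. ennreal (\<rho>1 (t, x) powr p') + ennreal (\<rho>2 (t, x) powr p') \<partial>X)"
      proof (rule nn_integral_mono)
        fix x
        have "norm (\<rho> (t, x)) powr p' \<le> max (\<rho>1 (t, x)) (\<rho>2 (t, x)) powr p'"
          using \<rho>_abs[of "(t, x)"] p'(1) by (intro powr_mono2) auto
        also have "\<dots> \<le> \<rho>1 (t, x) powr p' + \<rho>2 (t, x) powr p'"
          by (simp add: max_def)
        finally have "ennreal (norm (\<rho> (t, x)) powr p') \<le> ennreal (\<rho>1 (t, x) powr p' + \<rho>2 (t, x) powr p')"
          by (rule ennreal_leI)
        also have "\<dots> = ennreal (\<rho>1 (t, x) powr p') + ennreal (\<rho>2 (t, x) powr p')"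
          by (rule ennreal_plus) simp_all
        finally show "ennreal (norm (\<rho> (t, x)) powr p') \<le> ennreal (\<rho>1 (t, x) powr p') + ennreal (\<rho>2 (t, x) powr p')" .
      qed
      also have "\<dots> = (\<integral>\<^sup>+ x. ennreal (\<rho>1 (t, x) powr p') \<partial>X) + (\<integral>\<^sup>+ x. ennreal (\<rho>2 (t, x) powr p') \<partial>X)"
        by (intro nn_integral_add) measurable
      also have "\<dots> \<le> ennreal (C1 powr p') + ennreal (C2 powr p')"
        using elim(1,2) by (rule add_mono)
      also have "\<dots> = ennreal D"
        unfolding D_def by (rule ennreal_plus[symmetric]) simp_all
      finally show ?case .
    qed
    have "(\<integral>\<^sup>+ z. ennreal (\<bar>\<rho> z\<bar> powr p') \<partial>M) = (\<integral>\<^sup>+ t. \<integral>\<^sup>+ x. ennreal (\<bar>\<rho> (t, x)\<bar> powr p') \<partial>X \<partial>A)"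
      by (rule X.nn_integral_fst[symmetric]) measurable
    also have "\<dots> \<le> (\<integral>\<^sup>+ t. ennreal D \<partial>A)"
      using I_le by (intro nn_integral_mono_AE) simp
    also have "\<dots> < \<infinity>"
      using A.emeasure_finite[of "space A", unfolded less_top] by (simp add: ennreal_mult_less_top)
    finally have fin: "(\<integral>\<^sup>+ z. ennreal (\<bar>\<rho> z\<bar> powr p') \<partial>M) < \<infinity>" .
    have bd: "AE t in A. (\<lambda>x. \<rho> (t, x)) \<in> Lp_space p \<Omega> \<and> Lp_norm p \<Omega> (\<lambda>x. \<rho> (t, x)) \<le> ennreal (D powr (1 / p'))"
      using I_le AE_space
    proof eventually_elim
      case (elim t)
      define I where "I = (\<integral>\<^sup>+ x. ennreal (norm (\<rho> (t, x)) powr p') \<partial>X)"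
      have I: "I \<le> ennreal D"
        using elim(1) by (simp only: I_def)
      then have I_fin: "I < \<infinity>"
        by (rule le_less_trans) simp
      have "enn2real I \<le> D"
        using enn2real_mono[OF I] D by simp
      then have "enn2real I powr (1 / p') \<le> D powr (1 / p')"
        using p'(1) by (intro powr_mono2) simp_all
      moreover have "Lp_norm p \<Omega> (\<lambda>x. \<rho> (t, x)) = ennreal (enn2real I powr (1 / p'))"
        using I_fin unfolding p'(2) Lp_norm_finite_exponent[OF p'(1)] Let_def I_def[symmetric] by simp
      ultimately show ?case
        using slice[OF elim(2)] by (simp add: Lp_space_def ennreal_leI)
    qed
    then have "AE t in A. (\<lambda>x. \<rho> (t, x)) \<in> Lp_space (ennreal p') \<Omega>"
      unfolding p'(2) by eventually_elim (rule conjunct1)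
    from bochner_measurable_Lp[OF T open_\<Omega> bounded_\<Omega> p'(1) \<rho>_meas fin this]
    have "bochner_measurable T (Lp_space p \<Omega>) (Lp_norm p \<Omega>) (\<lambda>t x. \<rho> (t, x))"
      unfolding p'(2) .
    moreover have "\<exists>C::real. AE t in A. (\<lambda>x. \<rho> (t, x)) \<in> Lp_space p \<Omega> \<and> Lp_norm p \<Omega> (\<lambda>x. \<rho> (t, x)) \<le> ennreal C"
      using bd by (rule exI)
    moreover have "(\<lambda>(t, x). \<rho> (t, x)) \<in> borel_measurable (lebesgue_on ({0<..<T} \<times> \<Omega>))"
      using lebesgue_on_Times_measurable[OF \<rho>_meas] by (simp add: case_prod_beta')
    ultimately show ?thesis
      unfolding Linf_time_Lp_def mem_Collect_eq by (intro conjI impI)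
  qed
  have \<rho>_V: "integrable M (\<lambda>z. \<rho> z * g z)" "(LINT z|M. \<rho> z * g z) = (LINT z|M. \<rho>1 z * g z) - (LINT z|M. \<rho>2 z * g z)"
    if "g \<in> V" for g
    using bspec[OF \<rho>1_V that] bspec[OF \<rho>2_V that] by (simp_all add: \<rho>_def left_diff_distrib)
  have "- (LINT t|A. LINT x|X. \<rho> (t, x) * deriv (\<lambda>s. \<phi> (s, x)) t) - (LINT x|X. \<rho>0 x * \<phi> (0, x))
      + (LINT t|A. LINT x|X. \<rho> (t, x) * (u t x \<bullet> grad (\<lambda>y. \<phi> (t, y)) x)) = 0"
    if \<phi>: "\<phi> \<in> ?F" for \<phi>
  proof -
    interpret \<phi>: velocity_test T \<Omega> q w \<phi>
      using \<phi> by (rule velocity_test)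
    have "(LINT t|A. LINT x|X. \<rho> (t, x) * deriv (\<lambda>s. \<phi> (s, x)) t) = (LINT t|A. LINT x|X. \<rho> (t, x) * \<phi>.tf.d\<phi> (t, x) (1, 0))"
      by (intro Bochner_Integration.integral_cong) (simp_all add: \<phi>.tf.time_deriv(2))
    also have "\<dots> = (LINT z|M. \<rho> z * \<phi>.tf.d\<phi> z (1, 0))"
      using P.integral_fst'[OF \<rho>_V(1)[OF \<phi>.time_deriv_V]] by simp
    finally have time: "(LINT t|A. LINT x|X. \<rho> (t, x) * deriv (\<lambda>s. \<phi> (s, x)) t) = (LINT z|M. \<rho> z * \<phi>.tf.d\<phi> z (1, 0))" .
    \<comment> \<open>Here the original velocity returns: at almost every time \<open>u\<close> may
      be exchanged for \<open>w\<close> under the spatial integral.\<close>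
    have "AE t in A. (LINT x|X. \<rho> (t, x) * (u t x \<bullet> grad (\<lambda>y. \<phi> (t, y)) x)) = (LINT x|X. \<rho> (t, x) * \<phi>.flux (t, x))"
      using u AE_space
    proof eventually_elim
      case (elim t)
      then have t: "t \<in> {0<..<T}" and w_u: "AE x in X. w t x = u t x"
        by simp_all
      have "AE x in X. \<rho> (t, x) * (u t x \<bullet> grad (\<lambda>y. \<phi> (t, y)) x) = \<rho> (t, x) * \<phi>.flux (t, x)"
        using w_u AE_space
      proof eventually_elim
        case (elim x)
        then have "u t x \<bullet> grad (\<lambda>y. \<phi> (t, y)) x = \<phi>.tf.d\<phi> (t, x) (0, w t x)"
          using inner_grad[OF \<phi>.tf.space_deriv, of t x "u t x"] t by simp
        then show ?case
          using t elim by (simp add: \<phi>.flux_def)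
      qed
      moreover have "(\<lambda>x. \<rho> (t, x) * \<phi>.flux (t, x)) \<in> borel_measurable X"
        by (intro borel_measurable_times slice elim V_slice(1)[OF \<phi>.flux_V t])
      ultimately show ?case
        using open_\<Omega> by (intro integral_cong_lebesgue_on_AE) simp_all
    qed
    then have "(LINT t|A. LINT x|X. \<rho> (t, x) * (u t x \<bullet> grad (\<lambda>y. \<phi> (t, y)) x)) = (LINT t|A. LINT x|X. \<rho> (t, x) * \<phi>.flux (t, x))"
      using P.integrable_fst'[OF \<rho>_V(1)[OF \<phi>.flux_V]]
      by (intro integral_cong_lebesgue_on_AE borel_measurable_integrable) simp_all
    also have "\<dots> = (LINT z|M. \<rho> z * \<phi>.flux z)"
      using P.integral_fst'[OF \<rho>_V(1)[OF \<phi>.flux_V]] by simp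
    finally have flux: "(LINT t|A. LINT x|X. \<rho> (t, x) * (u t x \<bullet> grad (\<lambda>y. \<phi> (t, y)) x)) = (LINT z|M. \<rho> z * \<phi>.flux z)" .
    \<comment> \<open>The duality identity is split into its time and flux parts, each integrable on
      its own, which yields the three terms of the weak formulation.\<close>
    have "(LINT x|X. \<rho>0 x * \<phi> (0, x)) = (LINT x|X. r1 x * \<phi> (0, x)) - (LINT x|X. r2 x * \<phi> (0, x))"
      using bspec[OF \<rho>1_eq \<phi>] bspec[OF \<rho>2_eq \<phi>] by (simp add: r_diff left_diff_distrib)
    also have "\<dots> = (LINT z|M. \<rho> z * transport \<phi> z)"
      using \<rho>_V(2)[OF \<phi>.transport_V] bspec[OF \<rho>1_eq \<phi>] bspec[OF \<rho>2_eq \<phi>] by simp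
    also have "\<dots> = (LINT z|M. - (\<rho> z * \<phi>.tf.d\<phi> z (1, 0)) + \<rho> z * \<phi>.flux z)"
      by (intro Bochner_Integration.integral_cong) (simp_all add: space_M \<phi>.transport_eq algebra_simps)
    also have "\<dots> = - (LINT z|M. \<rho> z * \<phi>.tf.d\<phi> z (1, 0)) + (LINT z|M. \<rho> z * \<phi>.flux z)"
      using \<rho>_V(1)[OF \<phi>.time_deriv_V] \<rho>_V(1)[OF \<phi>.flux_V] by simp
    finally show ?thesis
      using time flux by simp
  qed
  then have "transport_weak_solution T p \<Omega> u \<rho>0 (\<lambda>t x. \<rho> (t, x))"
    unfolding transport_weak_solution_def using \<rho>_Linf by (intro conjI ballI)
  then show ?thesis
    using \<rho>_Linf by (intro exI conjI)
qed

end

theorem theorem4: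
  fixes \<Omega> :: "(real ^ 'n) set" and T :: real and p q :: ennreal
    and \<rho>0 :: "real ^ 'n \<Rightarrow> real" and u :: "real \<Rightarrow> real ^ 'n \<Rightarrow> real ^ 'n"
  assumes "open \<Omega>" and "bounded \<Omega>" and "connected \<Omega>" and "simply_connected \<Omega>"
    and "smooth_boundary \<Omega>"
    and "T > 0"
    and "1 < p" and "1 / p + 1 / q = 1"
    and "\<rho>0 \<in> Lp_space p \<Omega>"
    and "u \<in> L1_time T (W10_space q \<Omega>) (W1_norm q \<Omega>)"
    and "weakly_divergence_free T \<Omega> u"
  shows "\<exists>\<rho>. \<rho> \<in> Linf_time_Lp T p \<Omega> \<and> transport_weak_solution T p \<Omega> u \<rho>0 \<rho>"
proof -
  obtain q' where q': "1 \<le> q'" "q = ennreal q'"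
    using conjugate_exponent_cases[OF assms(7,8)] by (metis less_imp_le order_refl)
  have "\<exists>w. velocity T \<Omega> q' w \<and>
    (AE t in lebesgue_on {0<..<T}. u t \<in> borel_measurable (lebesgue_on \<Omega>) \<and> (AE x in lebesgue_on \<Omega>. w t x = u t x))"
    using assms(6,1,2) q'(1) assms(10)[unfolded q'(2)] assms(11) by (rule L1_time_imp_velocity)
  then obtain w where w: "velocity T \<Omega> q' w"
    "AE t in lebesgue_on {0<..<T}. u t \<in> borel_measurable (lebesgue_on \<Omega>) \<and> (AE x in lebesgue_on \<Omega>. w t x = u t x)"
    by (elim exE conjE)
  show ?thesis
    by (rule velocity.ex_weak_solution[OF w(1) assms(7) assms(8)[unfolded q'(2)] assms(9) w(2)])
qed

end
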